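(* Fix $m>3/2$ and let $h\in L^2(m)$ be an initial datum with total mass $M=\int_{\mathbb{R}}h(\xi)\,d\xi$. Let $$p=-2\inf_{y\in\mathbb{R}}\int_{-\infty}^{y}h(x)\,dx,\qquad q=2\sup_{y\in\mathbb{R}}\int_{y}^{\infty}h(x)\,dx,$$ and let $N_{p,q}$ be the corresponding inviscid N-wave. For $\mu>0$ let $w=w^{\mu}(\xi,\tau)$ be the solution of the rescaled Burgers equation with viscosity $\mu$, $$\partial_\tau w=\mu\,\partial_\xi^2 w+\tfrac12\partial_\xi(\xi w)-w\,\partial_\xi w,\qquad w|_{\tau=0}=h.$$ Then for every $\delta>0$ there exist $\mu_0\in(0,1)$ and a constant $C>0$ such that for every $\mu\in(0,\mu_0)$ there is a time $T=T(\mu)$ with $0<T\le C|\log\mu|$ and $$\|w^{\mu}(\cdot,T)-N_{p,q}\|_{L^2(m)}\le\delta .$$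
   Context: For $m\ge 0$, $L^2(m)=\{w\in L^2(\mathbb{R}):\|w\|_{L^2(m)}^2=\int_{\mathbb{R}}(1+\xi^2)^m|w(\xi)|^2\,d\xi<\infty\}$. The rescaled equation is obtained from Burgers equation $\partial_t u=\mu\,\partial_x^2u-u\,u_x$, $u|_{t=0}=h$, by the change of variables $u(x,t)=\frac{1}{\sqrt{1+t}}\,w\!\left(\frac{x}{\sqrt{1+t}},\log(1+t)\right)$, $\xi=x/\sqrt{1+t}$, $\tau=\log(1+t)$. The initial datum $h$ does not depend on $\mu$. The inviscid N-wave with parameters $p,q\ge 0$ is $N_{p,q}(\xi)=\xi$ if $-\sqrt p<\xi<\sqrt q$, and $N_{p,q}(\xi)=0$ otherwise. *)

theory Defs
  imports "HOL-Analysis.Analysis"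
begin

text \<open>
  The space \<open>L\<^sup>2(m)\<close>; elements are Borel representatives, and functions that agree almost
  everywhere are not identified.
\<close>

definition weighted_L2 :: "real \<Rightarrow> (real \<Rightarrow> real) set" where
  "weighted_L2 m =
     {w \<in> borel_measurable lborel. integrable lborel (\<lambda>\<xi>. (1 + \<xi>\<^sup>2) powr m * (w \<xi>)\<^sup>2)}"

text \<open>The Bochner integral is \<open>0\<close> when the integrand is not integrable, so the following is
  meaningful only on \<^term>\<open>weighted_L2 m\<close>.\<close>

definition weighted_L2_norm :: "real \<Rightarrow> (real \<Rightarrow> real) \<Rightarrow> real" where
  "weighted_L2_norm m w = sqrt (LINT \<xi>|lborel. (1 + \<xi>\<^sup>2) powr m * (w \<xi>)\<^sup>2)"

definition N_wave :: "real \<Rightarrow> real \<Rightarrow> real \<Rightarrow> real" where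
  "N_wave p q \<xi> = (if - sqrt p < \<xi> \<and> \<xi> < sqrt q then \<xi> else 0)"

text \<open>
  A solution with initial datum \<open>h\<close> is a curve in \<open>C([0,\<infinity>); L\<^sup>2(m))\<close> starting at \<open>h\<close> that
  satisfies the equation classically at positive times; arguments of \<open>w\<close> are \<open>\<xi>\<close>, then \<open>\<tau>\<close>.
  Here \<open>w1\<close> and \<open>w2\<close> are the first and second derivatives in \<open>\<xi>\<close>. Continuity of the
  \<open>\<tau>\<close>-derivative follows from the equation, so \<open>w\<close> is of class \<open>C\<^sup>2\<close> in \<open>\<xi>\<close> and \<open>C\<^sup>1\<close> in \<open>\<tau>\<close>.
\<close>

definition rescaled_Burgers_solution ::
    "real \<Rightarrow> real \<Rightarrow> (real \<Rightarrow> real) \<Rightarrow> (real \<Rightarrow> real \<Rightarrow> real) \<Rightarrow> bool" where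
  "rescaled_Burgers_solution m \<mu> h w \<longleftrightarrow>
     (AE \<xi> in lborel. w \<xi> 0 = h \<xi>) \<and>
     (\<forall>\<tau>\<ge>0. (\<lambda>\<xi>. w \<xi> \<tau>) \<in> weighted_L2 m) \<and>
     (\<forall>\<tau>\<ge>0. ((\<lambda>s. weighted_L2_norm m (\<lambda>\<xi>. w \<xi> s - w \<xi> \<tau>)) \<longlongrightarrow> 0) (at \<tau> within {0..})) \<and>
     (\<exists>w1 w2.
        continuous_on (UNIV \<times> {0<..}) (\<lambda>(\<xi>, \<tau>). w \<xi> \<tau>) \<and>
        continuous_on (UNIV \<times> {0<..}) (\<lambda>(\<xi>, \<tau>). w1 \<xi> \<tau>) \<and>
        continuous_on (UNIV \<times> {0<..}) (\<lambda>(\<xi>, \<tau>). w2 \<xi> \<tau>) \<and>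
        (\<forall>\<xi>. \<forall>\<tau>>0.
           ((\<lambda>\<eta>. w \<eta> \<tau>) has_real_derivative w1 \<xi> \<tau>) (at \<xi>) \<and>
           ((\<lambda>\<eta>. w1 \<eta> \<tau>) has_real_derivative w2 \<xi> \<tau>) (at \<xi>) \<and>
           ((\<lambda>s. w \<xi> s) has_real_derivative
              \<mu> * w2 \<xi> \<tau> + 1/2 * deriv (\<lambda>\<eta>. \<eta> * w \<eta> \<tau>) \<xi> - w \<xi> \<tau> * w1 \<xi> \<tau>) (at \<tau>)))"

end

theory Submission
  imports Defs "HOL-Probability.Probability"
begin

text \<open>
  The scaling variables enter only through the weight. With \<open>\<sigma> = exp \<tau>\<close> and \<open>t = \<sigma> - 1\<close> the function
  \<open>u x t = w (x / sqrt \<sigma>) (ln \<sigma>) / sqrt \<sigma>\<close> solves the ordinary Burgers equation with viscosity \<open>\<mu>\<close>.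
  The rescaled time \<open>T\<close> can be chosen independently of \<open>\<mu>\<close>: first \<open>T\<close> is taken so large that the
  inviscid solution is close to the N-wave, then \<open>\<mu>\<close> so small that viscosity changes little up to
  time \<open>T\<close>. As \<open>\<bar>ln \<mu>\<bar>\<close> is bounded below for \<open>\<mu> < \<mu>0\<close>, such a \<open>T\<close> is at most \<open>C * \<bar>ln \<mu>\<bar>\<close>. What
  needs proof is that all estimates are uniform in \<open>\<mu>\<close>.

  \<^bold>\<open>Cole-Hopf.\<close> The potential \<open>W x t\<close>, the integral of \<open>u\<close> over \<open>(-\<infinity>, x]\<close>, satisfies
  \<open>W\<^sub>t = \<mu> W\<^sub>x\<^sub>x - W\<^sub>x\<^sup>2 / 2\<close>, so \<open>exp (- W / (2 \<mu>))\<close> is a bounded solution of the heat equation and is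
  given by the heat kernel applied to \<open>exp (- H / (2 \<mu>))\<close>, where \<open>H\<close> is the primitive of \<open>h\<close>
  (\<open>cole_hopf\<close>). A given solution comes without any decay of its derivatives, so every
  integration by parts is done against a cutoff whose contribution disappears in the limit.

  \<^bold>\<open>Uniform consequences.\<close> The formula bounds \<open>W\<close>, makes \<open>W x t - x\<^sup>2 / (2 t)\<close> concave in \<open>x\<close>
  (\<open>W_tangent\<close>, which is Oleinik's one-sided inequality in integrated form), hence
  \<open>\<bar>u\<bar> \<le> const / sqrt t\<close> (\<open>u_bound\<close>). Laplace's method squeezes \<open>W\<close> between two Hopf-Lax type
  infima of \<open>(x - y)\<^sup>2 / (2 t) + H y\<close> (\<open>W_lower\<close>, \<open>W_upper\<close>). For large \<open>t\<close> only three values of \<open>H\<close>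
  matter: \<open>0\<close> at \<open>-\<infinity>\<close>, the mass \<open>(q - p) / 2\<close> at \<open>\<infinity>\<close> and the infimum \<open>- p / 2\<close>, and these
  three branches form exactly the primitive of the N-wave (\<open>W_above_wave\<close>, \<open>W_below_wave\<close>).

  \<^bold>\<open>From \<open>W\<close> to \<open>w\<close>.\<close> Functions that are concave up to a fixed quadratic and uniformly close have
  close slopes wherever the limit is smooth. This gives convergence of \<open>w\<close> to the N-wave away from
  the two shocks, while near them \<open>w\<close> is at least bounded.

  \<^bold>\<open>Tails.\<close> No pointwise bound controls the weighted norm at infinity. Instead, the weight
  \<open>(\<bar>x\<bar> - r t)\<^sub>+ powr (2 m)\<close> is used, with a front \<open>r t\<close> whose speed is \<open>2/3\<close> of the bound
  \<open>const / sqrt t\<close> of \<open>\<bar>u\<bar>\<close>. The motion of the front absorbs the cubic term of the energy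
  identity, and the energy with weight \<open>1\<close> plus this one grows at most by the factor
  \<open>exp (const * \<mu> * t)\<close> (\<open>outer_energy\<close>). As \<open>r t\<close> is of order \<open>sqrt \<sigma>\<close>, the region beyond it contains
  \<open>\<bar>\<xi>\<bar> > R\<close> for a fixed \<open>R\<close>, where the change of variables gains \<open>\<sigma> powr (1/2 - m)\<close>. Everything is
  put together in \<open>distance_to_wave\<close>.
\<close>

section \<open>A polynomial cutoff\<close>

text \<open>
  On \<open>[c - L, c + L]\<close> this polynomial vanishes to second order at both ends and has a critical point
  at \<open>c\<close>. Integrating by parts twice over the whole interval therefore leaves no boundary terms, and
  over the left half only the value at \<open>c\<close>. \<open>cutoff'\<close> and \<open>cutoff''\<close>
  are the derivatives in \<open>y\<close>.
\<close>

definition cutoff :: "real \<Rightarrow> real \<Rightarrow> real \<Rightarrow> real" where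
  "cutoff L c y = (1 - ((y - c) / L)\<^sup>2)\<^sup>2"
definition cutoff' :: "real \<Rightarrow> real \<Rightarrow> real \<Rightarrow> real" where
  "cutoff' L c y = - 4 * ((y - c) / L) * (1 - ((y - c) / L)\<^sup>2) / L"
definition cutoff'' :: "real \<Rightarrow> real \<Rightarrow> real \<Rightarrow> real" where
  "cutoff'' L c y = (12 * ((y - c) / L)\<^sup>2 - 4) / L\<^sup>2"

lemma cutoff_deriv:
  assumes L: "L > 0"
  shows "(cutoff L c has_real_derivative cutoff' L c y) (at y)"
    "(cutoff' L c has_real_derivative cutoff'' L c y) (at y)"
proof -
  have lin: "((\<lambda>y. (y - c) / L) has_real_derivative 1 / L) (at y)"
    using L by (auto intro!: derivative_eq_intros)
  have 1: "((\<lambda>z. (1 - z\<^sup>2)\<^sup>2) has_real_derivative - 4 * z * (1 - z\<^sup>2)) (at z)" for z :: real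
    by (rule derivative_eq_intros refl | simp add: algebra_simps power2_eq_square)+
  have 2: "((\<lambda>z. - 4 * z * (1 - z\<^sup>2)) has_real_derivative 12 * z\<^sup>2 - 4) (at z)" for z :: real
    by (rule derivative_eq_intros refl | simp add: algebra_simps power2_eq_square)+
  show "(cutoff L c has_real_derivative cutoff' L c y) (at y)"
    using DERIV_chain2[OF 1 lin] by (simp add: cutoff_def[abs_def] cutoff'_def)
  show "(cutoff' L c has_real_derivative cutoff'' L c y) (at y)"
    using DERIV_cdivide[OF DERIV_chain2[OF 2 lin], of L]
    by (simp add: cutoff'_def[abs_def] cutoff''_def power2_eq_square)
qed

lemma cutoff_cont [continuous_intros]:
  assumes "continuous_on S f"
  shows "continuous_on S (\<lambda>x. cutoff L c (f x))" "continuous_on S (\<lambda>x. cutoff' L c (f x))"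
    "continuous_on S (\<lambda>x. cutoff'' L c (f x))"
  unfolding cutoff_def cutoff'_def cutoff''_def divide_inverse by (intro continuous_intros assms)+

lemma cutoff_measurable [measurable]: "cutoff L c \<in> borel_measurable borel"
  unfolding cutoff_def [abs_def] by measurable

lemma cutoff_bounds:
  assumes L: "L > 0" and y: "\<bar>y - c\<bar> \<le> L"
  shows "0 \<le> cutoff L c y" "cutoff L c y \<le> 1"
    "\<bar>cutoff' L c y\<bar> \<le> 4 * \<bar>y - c\<bar> / L\<^sup>2" "\<bar>cutoff' L c y\<bar> \<le> 4 / L" "\<bar>cutoff'' L c y\<bar> \<le> 8 / L\<^sup>2"
proof -
  define z where "z = (y - c) / L"
  have z: "\<bar>z\<bar> \<le> 1" using L y by (simp add: z_def)
  have z2: "0 \<le> z\<^sup>2" "z\<^sup>2 \<le> 1" using z by (auto simp: abs_square_le_1)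
  show "0 \<le> cutoff L c y" "cutoff L c y \<le> 1"
    using z2 by (auto simp: cutoff_def z_def[symmetric] power_le_one)
  have "\<bar>- 4 * z * (1 - z\<^sup>2)\<bar> = 4 * \<bar>z\<bar> * (1 - z\<^sup>2)" using z2 by (simp add: abs_mult)
  also have "\<dots> \<le> 4 * \<bar>z\<bar> * 1" using z2 by (intro mult_left_mono) auto
  finally have "\<bar>- 4 * z * (1 - z\<^sup>2)\<bar> / L \<le> 4 * \<bar>z\<bar> / L" using L by (intro divide_right_mono) auto
  hence 1: "\<bar>cutoff' L c y\<bar> \<le> 4 * \<bar>z\<bar> / L" using L by (simp add: cutoff'_def z_def[symmetric])
  also have "\<dots> = 4 * \<bar>y - c\<bar> / L\<^sup>2" using L by (simp add: z_def power2_eq_square)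
  finally show "\<bar>cutoff' L c y\<bar> \<le> 4 * \<bar>y - c\<bar> / L\<^sup>2" .
  have "4 * \<bar>z\<bar> / L \<le> 4 / L" using z L by (intro divide_right_mono) auto
  thus "\<bar>cutoff' L c y\<bar> \<le> 4 / L" using 1 by linarith
  have "\<bar>12 * z\<^sup>2 - 4\<bar> \<le> 8" unfolding abs_le_iff using z2 by linarith
  thus "\<bar>cutoff'' L c y\<bar> \<le> 8 / L\<^sup>2"
    by (simp add: cutoff''_def z_def[symmetric] divide_right_mono)
qed

lemma cutoff_values:
  "cutoff L c c = 1" "cutoff' L c c = 0"
  "L > 0 \<Longrightarrow> cutoff L c (c - L) = 0" "L > 0 \<Longrightarrow> cutoff' L c (c - L) = 0"
  "L > 0 \<Longrightarrow> cutoff L c (c + L) = 0" "L > 0 \<Longrightarrow> cutoff' L c (c + L) = 0"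
  by (auto simp: cutoff_def cutoff'_def)

lemma cutoff_indicator_bound:
  assumes "L > 0"
  shows "\<bar>indicator {c-L..c+L} y * cutoff L c y\<bar> \<le> 1"
proof (cases "y \<in> {c-L..c+L}")
  case True
  hence "\<bar>y - c\<bar> \<le> L" by (auto simp: abs_le_iff)
  from cutoff_bounds(1,2)[OF assms this] True show ?thesis by auto
qed auto

lemma filterlim_real_plus_1: "filterlim (\<lambda>n. real n + 1) at_top sequentially"
  by (rule filterlim_at_top_mono[OF filterlim_real_sequentially]) auto

lemma cutoff_LINT_tendsto:
  fixes f :: "real \<Rightarrow> real"
  assumes f: "integrable lborel f"
  shows "(\<lambda>n. LINT y|lborel. indicator {c-(real n + 1)..c+(real n + 1)} y * cutoff (real n + 1) c y * f y)
    \<longlonglongrightarrow> (LINT y|lborel. f y)"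
proof (rule integral_dominated_convergence[where w="\<lambda>y. \<bar>f y\<bar>"])
  show "AE y in lborel. (\<lambda>n. indicator {c-(real n + 1)..c+(real n + 1)} y * cutoff (real n + 1) c y * f y) \<longlonglongrightarrow> f y"
  proof (intro always_eventually allI)
    fix y
    have "\<forall>\<^sub>F n in sequentially. \<bar>y - c\<bar> \<le> real n + 1"
      by (rule eventually_sequentiallyI[of "nat \<lceil>\<bar>y - c\<bar>\<rceil>"]) linarith
    hence "\<forall>\<^sub>F n in sequentially. 1 = indicat_real {c-(real n + 1)..c+(real n + 1)} y"
      by eventually_elim (auto simp: indicator_def)
    hence 1: "(\<lambda>n. indicat_real {c-(real n + 1)..c+(real n + 1)} y) \<longlonglongrightarrow> 1"
      by (rule Lim_transform_eventually[OF tendsto_const])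
    have "(\<lambda>n. (1 - ((y - c) / (real n + 1))\<^sup>2)\<^sup>2) \<longlonglongrightarrow> (1 - 0\<^sup>2)\<^sup>2"
      by (intro tendsto_intros real_tendsto_divide_at_top[OF tendsto_const filterlim_real_plus_1])
    hence "(\<lambda>n. cutoff (real n + 1) c y) \<longlonglongrightarrow> 1" by (simp add: cutoff_def)
    from tendsto_mult[OF tendsto_mult[OF 1 this] tendsto_const[of "f y"]]
    show "(\<lambda>n. indicator {c-(real n + 1)..c+(real n + 1)} y * cutoff (real n + 1) c y * f y) \<longlonglongrightarrow> f y" by simp
  qed
  show "AE y in lborel. norm (indicator {c-(real n + 1)..c+(real n + 1)} y * cutoff (real n + 1) c y * f y) \<le> \<bar>f y\<bar>" for n
    unfolding real_norm_def abs_mult[of _ "f _"]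
    using cutoff_indicator_bound[of "real n + 1" c] by (intro always_eventually allI mult_left_le_one_le) auto
qed (use f in auto)

section \<open>Calculus in the half plane\<close>

text \<open>
  The time domain is an open interval since solutions are classical at positive times only.
\<close>

lemma has_derivative_under_integral:
  fixes F Ft :: "real \<Rightarrow> real \<Rightarrow> real"
  assumes der: "\<And>x t. x \<in> {a..b} \<Longrightarrow> t \<in> {0<..<c} \<Longrightarrow> ((\<lambda>t. F x t) has_real_derivative Ft x t) (at t)"
    and cF: "\<And>t. t \<in> {0<..<c} \<Longrightarrow> continuous_on {a..b} (\<lambda>x. F x t)"
    and cFt: "continuous_on ({a..b} \<times> {0<..<c}) (\<lambda>z. Ft (fst z) (snd z))"
    and t: "t \<in> {0<..<c}"
  shows "((\<lambda>t. integral {a..b} (\<lambda>x. F x t)) has_real_derivative integral {a..b} (\<lambda>x. Ft x t)) (at t)"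
proof -
  have "((\<lambda>t. integral (cbox a b) (\<lambda>x. F x t)) has_field_derivative
          integral (cbox a b) (\<lambda>x. Ft x t)) (at t within {0<..<c})"
  proof (rule leibniz_rule_field_derivative[where f="\<lambda>t x. F x t" and fx="\<lambda>t x. Ft x t"])
    show "((\<lambda>t. F y t) has_field_derivative Ft y t) (at t within {0<..<c})"
      if "t \<in> {0<..<c}" "y \<in> cbox a b" for t y
      using has_field_derivative_at_within[OF der[of y t]] that by auto
    show "(\<lambda>x. F x t) integrable_on cbox a b" if "t \<in> {0<..<c}" for t
      using cF[OF that] by (auto intro: integrable_continuous_real)
    show "continuous_on ({0<..<c} \<times> cbox a b) (\<lambda>(t, x). Ft x t)"
    proof -
      have "continuous_on ({0<..<c} \<times> cbox a b) (\<lambda>z. (snd z, fst z))" by (intro continuous_intros)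
      moreover have "(\<lambda>z. (snd z, fst z)) ` ({0<..<c} \<times> cbox a b) \<subseteq> {a..b} \<times> {0<..<c}" by auto
      ultimately have "continuous_on ({0<..<c} \<times> cbox a b) (\<lambda>z. Ft (fst (snd z, fst z)) (snd (snd z, fst z)))"
        by (rule continuous_on_compose2[OF cFt])
      thus ?thesis by (simp add: split_beta)
    qed
  qed (use t in auto)
  thus ?thesis using t by (simp add: at_within_open[of t "{0<..<c}"])
qed

lemma increment_bound:
  fixes f :: "real \<Rightarrow> real"
  assumes S: "convex S" "a \<in> S" "b \<in> S"
    and D: "\<And>r. r \<in> S \<Longrightarrow> \<exists>D. (f has_real_derivative D) (at r) \<and> \<bar>D\<bar> \<le> K"
  shows "\<bar>f a - f b\<bar> \<le> K * \<bar>a - b\<bar>"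
proof -
  have d: "(f has_real_derivative deriv f r) (at r)" "\<bar>deriv f r\<bar> \<le> K" if "r \<in> S" for r
    using D[OF that] DERIV_imp_deriv by (metis, metis)
  have "norm (f a - f b) \<le> K * norm (a - b)"
  proof (rule field_differentiable_bound[where S=S and f'="deriv f"])
    show "(f has_field_derivative deriv f r) (at r within S)" if "r \<in> S" for r
      by (rule has_field_derivative_at_within[OF d(1)[OF that]])
  qed (use S d(2) in auto)
  thus ?thesis by simp
qed

lemma integral_by_FTC:
  fixes Q q :: "real \<Rightarrow> real"
  assumes "a \<le> b" "\<And>x. x \<in> {a..b} \<Longrightarrow> (Q has_real_derivative q x) (at x)"
  shows "(q has_integral (Q b - Q a)) {a..b}"
  using has_field_derivative_at_within[OF assms(2)] assms(1) by (intro fundamental_theorem_of_calculus)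
    (auto simp: has_real_derivative_iff_has_vector_derivative[symmetric])

lemma hk_integral_eq_LINT:
  fixes f :: "real \<Rightarrow> real"
  assumes "continuous_on {a..b} f"
  shows "integral {a..b} f = (LINT x|lborel. indicator {a..b} x * f x)"
    "integrable lborel (\<lambda>x. indicator {a..b} x * f x)"
  using set_borel_integral_eq_integral(2)[OF borel_integrable_atLeastAtMost'[OF assms]]
    borel_integrable_atLeastAtMost'[OF assms]
  by (auto simp: set_lebesgue_integral_def set_integrable_def)

lemma hk_integral_le_LINT:
  fixes f :: "real \<Rightarrow> real"
  assumes "continuous_on {a..b} f" "integrable lborel f" "\<And>x. 0 \<le> f x"
  shows "integral {a..b} f \<le> (LINT x|lborel. f x)"
  unfolding hk_integral_eq_LINT(1)[OF assms(1)]
  by (intro integral_mono hk_integral_eq_LINT(2) assms) (auto simp: indicator_def assms(3))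

lemma has_derivative_from_partials:
  fixes f f1 f2 :: "real \<Rightarrow> real \<Rightarrow> real"
  assumes f1: "\<And>x t. t > 0 \<Longrightarrow> ((\<lambda>y. f y t) has_real_derivative f1 x t) (at x)"
    and f2: "\<And>x t. t > 0 \<Longrightarrow> ((\<lambda>s. f x s) has_real_derivative f2 x t) (at t)"
    and c2: "continuous_on (UNIV \<times> {0<..}) (\<lambda>z. f2 (fst z) (snd z))" and t: "t > 0"
  shows "((\<lambda>z. f (fst z) (snd z)) has_derivative (\<lambda>z. f1 x t * fst z + f2 x t * snd z)) (at (x, t))"
proof -
  have "((\<lambda>(x, y). f x y) has_derivative (\<lambda>(tx, ty). f1 x t * tx + blinfun_mult_right (f2 x t) ty))
     (at (x, t) within UNIV \<times> {0<..})"
  proof (rule has_derivative_partialsI[where fy="\<lambda>x t. blinfun_mult_right (f2 x t)"])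
    show "((\<lambda>x. f x t) has_derivative (*) (f1 x t)) (at x within UNIV)"
      using f1[OF t] by (simp add: has_field_derivative_def)
    show "((\<lambda>y. f x y) has_derivative blinfun_apply (blinfun_mult_right (f2 x y))) (at y within {0<..})" if "y \<in> {0<..}" for x y
      using has_derivative_at_withinI[OF f2[of y x, unfolded has_field_derivative_def]] that by auto
    have "continuous_on (UNIV \<times> {0<..}) (\<lambda>z. blinfun_mult_right (f2 (fst z) (snd z)))"
      by (intro bounded_linear.continuous_on[OF bounded_linear_blinfun_mult_right] c2)
    thus "continuous (at (x, t) within UNIV \<times> {0<..}) (\<lambda>(x, t). blinfun_mult_right (f2 x t))"
      using t by (simp add: continuous_on_eq_continuous_within case_prod_unfold)
  qed (use t in auto)
  moreover have "open (UNIV \<times> {0::real<..} :: (real \<times> real) set)" by (intro open_Times) auto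
  ultimately show ?thesis
    using t by (subst (asm) at_within_open) (auto simp: case_prod_unfold)
qed

lemma chain_rule_from_partials:
  fixes f f1 f2 :: "real \<Rightarrow> real \<Rightarrow> real"
  assumes f1: "\<And>x t. t > 0 \<Longrightarrow> ((\<lambda>y. f y t) has_real_derivative f1 x t) (at x)"
    and f2: "\<And>x t. t > 0 \<Longrightarrow> ((\<lambda>s. f x s) has_real_derivative f2 x t) (at t)"
    and c2: "continuous_on (UNIV \<times> {0<..}) (\<lambda>z. f2 (fst z) (snd z))"
    and a: "(a has_real_derivative a') (at t)" and b: "(b has_real_derivative b') (at t)" and pos: "b t > 0"
  shows "((\<lambda>t. f (a t) (b t)) has_real_derivative f1 (a t) (b t) * a' + f2 (a t) (b t) * b') (at t)"
proof -
  have G: "((\<lambda>t. (a t, b t)) has_derivative (\<lambda>h. (a' * h, b' * h))) (at t)"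
    using a b by (intro has_derivative_Pair) (auto simp: has_field_derivative_def)
  have "(\<lambda>h. f1 (a t) (b t) * (a' * h) + f2 (a t) (b t) * (b' * h)) = (*) (f1 (a t) (b t) * a' + f2 (a t) (b t) * b')"
    by (auto simp: fun_eq_iff algebra_simps)
  with has_derivative_compose[OF G has_derivative_from_partials[of f f1 f2, OF f1 f2 c2 pos]] show ?thesis
    by (simp add: has_field_derivative_def)
qed

section \<open>Solutions of the viscous Burgers equation and their potential\<close>

text \<open>
  \<open>H\<close> is the primitive of the initial datum. The datum itself never enters: the initial condition is
  the pointwise convergence of the primitives. \<open>A\<close> is a bound of \<open>H\<close> that does not depend on \<open>\<mu>\<close>,
  whereas the norms in \<open>bounded_norms\<close> may depend on \<open>\<mu>\<close>; they only serve to let cutoffs tend to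
  infinity.
\<close>

locale viscous_burgers =
  fixes \<mu> :: real and u ux uxx :: "real \<Rightarrow> real \<Rightarrow> real" and H :: "real \<Rightarrow> real" and A :: real
  assumes mu_pos: "\<mu> > 0"
    and cont_u: "continuous_on (UNIV \<times> {0<..}) (\<lambda>z. u (fst z) (snd z))"
    and cont_ux: "continuous_on (UNIV \<times> {0<..}) (\<lambda>z. ux (fst z) (snd z))"
    and cont_uxx: "continuous_on (UNIV \<times> {0<..}) (\<lambda>z. uxx (fst z) (snd z))"
    and u_x: "\<And>x t. t > 0 \<Longrightarrow> ((\<lambda>y. u y t) has_real_derivative ux x t) (at x)"
    and ux_x: "\<And>x t. t > 0 \<Longrightarrow> ((\<lambda>y. ux y t) has_real_derivative uxx x t) (at x)"
    and u_t: "\<And>x t. t > 0 \<Longrightarrow> ((\<lambda>s. u x s) has_real_derivative \<mu> * uxx x t - u x t * ux x t) (at t)"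
    and L1: "\<And>t. t > 0 \<Longrightarrow> integrable lborel (\<lambda>x. u x t)"
    and L2: "\<And>t. t > 0 \<Longrightarrow> integrable lborel (\<lambda>x. (u x t)\<^sup>2)"
    and bounded_norms: "\<And>T. \<exists>B. \<forall>t. 0 < t \<and> t \<le> T \<longrightarrow>
          (LINT x|lborel. \<bar>u x t\<bar>) \<le> B \<and> (LINT x|lborel. (u x t)\<^sup>2) \<le> B"
    and initial: "\<And>x. ((\<lambda>t. LINT y:{..x}|lborel. u y t) \<longlongrightarrow> H x) (at_right 0)"
    and H_cont: "continuous_on UNIV H"
    and H_bound: "\<And>x. \<bar>H x\<bar> \<le> A"
begin

lemma cont_compose [continuous_intros]:
  assumes "continuous_on S f" "continuous_on S g" "\<And>z. z \<in> S \<Longrightarrow> 0 < g z"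
  shows "continuous_on S (\<lambda>z. u (f z) (g z))" "continuous_on S (\<lambda>z. ux (f z) (g z))"
    "continuous_on S (\<lambda>z. uxx (f z) (g z))"
  using continuous_on_compose2[OF cont_u, of S "\<lambda>z. (f z, g z)"]
    continuous_on_compose2[OF cont_ux, of S "\<lambda>z. (f z, g z)"]
    continuous_on_compose2[OF cont_uxx, of S "\<lambda>z. (f z, g z)"] assms
  by (auto intro!: continuous_intros)

definition W :: "real \<Rightarrow> real \<Rightarrow> real" where
  "W x t = (LINT y:{..x}|lborel. u y t)"

definition flux :: "real \<Rightarrow> real \<Rightarrow> real" where
  "flux x t = \<mu> * ux x t - (u x t)\<^sup>2 / 2"

lemma flux_x: "t > 0 \<Longrightarrow> ((\<lambda>y. flux y t) has_real_derivative \<mu> * uxx x t - u x t * ux x t) (at x)"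
  unfolding flux_def by (rule derivative_eq_intros u_x ux_x refl | simp)+

lemma W_x:
  assumes t: "t > 0"
  shows "((\<lambda>x. W x t) has_real_derivative u x t) (at x)"
proof -
  let ?a = "x - 1"
  have c: "continuous_on S (\<lambda>y. u y t)" for S using t by (intro continuous_intros) auto
  have int: "set_integrable lborel S (\<lambda>y. u y t)" if "S \<in> sets borel" for S
    unfolding set_integrable_def by (rule integrable_mult_indicator) (use L1[OF t] that in auto)
  have eq: "W y t = W ?a t + integral {?a..y} (\<lambda>z. u z t)" if "y \<in> {?a<..<x+1}" for y
  proof -
    have "W y t = (LINT z:{..?a}|lborel. u z t) + (LINT z:{?a<..y}|lborel. u z t)"
      unfolding W_def using that
      by (subst set_integral_Un[symmetric]) (auto simp: ivl_disj_un intro!: int)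
    also have "(LINT z:{?a<..y}|lborel. u z t) = (LINT z:{?a..y}|lborel. u z t)"
      unfolding set_lebesgue_integral_def
      by (intro integral_cong_AE) 
        (use AE_lborel_singleton[of ?a] borel_measurable_integrable[OF L1[OF t]] in \<open>auto elim!: eventually_mono simp: indicator_def\<close>)
    also have "\<dots> = integral {?a..y} (\<lambda>z. u z t)"
      using set_borel_integral_eq_integral(2)[OF borel_integrable_atLeastAtMost'[OF c]] .
    finally show ?thesis by (simp add: W_def)
  qed
  have "((\<lambda>y. integral {?a..y} (\<lambda>z. u z t)) has_real_derivative u x t) (at x within {?a..x+1})"
    by (rule integral_has_real_derivative[OF c]) auto
  hence "((\<lambda>y. integral {?a..y} (\<lambda>z. u z t)) has_real_derivative u x t) (at x)"
    by (simp add: at_within_Icc_at)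
  hence "((\<lambda>y. W ?a t + integral {?a..y} (\<lambda>z. u z t)) has_real_derivative u x t) (at x)"
    by (auto intro!: derivative_eq_intros)
  thus ?thesis
    by (rule has_field_derivative_transform_within_open[of _ _ _ "{?a<..<x+1}"]) (auto simp: eq)
qed

text \<open>
  The time derivative of \<open>W\<close> cannot be computed under the improper integral, because nothing is known
  about \<open>ux\<close> at infinity. With the cutoff the far boundary term of the flux disappears, and what is
  left involves only \<open>u\<close> and \<open>u\<^sup>2\<close>, whose integrals are finite.
\<close>

definition smooth_W :: "real \<Rightarrow> real \<Rightarrow> real \<Rightarrow> real" where
  "smooth_W L x t = integral {x-L..x} (\<lambda>y. cutoff L x y * u y t)"

lemma smooth_W_t:
  assumes L: "L > 0" and t: "t > 0" and B: "(LINT x|lborel. \<bar>u x t\<bar>) \<le> B" "(LINT x|lborel. (u x t)\<^sup>2) \<le> B"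
  shows "\<exists>D. ((\<lambda>t. smooth_W L x t) has_real_derivative D) (at t) \<and> \<bar>D - flux x t\<bar> \<le> (8 * \<mu> / L\<^sup>2 + 2 / L) * B"
proof -
  define X X1 X2 where "X = cutoff L x" and "X1 = cutoff' L x" and "X2 = cutoff'' L x"
  note X_defs = X_def X1_def X2_def
  define g where "g y = \<mu> * X2 y * u y t + X1 y * (u y t)\<^sup>2 / 2" for y
  have 1: "((\<lambda>t. smooth_W L x t) has_real_derivative
      integral {x-L..x} (\<lambda>y. cutoff L x y * (\<mu> * uxx y t - u y t * ux y t))) (at t)"
    unfolding smooth_W_def
  proof (rule has_derivative_under_integral[where c = "t + 1"])
    show "((\<lambda>t. cutoff L x y * u y t) has_real_derivative cutoff L x y * (\<mu> * uxx y t - u y t * ux y t)) (at t)"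
      if "t \<in> {0<..<t'}" for t t' y
      using DERIV_cmult[OF u_t[of t y], of "cutoff L x y"] that by simp
  qed (use t in \<open>auto intro!: continuous_intros\<close>)
  have gi: "g integrable_on {x-L..x}"
    unfolding g_def X_defs using t by (intro integrable_continuous_real continuous_intros) auto
  \<comment> \<open>up to the error \<open>g\<close> the integrand is the derivative of \<open>X * flux - \<mu> * X1 * u\<close>\<close>
  have 2: "((\<lambda>y. X y * (\<mu> * uxx y t - u y t * ux y t) - g y) has_integral
     ((X x * flux x t - \<mu> * X1 x * u x t) - (X (x-L) * flux (x-L) t - \<mu> * X1 (x-L) * u (x-L) t))) {x-L..x}"
    apply (rule integral_by_FTC)
    using L apply simp
    apply (rule derivative_eq_intros cutoff_deriv[OF L, of x, folded X_defs] flux_x u_x t refl)+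
    apply (simp add: g_def flux_def algebra_simps power2_eq_square)
    done
  have 3: "X x = 1" "X1 x = 0" "X (x-L) = 0" "X1 (x-L) = 0"
    using L by (simp_all add: X_defs cutoff_values)
  have "((\<lambda>y. X y * (\<mu> * uxx y t - u y t * ux y t) - g y + g y) has_integral (flux x t + integral {x-L..x} g)) {x-L..x}"
    using 2 gi unfolding 3 by (intro has_integral_add) (auto simp: integrable_integral)
  hence 4: "integral {x-L..x} (\<lambda>y. X y * (\<mu> * uxx y t - u y t * ux y t)) = flux x t + integral {x-L..x} g"
    by (simp add: integral_unique)
  have "norm (integral {x-L..x} g) \<le> integral {x-L..x} (\<lambda>y. 8 * \<mu> / L\<^sup>2 * \<bar>u y t\<bar> + 2 / L * (u y t)\<^sup>2)"
  proof (rule integral_norm_bound_integral[OF gi])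
    show "(\<lambda>y. 8 * \<mu> / L\<^sup>2 * \<bar>u y t\<bar> + 2 / L * (u y t)\<^sup>2) integrable_on {x-L..x}"
      using t by (intro integrable_continuous_real continuous_intros) auto
    fix y assume y: "y \<in> {x-L..x}"
    have y1: "\<bar>y - x\<bar> \<le> L" using y by (auto simp: abs_le_iff)
    note X = cutoff_bounds[OF L y1, folded X_defs]
    have "\<mu> * (\<bar>X2 y\<bar> * \<bar>u y t\<bar>) \<le> \<mu> * (8 / L\<^sup>2 * \<bar>u y t\<bar>)"
        "\<bar>X1 y\<bar> * (u y t)\<^sup>2 \<le> 4 / L * (u y t)\<^sup>2"
      using mu_pos X by (intro mult_right_mono mult_left_mono; simp)+
    moreover have "\<bar>\<mu> * X2 y * u y t\<bar> = \<mu> * (\<bar>X2 y\<bar> * \<bar>u y t\<bar>)" "\<bar>X1 y * (u y t)\<^sup>2\<bar> = \<bar>X1 y\<bar> * (u y t)\<^sup>2"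
      using mu_pos by (simp_all add: abs_mult)
    ultimately show "norm (g y) \<le> 8 * \<mu> / L\<^sup>2 * \<bar>u y t\<bar> + 2 / L * (u y t)\<^sup>2"
      unfolding g_def by (simp add: algebra_simps) linarith
  qed
  also have "\<dots> \<le> (LINT y|lborel. 8 * \<mu> / L\<^sup>2 * \<bar>u y t\<bar> + 2 / L * (u y t)\<^sup>2)"
    using L1[OF t] L2[OF t] L mu_pos t by (intro hk_integral_le_LINT continuous_intros) auto
  also have "\<dots> = 8 * \<mu> / L\<^sup>2 * (LINT y|lborel. \<bar>u y t\<bar>) + 2 / L * (LINT y|lborel. (u y t)\<^sup>2)"
    using L1[OF t] L2[OF t] by simp
  also have "\<dots> \<le> 8 * \<mu> / L\<^sup>2 * B + 2 / L * B"
    using L mu_pos B by (intro add_mono mult_left_mono) auto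
  finally show ?thesis using 1 unfolding 4[unfolded X_def] by (intro exI[of _ "flux x t + integral {x-L..x} g"]) (auto simp: algebra_simps)
qed

lemma smooth_W_tendsto:
  assumes t: "t > 0"
  shows "(\<lambda>n. smooth_W (real n + 1) x t) \<longlonglongrightarrow> W x t"
proof -
  have "smooth_W (real n + 1) x t = (LINT y|lborel. indicator {x-(real n + 1)..x+(real n + 1)} y *
     cutoff (real n + 1) x y * (indicator {..x} y * u y t))" for n
    unfolding smooth_W_def using t
    by (subst hk_integral_eq_LINT) (auto intro!: continuous_intros Bochner_Integration.integral_cong simp: indicator_def)
  moreover have "integrable lborel (\<lambda>y. indicat_real {..x} y * u y t)"
    using integrable_mult_indicator[OF _ L1[OF t], of "{..x}"] by simp
  ultimately show ?thesis
    using cutoff_LINT_tendsto[of "\<lambda>y. indicat_real {..x} y * u y t" x] by (simp add: W_def set_lebesgue_integral_def)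
qed

text \<open>
  On a compact time interval the derivatives of \<open>smooth_W L\<close> converge uniformly to the flux, so their
  limit \<open>W\<close> differs from a time primitive of the flux by a constant. In particular no flux comes in
  from \<open>-\<infinity>\<close>.
\<close>

lemma W_t:
  assumes t: "t > 0"
  shows "((\<lambda>s. W x s) has_real_derivative flux x t) (at t)"
proof -
  let ?I = "{t/2<..<2*t}"
  define K where "K s = integral {t/2..s} (\<lambda>s. flux x s)" for s
  have K: "(K has_real_derivative flux x s) (at s)" if "s \<in> ?I" for s
  proof -
    have "(K has_real_derivative flux x s) (at s within {t/2..2*t})"
      unfolding K_def using t that
      by (intro integral_has_real_derivative) (auto simp: flux_def intro!: continuous_intros)
    thus ?thesis using that by (simp add: at_within_Icc_at)
  qed
  obtain B where B: "\<And>s. 0 < s \<Longrightarrow> s \<le> 2*t \<Longrightarrow> (LINT x|lborel. \<bar>u x s\<bar>) \<le> B"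
      "\<And>s. 0 < s \<Longrightarrow> s \<le> 2*t \<Longrightarrow> (LINT x|lborel. (u x s)\<^sup>2) \<le> B"
    using bounded_norms[of "2*t"] by blast
  have eq: "W x s - K s = W x t - K t" if s: "s \<in> ?I" for s
  proof -
    have "\<bar>(smooth_W (real n + 1) x s - K s) - (smooth_W (real n + 1) x t - K t)\<bar> \<le> (8 * \<mu> / (real n + 1)\<^sup>2 + 2 / (real n + 1)) * B * \<bar>s - t\<bar>" for n
    proof (rule increment_bound[where f="\<lambda>r. smooth_W (real n + 1) x r - K r" and S="?I"])
      fix r assume r: "r \<in> ?I"
      hence "0 < r" "r \<le> 2 * t" "0 < real n + 1" using t by auto
      from smooth_W_t[OF this(3,1) B[OF this(1,2)], of x] obtain D
        where D: "((\<lambda>t. smooth_W (real n + 1) x t) has_real_derivative D) (at r)"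
          "\<bar>D - flux x r\<bar> \<le> (8 * \<mu> / (real n + 1)\<^sup>2 + 2 / (real n + 1)) * B" by (elim exE conjE)
      show "\<exists>D. ((\<lambda>r. smooth_W (real n + 1) x r - K r) has_real_derivative D) (at r) \<and>
          \<bar>D\<bar> \<le> (8 * \<mu> / (real n + 1)\<^sup>2 + 2 / (real n + 1)) * B"
        using DERIV_diff[OF D(1) K[OF r]] D(2) by blast
    qed (use t s in auto)
    moreover have "(\<lambda>n. \<bar>(smooth_W (real n + 1) x s - K s) - (smooth_W (real n + 1) x t - K t)\<bar>) \<longlonglongrightarrow> \<bar>(W x s - K s) - (W x t - K t)\<bar>"
      using s t by (intro tendsto_intros smooth_W_tendsto) auto
    moreover have "(\<lambda>n. (8 * \<mu> / (real n + 1)\<^sup>2 + 2 / (real n + 1)) * B * \<bar>s - t\<bar>) \<longlonglongrightarrow> (0 + 0) * B * \<bar>s - t\<bar>"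
      by (intro tendsto_intros real_tendsto_divide_at_top[OF tendsto_const]
           filterlim_pow_at_top filterlim_real_plus_1) auto
    ultimately have "\<bar>(W x s - K s) - (W x t - K t)\<bar> \<le> (0 + 0) * B * \<bar>s - t\<bar>"
      by (intro tendsto_le[OF trivial_limit_sequentially]) (auto intro!: always_eventually)
    thus ?thesis by simp
  qed
  have "((\<lambda>s. K s + (W x t - K t)) has_real_derivative flux x t) (at t)"
    using K[of t] t by (auto intro!: derivative_eq_intros)
  thus ?thesis
    by (rule has_field_derivative_transform_within_open[of _ _ _ ?I]) (use eq t in \<open>auto simp: algebra_simps\<close>)
qed

section \<open>The Cole-Hopf formula\<close>

definition heat :: "real \<Rightarrow> real \<Rightarrow> real" where
  "heat r z = exp (- z\<^sup>2 / (4 * \<mu> * r)) / sqrt (4 * pi * \<mu> * r)"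

lemma mu_nonzero [simp]: "\<mu> \<noteq> 0"
  using mu_pos by simp

lemma heat_exp: "r > 0 \<Longrightarrow> heat r z = exp (- z\<^sup>2 / (4 * \<mu> * r) - ln (4 * pi * \<mu> * r) / 2)"
  using mu_pos ln_sqrt[of "4 * pi * \<mu> * r"] by (simp add: heat_def exp_diff flip: ln_sqrt)

lemma heat_pos: "r > 0 \<Longrightarrow> heat r z > 0"
  using mu_pos by (simp add: heat_def)

lemma heat_normal_density: "r > 0 \<Longrightarrow> heat r (x - y) = normal_density x (sqrt (2 * \<mu> * r)) y"
  using mu_pos by (simp add: heat_def normal_density_def power2_commute mult.assoc)

lemma heat_z:
  assumes r: "r > 0"
  shows "((\<lambda>z. heat r z) has_real_derivative - (z / (2 * \<mu> * r)) * heat r z) (at z)"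
proof -
  have "((\<lambda>z. exp (- z\<^sup>2 / a - c)) has_real_derivative - (2 * z / a) * exp (- z\<^sup>2 / a - c)) (at z)"
    if "a \<noteq> 0" for a c :: real
    using that by (auto intro!: derivative_eq_intros simp: field_simps)
  from this[of "4 * \<mu> * r" "ln (4 * pi * \<mu> * r) / 2"] show ?thesis
    using r by (simp add: heat_exp[OF r] mult.assoc)
qed

lemma heat_zz:
  assumes r: "r > 0"
  shows "((\<lambda>z. - (z / (2 * \<mu> * r)) * heat r z) has_real_derivative
           (z\<^sup>2 / (4 * \<mu>\<^sup>2 * r\<^sup>2) - 1 / (2 * \<mu> * r)) * heat r z) (at z)"
proof -
  have "((\<lambda>z. - (z / (2 * \<mu> * r))) has_real_derivative - (1 / (2 * \<mu> * r))) (at z)"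
    using r by (auto intro!: derivative_eq_intros)
  from DERIV_mult[OF this heat_z[OF r]] show ?thesis
    by (rule DERIV_cong) (use r in \<open>simp add: field_simps power2_eq_square\<close>)
qed

lemma heat_r:
  assumes r: "r > 0"
  shows "((\<lambda>r. heat r z) has_real_derivative
           \<mu> * ((z\<^sup>2 / (4 * \<mu>\<^sup>2 * r\<^sup>2) - 1 / (2 * \<mu> * r)) * heat r z)) (at r)"
proof -
  have pos: "4 * pi * \<mu> * r > 0" "\<mu> \<noteq> 0" using r mu_pos by auto
  have 1: "((\<lambda>r. - z\<^sup>2 / (4 * \<mu> * r) - ln (4 * pi * \<mu> * r) / 2) has_real_derivative
      z\<^sup>2 / (4 * \<mu> * r\<^sup>2) - 1 / (2 * r)) (at r)"
    using pos r by (auto intro!: derivative_eq_intros simp: field_simps power2_eq_square)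
  have 2: "((\<lambda>r. exp (- z\<^sup>2 / (4 * \<mu> * r) - ln (4 * pi * \<mu> * r) / 2)) has_real_derivative
      heat r z * (z\<^sup>2 / (4 * \<mu> * r\<^sup>2) - 1 / (2 * r))) (at r)"
    using DERIV_fun_exp[OF 1] by (simp add: heat_exp[OF r])
  have 3: "heat r z * (z\<^sup>2 / (4 * \<mu> * r\<^sup>2) - 1 / (2 * r)) = \<mu> * ((z\<^sup>2 / (4 * \<mu>\<^sup>2 * r\<^sup>2) - 1 / (2 * \<mu> * r)) * heat r z)"
    using pos by (simp add: field_simps power2_eq_square)
  show ?thesis unfolding 3[symmetric]
    by (rule has_field_derivative_transform_within_open[OF 2, of "{0<..}"]) (use r in \<open>auto simp: heat_exp\<close>)
qed

lemma heat_cont [continuous_intros]: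
  assumes "continuous_on S f" "continuous_on S g" "\<And>z. z \<in> S \<Longrightarrow> 0 < f z"
  shows "continuous_on S (\<lambda>z. heat (f z) (g z))"
  unfolding heat_def using mu_pos assms(3) by (intro continuous_intros assms) (auto simp: less_imp_neq[symmetric])

lemma heat_integral:
  assumes r: "r > 0"
  shows "integrable lborel (\<lambda>y. heat r (x - y))" "(LINT y|lborel. heat r (x - y)) = 1"
    "integrable lborel (\<lambda>y. (x - y)\<^sup>2 * heat r (x - y))" "(LINT y|lborel. (x - y)\<^sup>2 * heat r (x - y)) = 2 * \<mu> * r"
proof -
  have s: "0 < sqrt (2 * \<mu> * r)" using mu_pos r by simp
  show "integrable lborel (\<lambda>y. heat r (x - y))" "(LINT y|lborel. heat r (x - y)) = 1"
    unfolding heat_normal_density[OF r] using s by auto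
  show "integrable lborel (\<lambda>y. (x - y)\<^sup>2 * heat r (x - y))"
    unfolding heat_normal_density[OF r] using integrable_normal_moment[OF s, of x 2]
    by (simp add: mult.commute power2_commute)
  show "(LINT y|lborel. (x - y)\<^sup>2 * heat r (x - y)) = 2 * \<mu> * r"
    unfolding heat_normal_density[OF r] using integral_normal_moment_even[OF s, of x 1] mu_pos r
    by (simp add: mult.commute power2_commute)
qed

text \<open>
  The Cole-Hopf transform, a solution of the heat equation (\<open>phi_xx\<close> and \<open>phi_t\<close>).
\<close>

definition phi :: "real \<Rightarrow> real \<Rightarrow> real" where "phi x t = exp (- W x t / (2 * \<mu>))"

lemma phi_x: "t > 0 \<Longrightarrow> ((\<lambda>x. phi x t) has_real_derivative - (u x t / (2 * \<mu>)) * phi x t) (at x)"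
  unfolding phi_def by (rule derivative_eq_intros W_x refl | simp)+

lemma phi_xx:
  assumes "t > 0"
  shows "((\<lambda>x. - (u x t / (2 * \<mu>)) * phi x t) has_real_derivative
           ((u x t)\<^sup>2 / (4 * \<mu>\<^sup>2) - ux x t / (2 * \<mu>)) * phi x t) (at x)"
  by (rule derivative_eq_intros phi_x u_x assms refl | simp)+ (use mu_pos in \<open>simp add: field_simps power2_eq_square\<close>)

lemma phi_t:
  assumes "t > 0"
  shows "((\<lambda>t. phi x t) has_real_derivative
           \<mu> * (((u x t)\<^sup>2 / (4 * \<mu>\<^sup>2) - ux x t / (2 * \<mu>)) * phi x t)) (at t)"
  unfolding phi_def
  by (rule derivative_eq_intros W_t assms refl | simp)+ (use mu_pos in \<open>simp add: flux_def field_simps power2_eq_square\<close>)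

lemma W_joint_cont: "continuous_on (UNIV \<times> {0<..}) (\<lambda>z. W (fst z) (snd z))"
proof (rule continuous_at_imp_continuous_on, safe)
  fix x t :: real assume t: "t > 0"
  have "continuous_on (UNIV \<times> {0<..}) (\<lambda>z. flux (fst z) (snd z))"
    unfolding flux_def by (intro continuous_intros) auto
  from has_derivative_from_partials[of W u flux, OF W_x W_t this t]
  show "isCont (\<lambda>z. W (fst z) (snd z)) (x, t)"
    by (rule has_derivative_continuous)
qed

lemma phi_cont [continuous_intros]:
  assumes "continuous_on S f" "continuous_on S g" "\<And>z. z \<in> S \<Longrightarrow> 0 < g z"
  shows "continuous_on S (\<lambda>z. phi (f z) (g z))"
  unfolding phi_def using continuous_on_compose2[OF W_joint_cont, of S "\<lambda>z. (f z, g z)"] assms mu_pos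
  by (auto intro!: continuous_intros)

lemma phi_bounded: "\<exists>C. \<forall>t. 0 < t \<and> t \<le> T \<longrightarrow> (\<forall>x. phi x t \<le> C)"
proof -
  obtain B where B: "\<And>t. 0 < t \<Longrightarrow> t \<le> T \<Longrightarrow> (LINT x|lborel. \<bar>u x t\<bar>) \<le> B"
    using bounded_norms[of T] by blast
  have "phi x t \<le> exp (B / (2 * \<mu>))" if t: "0 < t" "t \<le> T" for x t
  proof -
    have "\<bar>W x t\<bar> \<le> (LINT y|lborel. \<bar>u y t\<bar>)"
      unfolding W_def set_lebesgue_integral_def
    proof (rule order_trans[OF integral_abs_bound integral_mono])
      show "integrable lborel (\<lambda>y. \<bar>indicat_real {..x} y *\<^sub>R u y t\<bar>)"
        by (intro integrable_abs integrable_mult_indicator) (use L1[OF t(1)] in auto)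
    qed (use L1[OF t(1)] in \<open>auto simp: indicator_def\<close>)
    hence "- W x t \<le> B" using B[OF t] by linarith
    hence "- W x t / (2 * \<mu>) \<le> B / (2 * \<mu>)" using mu_pos by (intro divide_right_mono) auto
    thus ?thesis unfolding phi_def by simp
  qed
  thus ?thesis by blast
qed

text \<open>
  Uniqueness for the heat equation is obtained by duality: paired with the backward heat kernel that
  concentrates at \<open>(x, t)\<close>, a solution gives a constant in \<open>s\<close>. Because of the cutoff the pairing is
  only almost constant.
\<close>

definition dual_pairing :: "real \<Rightarrow> real \<Rightarrow> real \<Rightarrow> real \<Rightarrow> real" where
  "dual_pairing L x t s = integral {x-L..x+L} (\<lambda>y. cutoff L x y * heat (t - s) (x - y) * phi y s)"

text \<open>
  After two integrations by parts only derivatives of the cutoff remain. The first derivative of the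
  kernel is singular as \<open>s\<close> approaches \<open>t\<close>, but it is multiplied by \<open>cutoff'\<close>, which is
  \<open>O(\<bar>y - x\<bar> / L\<^sup>2)\<close>; the product is controlled by the second moment \<open>2 * \<mu> * (t - s)\<close> of the
  kernel, and this compensates the singularity. The bound is therefore uniform in \<open>s\<close>.
\<close>

lemma dual_pairing_deriv:
  assumes L: "L > 0" and s: "0 < s" "s < t" and C: "\<And>y. phi y s \<le> C"
  shows "\<exists>D. ((\<lambda>s. dual_pairing L x t s) has_real_derivative D) (at s) \<and> \<bar>D\<bar> \<le> 16 * \<mu> * C / L\<^sup>2"
proof -
  define X X1 X2 where "X = cutoff L x" and "X1 = cutoff' L x" and "X2 = cutoff'' L x"
  note X_defs = X_def X1_def X2_def
  define h hz hzz where "h r y = heat r (x - y)" and "hz r y = (x - y) / (2 * \<mu> * r) * heat r (x - y)"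
    and "hzz r y = ((x - y)\<^sup>2 / (4 * \<mu>\<^sup>2 * r\<^sup>2) - 1 / (2 * \<mu> * r)) * heat r (x - y)" for r y
  have dh: "((\<lambda>y. h r y) has_real_derivative hz r y) (at y)" "((\<lambda>y. hz r y) has_real_derivative hzz r y) (at y)" if r: "r > 0" for r y
  proof -
    have lin: "((\<lambda>y. x - y) has_real_derivative - 1) (at y)" by (auto intro!: derivative_eq_intros)
    show "((\<lambda>y. h r y) has_real_derivative hz r y) (at y)"
      using DERIV_chain2[OF heat_z[OF r] lin] by (simp add: h_def hz_def)
    show "((\<lambda>y. hz r y) has_real_derivative hzz r y) (at y)"
      using DERIV_minus[OF DERIV_chain2[OF heat_zz[OF r] lin]] by (simp add: hz_def hzz_def)
  qed
  define px pxx where "px y s = - (u y s / (2 * \<mu>)) * phi y s"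
    and "pxx y s = ((u y s)\<^sup>2 / (4 * \<mu>\<^sup>2) - ux y s / (2 * \<mu>)) * phi y s" for y s
  define g where "g y = \<mu> * ((X2 y * h (t - s) y + 2 * X1 y * hz (t - s) y) * phi y s)" for y
  define Ft where "Ft y s = X y * (- \<mu> * hzz (t - s) y * phi y s + h (t - s) y * (\<mu> * pxx y s))" for y s
  have 1: "((\<lambda>s. dual_pairing L x t s) has_real_derivative integral {x-L..x+L} (\<lambda>y. Ft y s)) (at s)"
    unfolding dual_pairing_def X_def[symmetric]
  proof (rule has_derivative_under_integral[where c = t])
    show "((\<lambda>s. X y * heat (t - s) (x - y) * phi y s) has_real_derivative Ft y s) (at s)"
      if "s \<in> {0<..<t}" for s y
    proof -
      have "((\<lambda>s. t - s) has_real_derivative - 1) (at s)" by (auto intro!: derivative_eq_intros)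
      from DERIV_chain2[OF heat_r[of "t - s" "x - y"] this]
      have 2: "((\<lambda>s. heat (t - s) (x - y)) has_real_derivative - \<mu> * hzz (t - s) y) (at s)"
        using that by (simp add: hzz_def)
      have 3: "((\<lambda>s. phi y s) has_real_derivative \<mu> * pxx y s) (at s)"
        using phi_t[of s y] that by (simp add: pxx_def)
      from DERIV_cmult[OF DERIV_mult[OF 2 3], of "X y"] show ?thesis
        unfolding Ft_def h_def by (simp add: algebra_simps)
    qed
    show "continuous_on {x - L..x + L} (\<lambda>y. X y * heat (t - s) (x - y) * phi y s)" if "s \<in> {0<..<t}" for s
      unfolding X_def using that by (intro continuous_intros) auto
    show "continuous_on ({x - L..x + L} \<times> {0<..<t}) (\<lambda>z. Ft (fst z) (snd z))"
      unfolding Ft_def X_def hzz_def h_def pxx_def using mu_pos by (intro continuous_intros) auto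
  qed (use s in auto)
  have cg: "continuous_on {x-L..x+L} g"
    unfolding g_def X_defs h_def hz_def using s mu_pos by (intro continuous_intros) auto
  define Q where "Q y = \<mu> * (X y * h (t-s) y * px y s - (X1 y * h (t-s) y + X y * hz (t-s) y) * phi y s)" for y
  have 2: "((\<lambda>y. Ft y s - g y) has_integral (Q (x+L) - Q (x-L))) {x-L..x+L}"
  proof (rule integral_by_FTC)
    fix y
    have r: "t - s > 0" using s by simp
    have p: "((\<lambda>y. phi y s) has_real_derivative px y s) (at y)" "((\<lambda>y. px y s) has_real_derivative pxx y s) (at y)"
      using phi_x[OF s(1), of y] phi_xx[OF s(1), of y] by (auto simp: px_def pxx_def)
    show "(Q has_real_derivative Ft y s - g y) (at y)"
      unfolding Q_def
      by (rule derivative_eq_intros cutoff_deriv[OF L, of x, folded X_defs] dh[OF r] p refl)+ (simp add: Ft_def g_def algebra_simps)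
  qed (use L in auto)
  have 3: "Q (x+L) = 0" "Q (x-L) = 0" using L by (auto simp: Q_def X_defs cutoff_values)
  have gi: "g integrable_on {x-L..x+L}" using cg by (rule integrable_continuous_real)
  have "((\<lambda>y. Ft y s - g y + g y) has_integral (0 - 0 + integral {x-L..x+L} g)) {x-L..x+L}"
    using 2 gi unfolding 3 by (intro has_integral_add) (auto simp: integrable_integral)
  hence 4: "integral {x-L..x+L} (\<lambda>y. Ft y s) = integral {x-L..x+L} g"
    by (simp add: integral_unique)
  have C0: "0 \<le> C" using C[of 0] by (rule order_trans[rotated]) (simp add: phi_def)
  define b where "b y = 8 * \<mu> * C / L\<^sup>2 * heat (t-s) (x-y) + 8 * \<mu> * C / L\<^sup>2 / (2 * \<mu> * (t-s)) * ((x-y)\<^sup>2 * heat (t-s) (x-y))" for y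
  have r: "t - s > 0" using s by simp
  have "norm (integral {x-L..x+L} g) \<le> integral {x-L..x+L} b"
  proof (rule integral_norm_bound_integral[OF gi])
    show "b integrable_on {x-L..x+L}"
      unfolding b_def using r by (intro integrable_continuous_real continuous_intros) auto
    fix y assume y: "y \<in> {x-L..x+L}"
    have y1: "\<bar>y - x\<bar> \<le> L" using y by (auto simp: abs_le_iff)
    note X = cutoff_bounds[OF L y1, folded X_defs]
    have h0: "0 < heat (t-s) (x-y)" using heat_pos[OF r] .
    have a: "\<bar>X2 y * h (t-s) y\<bar> \<le> 8 / L\<^sup>2 * heat (t-s) (x-y)"
      using h0 X(5) unfolding h_def abs_mult by (intro mult_mono) auto
    have "\<bar>X1 y\<bar> \<le> 4 * \<bar>x - y\<bar> / L\<^sup>2" using X(3) by (simp add: abs_minus_commute)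
    moreover have "\<bar>hz (t-s) y\<bar> = \<bar>x - y\<bar> / (2 * \<mu> * (t-s)) * heat (t-s) (x-y)"
      using r mu_pos h0 by (simp add: hz_def abs_mult)
    moreover have "0 \<le> \<bar>x - y\<bar> / (2 * \<mu> * (t-s)) * heat (t-s) (x-y)"
      using r mu_pos h0 by (intro mult_nonneg_nonneg divide_nonneg_pos) auto
    ultimately have "\<bar>X1 y\<bar> * \<bar>hz (t-s) y\<bar> \<le> (4 * \<bar>x - y\<bar> / L\<^sup>2) * (\<bar>x - y\<bar> / (2 * \<mu> * (t-s)) * heat (t-s) (x-y))"
      by (metis mult_right_mono)
    also have "\<dots> = 4 / L\<^sup>2 / (2 * \<mu> * (t-s)) * (\<bar>x - y\<bar>\<^sup>2 * heat (t-s) (x-y))"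
      by (simp add: power2_eq_square)
    finally have b: "\<bar>2 * X1 y * hz (t-s) y\<bar> \<le> 8 / L\<^sup>2 / (2 * \<mu> * (t-s)) * ((x - y)\<^sup>2 * heat (t-s) (x-y))"
      by (simp add: abs_mult)
    have "\<bar>g y\<bar> = \<mu> * (\<bar>X2 y * h (t - s) y + 2 * X1 y * hz (t - s) y\<bar> * phi y s)"
      using mu_pos by (simp add: g_def abs_mult phi_def)
    also have "\<dots> \<le> \<mu> * ((8 / L\<^sup>2 * heat (t-s) (x-y) + 8 / L\<^sup>2 / (2 * \<mu> * (t-s)) * ((x - y)\<^sup>2 * heat (t-s) (x-y))) * C)"
      using mu_pos a b C[of y] by (intro mult_left_mono mult_mono) (auto simp: phi_def)
    also have "\<dots> = b y" by (simp add: b_def algebra_simps)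
    finally show "norm (g y) \<le> b y" by simp
  qed
  also have "\<dots> \<le> (LINT y|lborel. b y)"
  proof (rule hk_integral_le_LINT)
    show "continuous_on {x - L..x + L} b" unfolding b_def using r by (intro continuous_intros) auto
    show "integrable lborel b" unfolding b_def using heat_integral(1,3)[OF r] by auto
    show "0 \<le> b y" for y unfolding b_def using heat_pos[OF r, of "x - y"] mu_pos C0 r
      by (intro add_nonneg_nonneg mult_nonneg_nonneg divide_nonneg_nonneg) auto
  qed
  also have "(LINT y|lborel. b y) = 16 * \<mu> * C / L\<^sup>2"
  proof -
    define k where "k = 2 * \<mu> * (t - s)"
    have "k \<noteq> 0" using r by (simp add: k_def)
    thus ?thesis unfolding b_def k_def[symmetric]
      using heat_integral[OF r, of x] by (simp add: k_def[symmetric])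
  qed
  finally show ?thesis using 1 unfolding 4 by (intro exI[of _ "integral {x-L..x+L} g"]) auto
qed

lemma phi_initial: "((\<lambda>t. phi x t) \<longlongrightarrow> exp (- H x / (2 * \<mu>))) (at_right 0)"
  unfolding phi_def using initial[of x] by (intro tendsto_intros) (auto simp: W_def)

lemma dual_pairing_LINT:
  assumes "L > 0" "0 < s" "s < t"
  shows "dual_pairing L x t s = (LINT y|lborel. indicator {x-L..x+L} y * (cutoff L x y * heat (t - s) (x - y) * phi y s))"
  unfolding dual_pairing_def by (rule hk_integral_eq_LINT) (use assms in \<open>auto intro!: continuous_intros\<close>)

lemma phi_measurable: "s > 0 \<Longrightarrow> (\<lambda>y. phi y s) \<in> borel_measurable borel"
  by (intro borel_measurable_continuous_onI continuous_intros) auto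

lemma heat_measurable [measurable]: "(\<lambda>y. heat r (x - y)) \<in> borel_measurable borel"
  unfolding heat_def by measurable

lemma dual_at_initial_time:
  assumes L: "L > 0" and t: "t > 0" and s: "s \<longlonglongrightarrow> 0" "\<And>n. 0 < s n" "\<And>n. s n \<le> t / 2"
  shows "(\<lambda>n. dual_pairing L x t (s n)) \<longlonglongrightarrow>
    (LINT y|lborel. indicator {x-L..x+L} y * (cutoff L x y * heat t (x - y) * exp (- H y / (2 * \<mu>))))"
proof -
  have st: "s n < t" for n using s(3)[of n] t by linarith
  have H[measurable]: "H \<in> borel_measurable borel"
    using H_cont by (rule borel_measurable_continuous_onI)
  note [measurable] = phi_measurable[OF s(2)]
  obtain C where C: "\<And>s y. 0 < s \<Longrightarrow> s \<le> t \<Longrightarrow> phi y s \<le> C" using phi_bounded[of t] by blast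
  have sr: "filterlim s (at_right 0) sequentially"
  proof -
    have "s n \<noteq> 0" for n using s(2)[of n] by simp
    thus ?thesis using s(1,2) by (auto simp: filterlim_at)
  qed
  let ?k = "\<lambda>n y. indicat_real {x-L..x+L} y * (cutoff L x y * heat (t - s n) (x - y) * phi y (s n))"
    and ?b = "sqrt (4 * pi * \<mu> * (t / 2))"
  show ?thesis unfolding dual_pairing_LINT[OF L s(2) st]
  proof (rule integral_dominated_convergence[where w="\<lambda>y. indicator {x-L..x+L} y * (C / ?b)"])
    show "integrable lborel (\<lambda>y. indicator {x-L..x+L} y * (C / ?b))"
      by (intro integrable_mult_left integrable_real_indicator) (auto simp: emeasure_lborel_Icc_eq)
    show "AE y in lborel. (\<lambda>n. ?k n y)
       \<longlonglongrightarrow> indicator {x-L..x+L} y * (cutoff L x y * heat t (x - y) * exp (- H y / (2 * \<mu>)))"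
    proof (intro always_eventually allI tendsto_mult tendsto_const)
      fix y
      show "(\<lambda>n. phi y (s n)) \<longlonglongrightarrow> exp (- H y / (2 * \<mu>))"
        using filterlim_compose[OF phi_initial sr] .
      have "(\<lambda>n. heat (t - s n) (x - y)) \<longlonglongrightarrow> heat (t - 0) (x - y)"
        unfolding heat_def using mu_pos t by (intro tendsto_intros s(1)) auto
      thus "(\<lambda>n. heat (t - s n) (x - y)) \<longlonglongrightarrow> heat t (x - y)" by simp
    qed
    show "AE y in lborel. norm (?k n y)
       \<le> indicator {x-L..x+L} y * (C / ?b)" for n
    proof (intro always_eventually allI)
      fix y
      have r: "t - s n > 0" "t - s n \<ge> t / 2" using st[of n] s(3)[of n] by auto
      have "heat (t - s n) (x - y) \<le> 1 / ?b"
        unfolding heat_def using mu_pos t r by (intro frac_le real_sqrt_le_mono mult_left_mono) auto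
      moreover have "phi y (s n) \<le> C" using C[of "s n" y] s(2)[of n] st[of n] by auto
      ultimately have 1: "heat (t - s n) (x - y) * phi y (s n) \<le> 1 / ?b * C"
        using heat_pos[OF r(1), of "x - y"] mu_pos t by (intro mult_mono) (auto simp: phi_def)
      have 2: "0 \<le> heat (t - s n) (x - y) * phi y (s n)"
        using heat_pos[OF r(1), of "x - y"] by (auto simp: phi_def)
      show "norm (?k n y)
       \<le> indicator {x-L..x+L} y * (C / ?b)"
      proof (cases "y \<in> {x-L..x+L}")
        case True
        have "norm (?k n y)
          = \<bar>indicator {x-L..x+L} y * cutoff L x y\<bar> * (heat (t - s n) (x - y) * phi y (s n))"
          using heat_pos[OF r(1), of "x - y"] by (simp add: abs_mult phi_def)
        also have "\<dots> \<le> 1 * (1 / ?b * C)"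
          by (rule mult_mono[OF cutoff_indicator_bound[OF L] 1 _ 2]) simp
        finally show ?thesis using True by simp
      qed auto
    qed
  qed measurable
qed

lemma dual_at_final_time:
  assumes L: "L > 0" and t: "t > 0" and r: "r \<longlonglongrightarrow> 0" "\<And>n. 0 < r n" "\<And>n. r n \<le> t / 2"
  shows "(\<lambda>n. dual_pairing L x t (t - r n)) \<longlonglongrightarrow> phi x t"
proof -
  have st: "0 < t - r n" "t - r n < t" for n using r(2,3)[of n] t by auto
  note [measurable] = phi_measurable[OF st(1)]
  obtain C where C: "\<And>s y. 0 < s \<Longrightarrow> s \<le> t \<Longrightarrow> phi y s \<le> C" using phi_bounded[of t] by blast
  \<comment> \<open>the substitution \<open>y = x + c n * z\<close> turns the kernel into the fixed standard normal density\<close>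
  define c where "c n = sqrt (2 * \<mu> * r n)" for n
  have c: "c n > 0" for n using mu_pos r(2) by (simp add: c_def)
  have c2: "(c n)\<^sup>2 = 2 * \<mu> * r n" for n using mu_pos r(2)[of n] by (simp add: c_def)
  have c0: "c \<longlonglongrightarrow> 0"
  proof -
    have "(\<lambda>n. sqrt (2 * \<mu> * r n)) \<longlonglongrightarrow> sqrt (2 * \<mu> * 0)" by (intro tendsto_intros r(1))
    thus ?thesis by (simp add: c_def[abs_def])
  qed
  have heat_c: "c n * heat (r n) (x - (x + c n * z)) = std_normal_density z" for n z
  proof -
    have "heat (r n) (x - (x + c n * z)) = exp (- (c n)\<^sup>2 * z\<^sup>2 / (2 * (c n)\<^sup>2)) / sqrt (2 * pi * (c n)\<^sup>2)"
      unfolding c2 by (simp add: heat_def c2 power_mult_distrib mult.assoc)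
    also have "\<dots> = exp (- z\<^sup>2 / 2) / (sqrt (2 * pi) * c n)"
      using c[of n] by (simp add: real_sqrt_mult)
    finally show ?thesis using c[of n] by (simp add: std_normal_density_def)
  qed
  let ?k = "\<lambda>n z. indicat_real {x-L..x+L} (x + c n * z) * cutoff L x (x + c n * z) * phi (x + c n * z) (t - r n)"
  have eq: "dual_pairing L x t (t - r n) = (LINT z|lborel. std_normal_density z *
      ?k n z)" for n
  proof -
    have "dual_pairing L x t (t - r n) = (LINT y|lborel. indicator {x-L..x+L} y * (cutoff L x y * heat (r n) (x - y) * phi y (t - r n)))"
      using dual_pairing_LINT[OF L st(1)[of n] st(2)[of n], of x] by simp
    also have "\<dots> = (LINT z|lborel. c n * (indicator {x-L..x+L} (x + c n * z) *
        (cutoff L x (x + c n * z) * heat (r n) (x - (x + c n * z)) * phi (x + c n * z) (t - r n))))"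
      using c[of n] by (subst lborel_integral_real_affine[where c="c n" and t=x]) auto
    also have "\<dots> = (LINT z|lborel. (c n * heat (r n) (x - (x + c n * z))) *
        ?k n z)"
      by (intro Bochner_Integration.integral_cong refl) (simp only: mult_ac)
    finally show ?thesis unfolding heat_c .
  qed
  have "(\<lambda>n. LINT z|lborel. std_normal_density z *
      ?k n z)
    \<longlonglongrightarrow> (LINT z|lborel. std_normal_density z * (1 * 1 * phi x t))"
  proof (rule integral_dominated_convergence[where w="\<lambda>z. std_normal_density z * C"])
    show "AE z in lborel. (\<lambda>n. std_normal_density z *
      ?k n z)
      \<longlonglongrightarrow> std_normal_density z * (1 * 1 * phi x t)"
    proof (intro always_eventually allI tendsto_mult tendsto_const)
      fix z
      have cz: "(\<lambda>n. c n * z) \<longlonglongrightarrow> 0" using tendsto_mult_right[OF c0, of z] by simp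
      have "\<forall>\<^sub>F n in sequentially. \<bar>c n * z\<bar> < L"
        using order_tendstoD(2)[OF tendsto_rabs[OF cz]] L by simp
      hence "\<forall>\<^sub>F n in sequentially. 1 = indicat_real {x-L..x+L} (x + c n * z)"
        by eventually_elim (auto simp: indicator_def)
      thus "(\<lambda>n. indicat_real {x-L..x+L} (x + c n * z)) \<longlonglongrightarrow> 1"
        by (rule Lim_transform_eventually[OF tendsto_const])
      have "(\<lambda>n. (1 - (c n * z / L)\<^sup>2)\<^sup>2) \<longlonglongrightarrow> (1 - (0 / L)\<^sup>2)\<^sup>2"
        using L by (intro tendsto_intros cz) auto
      thus "(\<lambda>n. cutoff L x (x + c n * z)) \<longlonglongrightarrow> 1" by (simp add: cutoff_def)
      have "isCont (\<lambda>q. phi (fst q) (snd q)) (x, t)"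
      proof -
        have "continuous_on (UNIV \<times> {0<..}) (\<lambda>q. phi (fst q) (snd q))"
          by (intro continuous_intros) auto
        thus ?thesis using t by (subst (asm) continuous_on_eq_continuous_at) (auto intro!: open_Times)
      qed
      moreover have "(\<lambda>n. (x + c n * z, t - r n)) \<longlonglongrightarrow> (x + 0, t - 0)"
        by (intro tendsto_intros cz r(1))
      ultimately show "(\<lambda>n. phi (x + c n * z) (t - r n)) \<longlonglongrightarrow> phi x t"
        using isCont_tendsto_compose[of "(x, t)" "\<lambda>q. phi (fst q) (snd q)"] by fastforce
    qed
    show "AE z in lborel. norm (std_normal_density z *
      ?k n z)
      \<le> std_normal_density z * C" for n
    proof (intro always_eventually allI)
      fix z
      have "\<bar>indicator {x-L..x+L} (x + c n * z) * cutoff L x (x + c n * z)\<bar> * phi (x + c n * z) (t - r n) \<le> 1 * C"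
        using cutoff_indicator_bound[OF L, of x "x + c n * z"] C[of "t - r n" "x + c n * z"] st[of n]
        by (intro mult_mono) (auto simp: phi_def)
      thus "norm (std_normal_density z *
      ?k n z)
      \<le> std_normal_density z * C"
        by (simp add: abs_mult mult_left_mono phi_def)
    qed
  qed (auto intro!: integrable_mult_left)
  thus ?thesis unfolding eq by simp
qed

lemma cole_hopf_integrable:
  assumes t: "t > 0"
  shows "integrable lborel (\<lambda>y. heat t (x - y) * exp (- H y / (2 * \<mu>)))"
proof (rule Bochner_Integration.integrable_bound)
  have [measurable]: "H \<in> borel_measurable borel"
    using H_cont by (rule borel_measurable_continuous_onI)
  show "(\<lambda>y. heat t (x - y) * exp (- H y / (2 * \<mu>))) \<in> borel_measurable lborel" by measurable
  show "integrable lborel (\<lambda>y. heat t (x - y) * exp (A / (2 * \<mu>)))"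
    using heat_integral(1)[OF t] by auto
  show "AE y in lborel. norm (heat t (x - y) * exp (- H y / (2 * \<mu>))) \<le> norm (heat t (x - y) * exp (A / (2 * \<mu>)))"
  proof (intro always_eventually allI)
    fix y
    have "- H y \<le> A" using H_bound[of y] by linarith
    hence "- H y / (2 * \<mu>) \<le> A / (2 * \<mu>)" using mu_pos by (intro divide_right_mono) auto
    thus "norm (heat t (x - y) * exp (- H y / (2 * \<mu>))) \<le> norm (heat t (x - y) * exp (A / (2 * \<mu>)))"
      using heat_pos[OF t, of "x - y"] by (simp add: abs_mult)
  qed
qed

theorem cole_hopf:
  assumes t: "t > 0"
  shows "phi x t = (LINT y|lborel. heat t (x - y) * exp (- H y / (2 * \<mu>)))"
proof -
  obtain C where C: "\<And>s y. 0 < s \<Longrightarrow> s \<le> t \<Longrightarrow> phi y s \<le> C" using phi_bounded[of t] by blast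
  define I where "I L = (LINT y|lborel. indicator {x-L..x+L} y * (cutoff L x y * heat t (x - y) * exp (- H y / (2 * \<mu>))))" for L
  define a where "a n = t / (real n + 2)" for n
  have a: "a \<longlonglongrightarrow> 0" "\<And>n. 0 < a n" "\<And>n. a n \<le> t / 2"
  proof -
    have "filterlim (\<lambda>n. real n + 2) at_top sequentially"
      by (rule filterlim_at_top_mono[OF filterlim_real_sequentially]) auto
    thus "a \<longlonglongrightarrow> 0" unfolding a_def[abs_def] by (rule real_tendsto_divide_at_top[OF tendsto_const])
    show "0 < a n" "a n \<le> t / 2" for n
      using t by (auto simp: a_def field_simps)
  qed
  have est: "\<bar>phi x t - I L\<bar> \<le> 16 * \<mu> * C / L\<^sup>2 * t" if L: "L > 0" for L
  proof -
    have C0: "0 \<le> C" using C[OF t, of x] by (rule order_trans[rotated]) (auto simp: phi_def)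
    have "\<bar>dual_pairing L x t (t - a n) - dual_pairing L x t (a n)\<bar> \<le> 16 * \<mu> * C / L\<^sup>2 * t" for n
    proof -
      have an: "a n \<in> {0<..<t}" "t - a n \<in> {0<..<t}" using a(2,3)[of n] t by auto
      have "\<bar>dual_pairing L x t (t - a n) - dual_pairing L x t (a n)\<bar> \<le> 16 * \<mu> * C / L\<^sup>2 * \<bar>(t - a n) - a n\<bar>"
      proof (rule increment_bound[where f="\<lambda>s. dual_pairing L x t s" and S="{0<..<t}"])
        fix s assume s: "s \<in> {0<..<t}"
        hence "0 < s" "s < t" "\<And>y. phi y s \<le> C" using C[of s] by auto
        from dual_pairing_deriv[OF L this]
        show "\<exists>D. ((\<lambda>s. dual_pairing L x t s) has_real_derivative D) (at s) \<and> \<bar>D\<bar> \<le> 16 * \<mu> * C / L\<^sup>2" .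
      qed (use an in auto)
      also have "\<dots> \<le> 16 * \<mu> * C / L\<^sup>2 * t"
        using a(2,3)[of n] mu_pos C0 by (intro mult_left_mono) auto
      finally show ?thesis by simp
    qed
    moreover have "(\<lambda>n. \<bar>dual_pairing L x t (t - a n) - dual_pairing L x t (a n)\<bar>) \<longlonglongrightarrow> \<bar>phi x t - I L\<bar>"
      unfolding I_def by (intro tendsto_intros dual_at_initial_time dual_at_final_time L t a)
    ultimately show ?thesis
      by (intro LIMSEQ_le_const2) auto
  qed
  have lim: "(\<lambda>n. I (real n + 1)) \<longlonglongrightarrow> (LINT y|lborel. heat t (x - y) * exp (- H y / (2 * \<mu>)))"
    using cutoff_LINT_tendsto[OF cole_hopf_integrable[OF t], of x x] by (simp add: I_def mult.assoc)
  have "(\<lambda>n. 16 * \<mu> * C / (real n + 1)\<^sup>2 * t) \<longlonglongrightarrow> 0 * t"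
    by (intro tendsto_intros real_tendsto_divide_at_top[OF tendsto_const] filterlim_pow_at_top filterlim_real_plus_1) auto
  moreover have "(\<lambda>n. \<bar>phi x t - I (real n + 1)\<bar>) \<longlonglongrightarrow> \<bar>phi x t - (LINT y|lborel. heat t (x - y) * exp (- H y / (2 * \<mu>)))\<bar>"
    by (intro tendsto_intros lim)
  ultimately have "\<bar>phi x t - (LINT y|lborel. heat t (x - y) * exp (- H y / (2 * \<mu>)))\<bar> \<le> 0 * t"
    by (rule tendsto_le[OF trivial_limit_sequentially]) (intro always_eventually allI est, simp)
  thus ?thesis by simp
qed

section \<open>Bounds that are uniform in the viscosity\<close>

lemma phi_le_iff: "phi x t \<le> exp (- c / (2 * \<mu>)) \<longleftrightarrow> c \<le> W x t"
  unfolding phi_def using mu_pos by (simp add: divide_le_cancel)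

lemma phi_ge_iff: "exp (- c / (2 * \<mu>)) \<le> phi x t \<longleftrightarrow> W x t \<le> c"
  unfolding phi_def using mu_pos by (simp add: divide_le_cancel)

lemma exp_antimono:
  assumes "a \<le> b"
  shows "exp (- b / (2 * \<mu>)) \<le> exp (- a / (2 * \<mu>))"
proof -
  have "- b / (2 * \<mu>) \<le> - a / (2 * \<mu>)" using assms mu_pos by (intro divide_right_mono) auto
  thus ?thesis by (simp only: exp_le_cancel_iff)
qed

lemma W_bound:
  assumes t: "t > 0"
  shows "\<bar>W x t\<bar> \<le> A"
proof -
  have HA: "- A \<le> H y" "H y \<le> A" for y using H_bound[of y] by linarith+
  have "phi x t \<le> (LINT y|lborel. heat t (x - y) * exp (- (- A) / (2 * \<mu>)))"
    unfolding cole_hopf[OF t] using heat_pos[OF t] heat_integral(1)[OF t]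
    by (intro integral_mono cole_hopf_integrable[OF t] mult_left_mono exp_antimono HA)
       (auto simp: less_imp_le)
  hence 1: "- A \<le> W x t" using heat_integral(2)[OF t, of x] by (simp add: phi_le_iff[symmetric])
  have "(LINT y|lborel. heat t (x - y) * exp (- A / (2 * \<mu>))) \<le> phi x t"
    unfolding cole_hopf[OF t] using heat_pos[OF t] heat_integral(1)[OF t]
    by (intro integral_mono cole_hopf_integrable[OF t] mult_left_mono exp_antimono HA)
       (auto simp: less_imp_le)
  hence 2: "W x t \<le> A" using heat_integral(2)[OF t, of x] by (simp add: phi_ge_iff[symmetric])
  show ?thesis using 1 2 by linarith
qed

text \<open>
  The kernels centred at \<open>x + d\<close> and \<open>x - d\<close> have the kernel at \<open>x\<close> as geometric mean, up to the
  factor \<open>exp (- d\<^sup>2 / (4 * \<mu> * t))\<close>. Integrating the inequality between geometric and arithmetic means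
  gives a midpoint inequality for \<open>ln phi\<close>.
\<close>

lemma W_semiconcave:
  assumes t: "t > 0"
  shows "W (x + d) t + W (x - d) t \<le> 2 * W x t + d\<^sup>2 / t"
proof -
  \<comment> \<open>the weight \<open>exp l\<close> in the arithmetic mean makes its two terms equal after integration\<close>
  define l where "l = (W (x + d) t - W (x - d) t) / (4 * \<mu>)"
  define e where "e = exp (- d\<^sup>2 / (4 * \<mu> * t))"
  have ptw: "2 * e * heat t z \<le> exp l * heat t (z + d) + exp (- l) * heat t (z - d)" for z
  proof -
    define k where "k = z * d / (2 * \<mu> * t)"
    have hp: "heat t (z + d) = heat t z * (e * exp (- k))" and hm: "heat t (z - d) = heat t z * (e * exp k)"
      unfolding heat_def e_def k_def using t mu_pos
      by (simp_all add: exp_add[symmetric] field_simps power2_eq_square)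
    have "2 \<le> exp (l - k) + exp (- (l - k))"
      using cosh_real_ge_1[of "l - k"] by (simp add: cosh_def)
    hence "(heat t z * e) * 2 \<le> (heat t z * e) * (exp (l - k) + exp (- (l - k)))"
      using heat_pos[OF t, of z] by (intro mult_left_mono) (auto simp: e_def)
    also have "\<dots> = exp l * heat t (z + d) + exp (- l) * heat t (z - d)"
      unfolding hp hm by (simp add: algebra_simps exp_diff exp_minus divide_simps)
    finally show ?thesis by (simp add: algebra_simps)
  qed
  have "2 * e * phi x t = (LINT y|lborel. 2 * e * (heat t (x - y) * exp (- H y / (2 * \<mu>))))"
    by (simp add: cole_hopf[OF t])
  also have "\<dots> \<le> (LINT y|lborel. exp l * (heat t (x + d - y) * exp (- H y / (2 * \<mu>)))
       + exp (- l) * (heat t (x - d - y) * exp (- H y / (2 * \<mu>))))"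
  proof (rule integral_mono)
    fix y
    show "2 * e * (heat t (x - y) * exp (- H y / (2 * \<mu>))) \<le> exp l * (heat t (x + d - y) * exp (- H y / (2 * \<mu>)))
       + exp (- l) * (heat t (x - d - y) * exp (- H y / (2 * \<mu>)))"
      using mult_right_mono[OF ptw[of "x - y"], of "exp (- H y / (2 * \<mu>))"]
      by (simp add: algebra_simps)
  qed (intro integrable_mult_right Bochner_Integration.integrable_add cole_hopf_integrable[OF t])+
  also have "\<dots> = exp l * phi (x + d) t + exp (- l) * phi (x - d) t"
    unfolding cole_hopf[OF t]
    by (subst Bochner_Integration.integral_add) (intro integrable_mult_right cole_hopf_integrable[OF t], intro integrable_mult_right cole_hopf_integrable[OF t], simp)
  also have "\<dots> = 2 * exp (- (W (x + d) t + W (x - d) t) / (4 * \<mu>))"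
    unfolding phi_def l_def exp_add[symmetric] by (simp add: field_simps)
  finally have "e * phi x t \<le> exp (- (W (x + d) t + W (x - d) t) / (4 * \<mu>))" by simp
  hence "- d\<^sup>2 / (4 * \<mu> * t) + - W x t / (2 * \<mu>) \<le> - (W (x + d) t + W (x - d) t) / (4 * \<mu>)"
    by (simp add: e_def phi_def exp_add[symmetric])
  hence "4 * \<mu> * (- d\<^sup>2 / (4 * \<mu> * t) + - W x t / (2 * \<mu>)) \<le> 4 * \<mu> * (- (W (x + d) t + W (x - d) t) / (4 * \<mu>))"
    using mu_pos by (intro mult_left_mono) auto
  moreover have "4 * \<mu> * (- d\<^sup>2 / (4 * \<mu> * t) + - W x t / (2 * \<mu>)) = - (d\<^sup>2 / t) - 2 * W x t"
    "4 * \<mu> * (- (W (x + d) t + W (x - d) t) / (4 * \<mu>)) = - (W (x + d) t + W (x - d) t)"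
    using t by (simp_all add: field_simps)
  ultimately show ?thesis by linarith
qed

text \<open>
  Midpoint concavity of \<open>W (x + e) t - e\<^sup>2 / (2 * t)\<close> along \<open>e = d, d / 2, d / 4, \<dots>\<close> compares the
  secant slope at \<open>d\<close> with the derivative at \<open>0\<close>.
\<close>

lemma W_tangent:
  assumes t: "t > 0"
  shows "W (x + d) t \<le> W x t + d * u x t + d\<^sup>2 / (2 * t)"
proof (cases "d = 0")
  case False
  define g where "g e = W (x + e) t - e\<^sup>2 / (2 * t)" for e
  have half: "g e - g 0 \<le> 2 * (g (e / 2) - g 0)" for e
  proof -
    define a where "a = e\<^sup>2 / t"
    have "x + e / 2 + e / 2 = x + e" "x + e / 2 - e / 2 = x" by simp_all
    moreover have "(e / 2)\<^sup>2 / t = a / 4" by (simp add: a_def power_divide)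
    moreover define wh we where "wh = W (x + e / 2) t" and "we = W (x + e) t"
    ultimately have 1: "we + W x t \<le> 2 * wh + a / 4"
      using W_semiconcave[OF t, of "x + e / 2" "e / 2"] by (simp only:)
    have 2: "g e = we - a / 2" "g (e / 2) = wh - a / 8" "g 0 = W x t"
      by (simp_all add: a_def g_def power_divide wh_def we_def)
    show ?thesis unfolding 2 using 1 by simp
  qed
  have halves: "g d - g 0 \<le> 2 ^ n * (g (d / 2 ^ n) - g 0)" for n
  proof (induction n)
    case (Suc n)
    also have "2 ^ n * (g (d / 2 ^ n) - g 0) \<le> 2 ^ n * (2 * (g (d / 2 ^ n / 2) - g 0))"
      by (intro mult_left_mono half) auto
    finally show ?case by (simp add: algebra_simps)
  qed simp
  have "((\<lambda>e. W (x + e) t) has_real_derivative u x t) (at 0)"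
    using W_x[OF t, of x] by (simp add: DERIV_shift[of _ _ 0 x, simplified] add.commute)
  hence "(g has_real_derivative u x t) (at 0)"
    unfolding g_def[abs_def] using t by (auto intro!: derivative_eq_intros)
  hence lim: "((\<lambda>e. (g (0 + e) - g 0) / e) \<longlongrightarrow> u x t) (at 0)"
    by (simp add: DERIV_def)
  have e0: "filterlim (\<lambda>n. d / 2 ^ n) (at 0) sequentially"
    using False by (auto simp: filterlim_at intro!: LIMSEQ_divide_realpow_zero)
  have "(\<lambda>n. d * ((g (d / 2 ^ n) - g 0) / (d / 2 ^ n))) \<longlonglongrightarrow> d * u x t"
    using filterlim_compose[OF lim e0] by (intro tendsto_intros) simp
  moreover have "d * ((g (d / 2 ^ n) - g 0) / (d / 2 ^ n)) = 2 ^ n * (g (d / 2 ^ n) - g 0)" for n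
    using False by simp
  ultimately have "(\<lambda>n. 2 ^ n * (g (d / 2 ^ n) - g 0)) \<longlonglongrightarrow> d * u x t"
    by (simp only:)
  hence "g d - g 0 \<le> d * u x t"
    by (rule LIMSEQ_le_const) (use halves in auto)
  thus ?thesis by (simp add: g_def)
qed simp

text \<open>
  The step \<open>\<plusminus> sqrt t\<close> balances the oscillation \<open>2 * A\<close> of \<open>W\<close> against the quadratic term of the
  tangent inequality.
\<close>

lemma u_bound:
  assumes t: "t > 0"
  shows "\<bar>u x t\<bar> \<le> (2 * A + 1/2) / sqrt t"
proof -
  have s: "sqrt t > 0" "(sqrt t)\<^sup>2 = t" using t by auto
  have "- (2 * A + 1/2) \<le> sqrt t * u x t" "sqrt t * u x t \<le> 2 * A + 1/2"
    using W_tangent[OF t, of x "sqrt t"] W_tangent[OF t, of x "- sqrt t"] s t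
      W_bound[OF t, of x] W_bound[OF t, of "x + sqrt t"] W_bound[OF t, of "x - sqrt t"]
    by (auto simp: abs_le_iff)
  hence "\<bar>sqrt t * u x t\<bar> \<le> 2 * A + 1/2" by linarith
  thus ?thesis using s by (simp add: abs_mult field_simps)
qed

text \<open>
  Laplace's method from one side: a fraction \<open>\<theta>\<close> of the Gaussian exponent is kept to make the kernel
  integrable, at the price \<open>\<mu> * ln \<theta>\<close>; the rest competes with \<open>H\<close>.
\<close>

lemma W_lower:
  assumes t: "t > 0" and \<theta>: "0 < \<theta>"
    and c: "\<And>y. c \<le> (1 - \<theta>) * (x - y)\<^sup>2 / (2 * t) + H y"
  shows "c + \<mu> * ln \<theta> \<le> W x t"
proof -
  have tt: "t / \<theta> > 0" using t \<theta> by simp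
  have ptw: "heat t (x - y) * exp (- H y / (2 * \<mu>)) \<le> exp (- (c + \<mu> * ln \<theta>) / (2 * \<mu>)) * heat (t / \<theta>) (x - y)" for y
  proof -
    define K where "K = (1 - \<theta>) * (x - y)\<^sup>2 / (2 * t) + H y"
    have sq: "sqrt \<theta> = exp (ln \<theta> / 2)" using \<theta> by (simp add: ln_sqrt[symmetric])
    have h2: "heat (t / \<theta>) (x - y) = sqrt \<theta> * (exp (- \<theta> * (x - y)\<^sup>2 / (4 * \<mu> * t)) / sqrt (4 * pi * \<mu> * t))"
      unfolding heat_def using t \<theta> mu_pos by (simp add: real_sqrt_divide)
    have ex: "- (x - y)\<^sup>2 / (4 * \<mu> * t) + - H y / (2 * \<mu>) = - K / (2 * \<mu>) + - \<theta> * (x - y)\<^sup>2 / (4 * \<mu> * t)"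
      unfolding K_def using t mu_pos by (simp add: field_simps)
    have "heat t (x - y) * exp (- H y / (2 * \<mu>)) = exp (- (x - y)\<^sup>2 / (4 * \<mu> * t) + - H y / (2 * \<mu>)) / sqrt (4 * pi * \<mu> * t)"
      by (simp only: heat_def exp_add times_divide_eq_left)
    also have "\<dots> = exp (- K / (2 * \<mu>)) * (exp (- \<theta> * (x - y)\<^sup>2 / (4 * \<mu> * t)) / sqrt (4 * pi * \<mu> * t))"
      unfolding ex exp_add by simp
    also have "\<dots> \<le> exp (- c / (2 * \<mu>)) * (exp (- \<theta> * (x - y)\<^sup>2 / (4 * \<mu> * t)) / sqrt (4 * pi * \<mu> * t))"
      using mu_pos t by (intro mult_right_mono exp_antimono) (auto simp: K_def c)
    also have "exp (- c / (2 * \<mu>)) = exp (- (c + \<mu> * ln \<theta>) / (2 * \<mu>)) * sqrt \<theta>"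
      unfolding sq exp_add[symmetric] using mu_pos by (simp add: field_simps)
    finally show ?thesis unfolding h2 by (simp add: mult.assoc)
  qed
  have "phi x t \<le> (LINT y|lborel. exp (- (c + \<mu> * ln \<theta>) / (2 * \<mu>)) * heat (t / \<theta>) (x - y))"
    unfolding cole_hopf[OF t]
    by (intro integral_mono cole_hopf_integrable[OF t] integrable_mult_right heat_integral(1)[OF tt] ptw)
  also have "\<dots> = exp (- (c + \<mu> * ln \<theta>) / (2 * \<mu>))"
    using heat_integral(2)[OF tt, of x] by simp
  finally show ?thesis by (simp only: phi_le_iff)
qed

text \<open>
  The other side of Laplace's method keeps only the contribution of the interval of radius \<open>r\<close>
  around \<open>y0\<close>. The last term estimates the logarithm of the normalising factor by \<open>ln q \<le> q\<close>.
\<close>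

lemma W_upper:
  assumes t: "t > 0" and r: "r > 0" and b: "\<And>y. \<bar>y - y0\<bar> \<le> r \<Longrightarrow> H y \<le> b"
  shows "W x t \<le> (\<bar>x - y0\<bar> + r)\<^sup>2 / (2 * t) + b + \<mu>\<^sup>2 * pi * t / r\<^sup>2"
proof -
  define K where "K = (\<bar>x - y0\<bar> + r)\<^sup>2 / (2 * t) + b"
  define k where "k = exp (- K / (2 * \<mu>)) / sqrt (4 * pi * \<mu> * t)"
  have "(LINT y|lborel. indicator {y0-r..y0+r} y * k) \<le> phi x t"
    unfolding cole_hopf[OF t]
  proof (intro integral_mono cole_hopf_integrable[OF t])
    show "integrable lborel (\<lambda>y. indicator {y0-r..y0+r} y * k)"
      by (intro integrable_mult_left integrable_real_indicator) (auto simp: emeasure_lborel_Icc_eq)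
    fix y
    show "indicator {y0-r..y0+r} y * k \<le> heat t (x - y) * exp (- H y / (2 * \<mu>))"
    proof (cases "y \<in> {y0-r..y0+r}")
      case True
      hence y: "\<bar>y - y0\<bar> \<le> r" by auto
      hence "\<bar>x - y\<bar> \<le> \<bar>x - y0\<bar> + r" by linarith
      hence "\<bar>x - y\<bar>\<^sup>2 \<le> (\<bar>x - y0\<bar> + r)\<^sup>2" by (intro power_mono) auto
      hence "(x - y)\<^sup>2 / (2 * t) \<le> (\<bar>x - y0\<bar> + r)\<^sup>2 / (2 * t)" using t by (simp add: divide_right_mono)
      hence "(x - y)\<^sup>2 / (2 * t) + H y \<le> K" using b[OF y] by (simp add: K_def)
      hence "- K / (2 * \<mu>) \<le> - ((x - y)\<^sup>2 / (2 * t) + H y) / (2 * \<mu>)" using mu_pos by (intro divide_right_mono) auto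
      hence "exp (- K / (2 * \<mu>)) \<le> exp (- ((x - y)\<^sup>2 / (2 * t) + H y) / (2 * \<mu>))" by simp
      also have "- ((x - y)\<^sup>2 / (2 * t) + H y) / (2 * \<mu>) = - (x - y)\<^sup>2 / (4 * \<mu> * t) + - H y / (2 * \<mu>)"
        using t mu_pos by (simp add: field_simps)
      finally have "k \<le> exp (- (x - y)\<^sup>2 / (4 * \<mu> * t) + - H y / (2 * \<mu>)) / sqrt (4 * pi * \<mu> * t)"
        unfolding k_def using t mu_pos by (intro divide_right_mono) auto
      hence "k \<le> heat t (x - y) * exp (- H y / (2 * \<mu>))"
        by (simp only: heat_def exp_add times_divide_eq_left)
      thus ?thesis using True by simp
    qed (use heat_pos[OF t, of "x - y"] in auto)
  qed
  moreover have "(LINT y|lborel. indicator {y0-r..y0+r} y * k) = 2 * r * k"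
    using r by simp
  ultimately have 1: "2 * r * k \<le> phi x t" by (simp only:)
  have k: "0 < 2 * r * k" using r t mu_pos by (auto simp: k_def)
  define q where "q = pi * \<mu> * t / r\<^sup>2"
  have q: "q > 0" using t mu_pos r by (simp add: q_def)
  have sq: "sqrt (4 * pi * \<mu> * t) = 2 * r * sqrt q"
    using r by (simp add: q_def real_sqrt_divide real_sqrt_mult)
  have "2 * r * k = exp (- K / (2 * \<mu>)) / sqrt q"
    unfolding k_def sq using r q by simp
  also have "\<dots> = exp (- K / (2 * \<mu>) - ln q / 2)"
    using q by (simp add: exp_diff ln_sqrt[symmetric])
  also have "- K / (2 * \<mu>) - ln q / 2 = - (K + \<mu> * ln q) / (2 * \<mu>)"
    using mu_pos by (simp add: field_simps)
  finally have "W x t \<le> K + \<mu> * ln q" using 1 by (simp only: phi_ge_iff)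
  also have "\<mu> * ln q \<le> \<mu> * q" using mu_pos ln_less_self[OF q] by (intro mult_left_mono) auto
  also have "\<mu> * q = \<mu>\<^sup>2 * pi * t / r\<^sup>2" by (simp add: q_def power2_eq_square)
  finally show ?thesis by (simp add: K_def)
qed

end

section \<open>Energy beyond an expanding front\<close>

text \<open>
  The power of the positive part: differentiable everywhere for exponents above \<open>1\<close>, so twice
  differentiable for the exponent \<open>2 * m > 3\<close> used below.
\<close>

definition pospow :: "real \<Rightarrow> real \<Rightarrow> real" where "pospow a s = max 0 s powr a"

lemma pospow_nonneg [simp]: "0 \<le> pospow a s" by (simp add: pospow_def)

lemma pospow_cont:
  assumes "a > 0" "continuous_on S f"
  shows "continuous_on S (\<lambda>x. pospow a (f x))"
  unfolding pospow_def using assms by (intro continuous_on_powr' continuous_intros) auto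

lemma pospow_deriv:
  assumes a: "a > 1"
  shows "(pospow a has_real_derivative a * pospow (a - 1) s) (at s)"
proof (cases s "0 :: real" rule: linorder_cases)
  case less
  have "((\<lambda>_. 0) has_real_derivative 0) (at s)" by simp
  hence "(pospow a has_real_derivative 0) (at s)"
    by (rule has_field_derivative_transform_within_open[of _ _ _ "{..<0}"]) (use less in \<open>auto simp: pospow_def\<close>)
  thus ?thesis using less by (simp add: pospow_def)
next
  case greater
  have "((\<lambda>s. s powr a) has_real_derivative a * s powr (a - 1)) (at s)"
    using has_real_derivative_powr[of s a] greater by simp
  hence "(pospow a has_real_derivative a * s powr (a - 1)) (at s)"
    by (rule has_field_derivative_transform_within_open[of _ _ _ "{0<..}"]) (use greater in \<open>auto simp: pospow_def\<close>)
  thus ?thesis using greater by (simp add: pospow_def)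
next
  case equal
  have "((\<lambda>h. \<bar>h\<bar> powr (a - 1)) \<longlongrightarrow> 0 powr (a - 1)) (at 0)"
    using a by (intro tendsto_powr' tendsto_rabs_zero tendsto_ident_at tendsto_const) auto
  hence lim: "((\<lambda>h. \<bar>h\<bar> powr (a - 1)) \<longlongrightarrow> 0) (at (0::real))" by simp
  have "((\<lambda>h. (pospow a (0 + h) - pospow a 0) / h) \<longlongrightarrow> 0) (at 0)"
  proof (rule Lim_null_comparison[OF _ lim])
    show "\<forall>\<^sub>F h in at 0. norm ((pospow a (0 + h) - pospow a 0) / h) \<le> \<bar>h\<bar> powr (a - 1)"
    proof (intro always_eventually allI)
      fix h :: real
      show "norm ((pospow a (0 + h) - pospow a 0) / h) \<le> \<bar>h\<bar> powr (a - 1)"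
      proof (cases "h > 0")
        case True
        thus ?thesis using a by (simp add: pospow_def powr_diff)
      next
        case False
        hence "pospow a h = 0" by (simp add: pospow_def max_def)
        thus ?thesis using a by (simp add: pospow_def)
      qed
    qed
  qed
  thus ?thesis using equal a by (simp add: DERIV_def pospow_def)
qed

lemma pospow_mono_exponent:
  assumes "0 < a" "a \<le> b"
  shows "pospow a s \<le> 1 + pospow b s"
proof (cases "s \<ge> 1")
  case True
  hence "s powr a \<le> s powr b" using assms by (intro powr_mono) auto
  thus ?thesis using True by (simp add: pospow_def)
next
  case False
  hence "max 0 s powr a \<le> 1" using powr_mono2[of a "max 0 s" 1] assms by auto
  thus ?thesis unfolding pospow_def using powr_ge_zero[of "max 0 s" b] by linarith
qed

lemma pospow_le_weight:
  assumes "m > 0" "s \<le> \<bar>x\<bar>"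
  shows "pospow (2 * m) s \<le> (1 + x\<^sup>2) powr m"
proof -
  have "pospow (2 * m) s \<le> \<bar>x\<bar> powr (2 * m)"
    unfolding pospow_def using assms by (intro powr_mono2) auto
  also have "\<dots> = (x\<^sup>2) powr m"
  proof -
    have "\<bar>x\<bar> powr 2 = x\<^sup>2" by (simp add: powr_numeral)
    thus ?thesis using powr_powr[of "\<bar>x\<bar>" 2 m] by simp
  qed
  also have "\<dots> \<le> (1 + x\<^sup>2) powr m" using assms by (intro powr_mono2) auto
  finally show ?thesis .
qed

text \<open>
  \<open>E0\<close> bounds the squared weighted norm near the initial time and does not depend on \<open>\<mu>\<close>; the bounds in
  \<open>weighted_bounded\<close> may.
\<close>

locale weighted_burgers = viscous_burgers +
  fixes m E0 :: real
  assumes m: "m > 3/2"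
    and weighted_integrable: "\<And>t. t > 0 \<Longrightarrow> integrable lborel (\<lambda>x. (1 + x\<^sup>2) powr m * (u x t)\<^sup>2)"
    and weighted_bounded: "\<And>T. \<exists>B. \<forall>t. 0 < t \<and> t \<le> T \<longrightarrow> (LINT x|lborel. (1 + x\<^sup>2) powr m * (u x t)\<^sup>2) \<le> B"
    and weighted_initial: "\<forall>\<^sub>F t in at_right 0. (LINT x|lborel. (1 + x\<^sup>2) powr m * (u x t)\<^sup>2) \<le> E0"
begin

text \<open>
  The speed of the front is \<open>2/3\<close> of the bound of \<open>\<bar>u\<bar>\<close> in \<open>u_bound\<close>: exactly what the cubic term
  \<open>2/3 * u^3\<close> of the energy identity requires. Starting at \<open>1\<close> keeps it positive.
\<close>

definition front :: "real \<Rightarrow> real" where "front t = 1 + 4/3 * (2 * A + 1/2) * sqrt t"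

text \<open>
  The additive \<open>1\<close> lets the weight dominate its own second derivative, which has a lower power of the
  distance to the front.
\<close>

definition outer :: "real \<Rightarrow> real \<Rightarrow> real" where
  "outer x t = 1 + pospow (2 * m) (x - front t) + pospow (2 * m) (- x - front t)"

definition outer_x :: "real \<Rightarrow> real \<Rightarrow> real" where
  "outer_x x t = 2 * m * pospow (2 * m - 1) (x - front t) - 2 * m * pospow (2 * m - 1) (- x - front t)"

text \<open>
  Both one-sided weights contribute with a positive sign: this bounds \<open>\<bar>outer_x\<bar>\<close> and is, up to the
  factor \<open>-\<close> speed, the time derivative of \<open>outer\<close>.
\<close>

definition outer_slope :: "real \<Rightarrow> real \<Rightarrow> real" where
  "outer_slope x t = 2 * m * pospow (2 * m - 1) (x - front t) + 2 * m * pospow (2 * m - 1) (- x - front t)"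

definition outer_xx :: "real \<Rightarrow> real \<Rightarrow> real" where
  "outer_xx x t = 2 * m * ((2 * m - 1) * pospow (2 * m - 2) (x - front t))
     + 2 * m * ((2 * m - 1) * pospow (2 * m - 2) (- x - front t))"

lemma A_nonneg: "0 \<le> A" using H_bound[of 0] by linarith

lemma front_ge_1: "t \<ge> 0 \<Longrightarrow> 1 \<le> front t"
  using A_nonneg by (simp add: front_def)

lemma front_t: "t > 0 \<Longrightarrow> (front has_real_derivative 2/3 * (2 * A + 1/2) / sqrt t) (at t)"
  unfolding front_def[abs_def] by (auto intro!: derivative_eq_intros simp: field_simps)

lemma front_cont: "continuous_on S front"
  unfolding front_def[abs_def] by (intro continuous_intros)

lemma outer_deriv:
  shows DERIV_outer_x: "((\<lambda>x. outer x t) has_real_derivative outer_x x t) (at x)"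
    and DERIV_outer_xx: "((\<lambda>x. outer_x x t) has_real_derivative outer_xx x t) (at x)"
    and DERIV_outer_t: "t > 0 \<Longrightarrow> ((\<lambda>t. outer x t) has_real_derivative - (2/3 * (2 * A + 1/2) / sqrt t) * outer_slope x t) (at t)"
proof -
  have l: "((\<lambda>x. x - front t) has_real_derivative 1) (at x)" "((\<lambda>x. - x - front t) has_real_derivative - 1) (at x)"
    by (auto intro!: derivative_eq_intros)
  have m1: "2 * m > 1" "2 * m - 1 > 1" "2 * m - 1 - 1 = 2 * m - 2" using m by auto
  note p1 = DERIV_chain2[OF pospow_deriv[OF m1(1)]] and p2 = DERIV_chain2[OF pospow_deriv[OF m1(2)]]
  show "((\<lambda>x. outer x t) has_real_derivative outer_x x t) (at x)"
    using DERIV_add[OF DERIV_add[OF DERIV_const p1[OF l(1)]] p1[OF l(2)], of 1]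
    by (simp add: outer_def[abs_def] outer_x_def)
  show "((\<lambda>x. outer_x x t) has_real_derivative outer_xx x t) (at x)"
    using DERIV_diff[OF DERIV_cmult[OF p2[OF l(1)], of "2*m"] DERIV_cmult[OF p2[OF l(2)], of "2*m"]]
    by (simp add: outer_x_def[abs_def] outer_xx_def m1)
  assume t: "t > 0"
  define k where "k = 2/3 * (2 * A + 1/2) / sqrt t"
  have l: "((\<lambda>t. x - front t) has_real_derivative - k) (at t)" "((\<lambda>t. - x - front t) has_real_derivative - k) (at t)"
    using front_t[OF t] by (auto intro!: derivative_eq_intros simp: k_def)
  show "((\<lambda>t. outer x t) has_real_derivative - (2/3 * (2 * A + 1/2) / sqrt t) * outer_slope x t) (at t)"
    using DERIV_add[OF DERIV_add[OF DERIV_const p1[OF l(1)]] p1[OF l(2)], of 1]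
    unfolding k_def[symmetric] by (simp add: outer_def[abs_def] outer_slope_def algebra_simps)
qed

lemma outer_cont:
  assumes "continuous_on S f" "continuous_on S g"
  shows "continuous_on S (\<lambda>z. outer (f z) (g z))" "continuous_on S (\<lambda>z. outer_x (f z) (g z))"
    "continuous_on S (\<lambda>z. outer_xx (f z) (g z))" "continuous_on S (\<lambda>z. outer_slope (f z) (g z))"
  unfolding outer_def outer_x_def outer_xx_def outer_slope_def using m continuous_on_compose2[OF front_cont[of UNIV] assms(2)]
  by (intro continuous_intros pospow_cont assms; simp)+

lemma outer_bounds:
  shows outer_ge_1: "1 \<le> outer x t"
    and outer_x_le: "\<bar>outer_x x t\<bar> \<le> outer_slope x t" and outer_slope_nonneg: "0 \<le> outer_slope x t"
    and outer_slope_le: "outer_slope x t \<le> 4 * m * outer x t"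
    and outer_xx_le: "outer_xx x t \<le> 8 * m\<^sup>2 * outer x t"
    and outer_le_weight: "t \<ge> 0 \<Longrightarrow> outer x t \<le> 3 * (1 + x\<^sup>2) powr m"
proof -
  show "1 \<le> outer x t" by (simp add: outer_def)
  have nn: "0 \<le> 2 * m * pospow (2 * m - 1) s" for s using m by simp
  show "\<bar>outer_x x t\<bar> \<le> outer_slope x t" "0 \<le> outer_slope x t"
    using nn[of "x - front t"] nn[of "- x - front t"] unfolding outer_x_def outer_slope_def by linarith+
  have e1: "pospow (2 * m - 1) s \<le> 1 + pospow (2 * m) s" "pospow (2 * m - 2) s \<le> 1 + pospow (2 * m) s" for s
    using m by (intro pospow_mono_exponent; simp)+
  have le: "1 + pospow (2 * m) (x - front t) \<le> outer x t" "1 + pospow (2 * m) (- x - front t) \<le> outer x t"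
    by (simp_all add: outer_def)
  have "outer_slope x t \<le> 2 * m * (1 + pospow (2 * m) (x - front t)) + 2 * m * (1 + pospow (2 * m) (- x - front t))"
    unfolding outer_slope_def using m by (intro add_mono mult_left_mono e1) auto
  also have "\<dots> \<le> 2 * m * outer x t + 2 * m * outer x t"
    using m by (intro add_mono mult_left_mono le) auto
  finally show "outer_slope x t \<le> 4 * m * outer x t" by simp
  have "outer_xx x t \<le> 2 * m * (2 * m * (1 + pospow (2 * m) (x - front t))) + 2 * m * (2 * m * (1 + pospow (2 * m) (- x - front t)))"
    unfolding outer_xx_def using m by (intro add_mono mult_left_mono mult_mono e1) auto
  also have "\<dots> \<le> 2 * m * (2 * m * outer x t) + 2 * m * (2 * m * outer x t)"
    using m by (intro add_mono mult_left_mono le) auto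
  finally show "outer_xx x t \<le> 8 * m\<^sup>2 * outer x t" by (simp add: power2_eq_square)
  assume "t \<ge> 0"
  hence f: "1 \<le> front t" by (rule front_ge_1)
  have "pospow (2 * m) (x - front t) \<le> (1 + x\<^sup>2) powr m" "pospow (2 * m) (- x - front t) \<le> (1 + x\<^sup>2) powr m"
    using m f by (intro pospow_le_weight; simp)+
  moreover have "1 \<le> (1 + x\<^sup>2) powr m" using m by (intro ge_one_powr_ge_zero) auto
  ultimately show "outer x t \<le> 3 * (1 + x\<^sup>2) powr m" unfolding outer_def by linarith
qed

lemma outer_u_nonneg: "0 \<le> outer x t * (u x t)\<^sup>2"
  using outer_ge_1[of x t] by (intro mult_nonneg_nonneg) auto

lemma outer_u_cont: "t > 0 \<Longrightarrow> continuous_on S (\<lambda>x. outer x t * (u x t)\<^sup>2)"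
  by (intro continuous_intros outer_cont) auto

lemma outer_integrable:
  assumes t: "t > 0"
  shows "integrable lborel (\<lambda>x. outer x t * (u x t)\<^sup>2)"
    "(LINT x|lborel. outer x t * (u x t)\<^sup>2) \<le> 3 * (LINT x|lborel. (1 + x\<^sup>2) powr m * (u x t)\<^sup>2)"
proof -
  have le: "outer x t * (u x t)\<^sup>2 \<le> 3 * ((1 + x\<^sup>2) powr m * (u x t)\<^sup>2)" for x
    using mult_right_mono[OF outer_le_weight[of t x], of "(u x t)\<^sup>2"] t by (simp add: mult.assoc)
  have [measurable]: "(\<lambda>x. outer x t * (u x t)\<^sup>2) \<in> borel_measurable lborel"
    using borel_measurable_continuous_onI[OF outer_u_cont[OF t]] by simp
  show 1: "integrable lborel (\<lambda>x. outer x t * (u x t)\<^sup>2)"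
  proof (rule Bochner_Integration.integrable_bound)
    show "integrable lborel (\<lambda>x. 3 * ((1 + x\<^sup>2) powr m * (u x t)\<^sup>2))"
      by (intro integrable_mult_right weighted_integrable t)
    show "AE x in lborel. norm (outer x t * (u x t)\<^sup>2) \<le> norm (3 * ((1 + x\<^sup>2) powr m * (u x t)\<^sup>2))"
      using le outer_ge_1 by (intro always_eventually allI) (simp add: abs_mult, smt (verit) outer_ge_1)
  qed measurable
  have "(LINT x|lborel. outer x t * (u x t)\<^sup>2) \<le> (LINT x|lborel. 3 * ((1 + x\<^sup>2) powr m * (u x t)\<^sup>2))"
    by (intro integral_mono 1 integrable_mult_right weighted_integrable t le)
  thus "(LINT x|lborel. outer x t * (u x t)\<^sup>2) \<le> 3 * (LINT x|lborel. (1 + x\<^sup>2) powr m * (u x t)\<^sup>2)" by simp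
qed

definition energy :: "real \<Rightarrow> real \<Rightarrow> real" where
  "energy L t = integral {-L..L} (\<lambda>x. cutoff L 0 x * outer x t * (u x t)\<^sup>2)"

text \<open>
  The energy identity for the weight \<open>\<Omega> = cutoff * outer\<close> is
  \<open>d/dt \<integral> \<Omega> u\<^sup>2 = \<integral> \<Omega>\<^sub>t u\<^sup>2 - 2 \<mu> \<integral> \<Omega> u\<^sub>x\<^sup>2 + \<mu> \<integral> \<Omega>\<^sub>x\<^sub>x u\<^sup>2 + 2/3 \<integral> \<Omega>\<^sub>x u\<^sup>3\<close>. The motion of the
  front makes the first term compensate the part of the last one in which \<open>outer\<close> is differentiated.
  Terms with derivatives of the cutoff are \<open>O(1 / L)\<close>.
\<close>

lemma energy_t:
  assumes L: "L \<ge> 1" and t: "t > 0" and N: "(LINT x|lborel. outer x t * (u x t)\<^sup>2) \<le> N"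
  shows "\<exists>D. (energy L has_real_derivative D) (at t) \<and>
     D \<le> 8 * m\<^sup>2 * \<mu> * energy L t + (32 * m * \<mu> + 8 * \<mu> + 8/3 * (2 * A + 1/2)) / L * (1 + 1 / sqrt t) * N"
proof -
  define B where "B = 2 * A + 1/2"
  have B: "B > 0" using A_nonneg by (simp add: B_def)
  define X X1 X2 where "X = cutoff L 0" and "X1 = cutoff' L 0" and "X2 = cutoff'' L 0"
  note X_defs = X_def X1_def X2_def
  have L0: "L > 0" using L by simp
  define k where "k t = 2/3 * (2 * A + 1/2) / sqrt t" for t
  define Ft where "Ft x t = X x * ((- k t * outer_slope x t) * (u x t)\<^sup>2 + outer x t * (2 * u x t * (\<mu> * uxx x t - u x t * ux x t)))" for x t
  define O1 O2 where "O1 x = X1 x * outer x t + X x * outer_x x t"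
    and "O2 x = X2 x * outer x t + 2 * X1 x * outer_x x t + X x * outer_xx x t" for x
  define G where "G x = - k t * X x * outer_slope x t * (u x t)\<^sup>2 - 2 * \<mu> * (X x * outer x t) * (ux x t)\<^sup>2
      + \<mu> * O2 x * (u x t)\<^sup>2 + 2/3 * O1 x * (u x t)^3" for x
  define Q where "Q x = 2 * \<mu> * (X x * outer x t) * (u x t * ux x t) - \<mu> * O1 x * (u x t)\<^sup>2 - 2/3 * (X x * outer x t) * (u x t)^3" for x
  note cont = continuous_intros outer_cont
  have 1: "(energy L has_real_derivative integral {-L..L} (\<lambda>x. Ft x t)) (at t)"
    unfolding energy_def[abs_def] X_def[symmetric]
  proof (rule has_derivative_under_integral[where c = "t + 1"])
    show "((\<lambda>t. X x * outer x t * (u x t)\<^sup>2) has_real_derivative Ft x t) (at t)"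
      if "t \<in> {0<..<t'}" for t t' x
    proof -
      have t: "t > 0" using that by simp
      have "((\<lambda>t. outer x t) has_real_derivative - k t * outer_slope x t) (at t)"
        using DERIV_outer_t[OF t, of x] by (simp add: k_def)
      from DERIV_cmult[OF DERIV_mult[OF this DERIV_power[OF u_t[OF t, of x], of 2]], of "X x"]
      show ?thesis by (simp add: Ft_def mult.assoc algebra_simps)
    qed
    show "continuous_on ({- L..L} \<times> {0<..<t + 1}) (\<lambda>z. Ft (fst z) (snd z))"
      unfolding Ft_def X_def k_def by (intro cont) auto
    show "continuous_on {- L..L} (\<lambda>x. X x * outer x t * (u x t)\<^sup>2)" if "t \<in> {0<..<t'}" for t t'
      unfolding X_def using that by (intro cont) auto
  qed (use t in auto)
  have cG: "continuous_on {-L..L} G"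
    unfolding G_def O1_def O2_def X_defs k_def using t by (intro cont) auto
  have 2: "((\<lambda>x. Ft x t - G x) has_integral (Q L - Q (-L))) {-L..L}"
  proof (rule integral_by_FTC)
    fix x
    note dX = cutoff_deriv[OF L0, of 0 x, folded X_defs]
    have dO1: "(O1 has_real_derivative O2 x) (at x)"
      unfolding O1_def[abs_def] O2_def
      by (rule DERIV_cong[OF DERIV_add[OF DERIV_mult[OF dX(2) DERIV_outer_x] DERIV_mult[OF dX(1) DERIV_outer_xx]]]) (simp add: algebra_simps)
    have dO: "((\<lambda>x. X x * outer x t) has_real_derivative O1 x) (at x)"
      unfolding O1_def by (rule DERIV_cong[OF DERIV_mult[OF dX(1) DERIV_outer_x]]) (simp add: algebra_simps)
    note du = u_x[OF t, of x] note dux = ux_x[OF t, of x]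
    note d1 = DERIV_mult[OF DERIV_cmult[OF dO, of "2 * \<mu>"] DERIV_mult[OF du dux]]
    note d2 = DERIV_mult[OF DERIV_cmult[OF dO1, of \<mu>] DERIV_power[OF du, of 2]]
    note d3 = DERIV_mult[OF DERIV_cmult[OF dO, of "2/3"] DERIV_power[OF du, of 3]]
    show "(Q has_real_derivative Ft x t - G x) (at x)"
      unfolding Q_def[abs_def]
      by (rule DERIV_cong[OF DERIV_diff[OF DERIV_diff[OF d1 d2] d3]])
        (simp add: Ft_def G_def power2_eq_square power3_eq_cube algebra_simps)
  qed (use L in auto)
  have 3: "Q L = 0" "Q (-L) = 0" using cutoff_values(3-6)[OF L0, of 0] by (auto simp: Q_def O1_def X_defs)
  have gi: "G integrable_on {-L..L}" using cG by (rule integrable_continuous_real)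
  have "((\<lambda>x. Ft x t - G x + G x) has_integral (0 - 0 + integral {-L..L} G)) {-L..L}"
    using 2 gi unfolding 3 by (intro has_integral_add) (auto simp: integrable_integral)
  hence 4: "integral {-L..L} (\<lambda>x. Ft x t) = integral {-L..L} G"
    by (simp add: integral_unique)
  define c where "c = (32 * m * \<mu> + 8 * \<mu> + 8/3 * B) / L * (1 + 1 / sqrt t)"
  have c0: "c \<ge> 0" unfolding c_def using m mu_pos B L t by (intro mult_nonneg_nonneg divide_nonneg_nonneg add_nonneg_nonneg) auto
  have st: "sqrt t > 0" using t by simp
  let ?b = "\<lambda>x. 8 * m\<^sup>2 * \<mu> * (X x * outer x t * (u x t)\<^sup>2) + c * (outer x t * (u x t)\<^sup>2)"
  have "integral {-L..L} G \<le> integral {-L..L} ?b"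
  proof (rule integral_le[OF gi])
    show "?b integrable_on {-L..L}"
      unfolding X_def using t by (intro integrable_continuous_real cont) auto
    fix x assume x: "x \<in> {-L..L}"
    have "\<bar>x - 0\<bar> \<le> L" using x by (auto simp: abs_le_iff)
    note X = cutoff_bounds[OF L0 this, folded X_defs]
    note X0 = X(1,2) note X1 = X(4)
    note X(5)
    also have "8 / L\<^sup>2 \<le> 8 / L" using L by (intro divide_left_mono) (auto simp: power2_eq_square)
    finally have X2: "\<bar>X2 x\<bar> \<le> 8 / L" .
    define o' where "o' = outer x t"
    define s where "s = outer_slope x t"
    define v where "v = (u x t)\<^sup>2"
    have o: "1 \<le> o'" and s: "0 \<le> s" "s \<le> 4 * m * o'" "\<bar>outer_x x t\<bar> \<le> s" and xx: "outer_xx x t \<le> 8 * m\<^sup>2 * o'"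
      using outer_bounds unfolding o'_def s_def by auto
    have v: "v \<ge> 0" by (simp add: v_def)
    have ub: "\<bar>u x t\<bar> \<le> B / sqrt t" using u_bound[OF t] by (simp add: B_def)
    have t2: "X2 x * o' \<le> 8 / L * o'" using X2 o by (intro mult_right_mono) auto
    have "\<bar>X1 x * outer_x x t\<bar> \<le> 4 / L * (4 * m * o')"
      unfolding abs_mult using X1 s L by (intro mult_mono) auto
    hence t3: "2 * X1 x * outer_x x t \<le> 32 * m / L * o'" by (simp add: abs_le_iff)
    have t4: "X x * outer_xx x t \<le> X x * (8 * m\<^sup>2 * o')" using X0 xx by (intro mult_left_mono) auto
    have O2: "O2 x \<le> 8 / L * o' + 32 * m / L * o' + X x * (8 * m\<^sup>2 * o')"
      unfolding O2_def o'_def[symmetric] using t2 t3 t4 by linarith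
    have a1: "\<mu> * O2 x * v \<le> \<mu> * (8 / L * o' + 32 * m / L * o' + X x * (8 * m\<^sup>2 * o')) * v"
      using O2 mu_pos v by (intro mult_right_mono mult_left_mono) auto
    have "O1 x * u x t \<le> \<bar>O1 x\<bar> * \<bar>u x t\<bar>" by (metis abs_ge_self abs_mult)
    also have "\<dots> \<le> (4 / L * o' + X x * s) * (B / sqrt t)"
    proof (intro mult_mono ub)
      have "\<bar>O1 x\<bar> \<le> \<bar>X1 x * o'\<bar> + \<bar>X x * outer_x x t\<bar>" unfolding O1_def o'_def by (rule abs_triangle_ineq)
      also have "\<dots> \<le> 4 / L * o' + X x * s"
        unfolding abs_mult using X1 X0 s o L by (intro add_mono mult_mono) auto
      finally show "\<bar>O1 x\<bar> \<le> 4 / L * o' + X x * s" .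
      show "0 \<le> 4 / L * o' + X x * s" using X0 s o L by auto
    qed auto
    finally have "2/3 * (O1 x * u x t) * v \<le> 2/3 * ((4 / L * o' + X x * s) * (B / sqrt t)) * v"
      using v by (intro mult_right_mono mult_left_mono) auto
    also have "\<dots> = 8/3 * B / L * (1 / sqrt t) * (o' * v) + k t * X x * s * v"
    proof -
      define q where "q = B / sqrt t"
      define il where "il = 1 / L"
      have e: "4 / L = 4 * il" "k t = 2/3 * q" "8/3 * B / L * (1 / sqrt t) = 8/3 * il * q"
        by (simp_all add: k_def B_def q_def il_def)
      show ?thesis unfolding e q_def[symmetric] by (simp add: algebra_simps)
    qed
    \<comment> \<open>the term with \<open>k t\<close> is the one that the moving front cancels\<close>
    finally have a2: "2/3 * O1 x * (u x t)^3 \<le> 8/3 * B / L * (1 / sqrt t) * (o' * v) + k t * X x * s * v"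
      by (simp add: v_def power2_eq_square power3_eq_cube algebra_simps)
    have a3: "0 \<le> 2 * \<mu> * (X x * o') * (ux x t)\<^sup>2" using mu_pos X0 o by auto
    have "G x \<le> \<mu> * (8 / L * o' + 32 * m / L * o' + X x * (8 * m\<^sup>2 * o')) * v + 8/3 * B / L * (1 / sqrt t) * (o' * v)"
    proof -
      define T1 T2 T3 T4 where "T1 = \<mu> * O2 x * v" and "T2 = 2/3 * O1 x * (u x t)^3"
        and "T3 = 2 * \<mu> * (X x * o') * (ux x t)\<^sup>2" and "T4 = k t * X x * s * v"
      have "G x = - T4 - T3 + T1 + T2"
        by (simp add: G_def T1_def T2_def T3_def T4_def o'_def s_def v_def)
      thus ?thesis using a1 a2 a3 unfolding T1_def[symmetric] T2_def[symmetric] T3_def[symmetric] T4_def[symmetric] by linarith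
    qed
    also have "\<dots> = 8 * m\<^sup>2 * \<mu> * (X x * o' * v) + ((32 * m * \<mu> + 8 * \<mu>) / L + 8/3 * B / L * (1 / sqrt t)) * (o' * v)"
      using L by (simp add: field_simps)
    also have "\<dots> \<le> 8 * m\<^sup>2 * \<mu> * (X x * o' * v) + c * (o' * v)"
    proof -
      have "c - ((32 * m * \<mu> + 8 * \<mu>) / L + 8/3 * B / L * (1 / sqrt t)) = (32 * m * \<mu> + 8 * \<mu>) / L * (1 / sqrt t) + 8/3 * B / L"
        unfolding c_def using L st by (simp add: field_simps)
      also have "\<dots> \<ge> 0" using L st m mu_pos B by auto
      finally show ?thesis using o v by (intro add_left_mono mult_right_mono) auto
    qed
    finally show "G x \<le> 8 * m\<^sup>2 * \<mu> * (X x * outer x t * (u x t)\<^sup>2) + c * (outer x t * (u x t)\<^sup>2)"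
      by (simp add: o'_def v_def)
  qed
  also have "\<dots> = 8 * m\<^sup>2 * \<mu> * energy L t + c * integral {-L..L} (\<lambda>x. outer x t * (u x t)\<^sup>2)"
    unfolding energy_def X_def using t
    by (subst integral_add) (auto intro!: integrable_continuous_real cont simp: integral_mult_right)
  also have "\<dots> \<le> 8 * m\<^sup>2 * \<mu> * energy L t + c * N"
  proof (intro add_left_mono mult_left_mono c0)
    have "integral {-L..L} (\<lambda>x. outer x t * (u x t)\<^sup>2) \<le> (LINT x|lborel. outer x t * (u x t)\<^sup>2)"
      using outer_integrable[OF t] by (intro hk_integral_le_LINT outer_u_cont outer_u_nonneg t)
    thus "integral {-L..L} (\<lambda>x. outer x t * (u x t)\<^sup>2) \<le> N" using N by simp
  qed
  finally show ?thesis using 1 unfolding 4 c_def B_def by blast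
qed

text \<open>
  The function \<open>exp (- 8 * m\<^sup>2 * \<mu> * s) * energy L s - c * (s + 2 * sqrt s)\<close> is nonincreasing: the
  derivative \<open>1 + 1 / sqrt s\<close> of the last bracket matches the singularity in \<open>energy_t\<close>, which is
  integrable at \<open>0\<close>. So the energy at time \<open>t\<close> is compared with the energy near the initial time.
\<close>

lemma energy_exponential_bound:
  assumes L: "L \<ge> 1" and t: "t > 0"
    and N: "\<And>s. 0 < s \<Longrightarrow> s \<le> t \<Longrightarrow> (LINT x|lborel. outer x s * (u x s)\<^sup>2) \<le> N"
  shows "energy L t \<le> exp (8 * m\<^sup>2 * \<mu> * t) *
     (3 * E0 + (32 * m * \<mu> + 8 * \<mu> + 8/3 * (2 * A + 1/2)) * N * (t + 2 * sqrt t) / L)"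
proof -
  define \<Lambda> where "\<Lambda> = 8 * m\<^sup>2 * \<mu>"
  define c where "c = (32 * m * \<mu> + 8 * \<mu> + 8/3 * (2 * A + 1/2)) / L * N"
  have "0 \<le> (LINT x|lborel. outer x t * (u x t)\<^sup>2)"
    by (intro integral_nonneg_AE always_eventually allI outer_u_nonneg)
  hence N0: "N \<ge> 0" using N[OF t] by simp
  have c0: "c \<ge> 0" unfolding c_def using m mu_pos A_nonneg L N0
    by (intro mult_nonneg_nonneg divide_nonneg_nonneg add_nonneg_nonneg) auto
  have l0: "\<Lambda> \<ge> 0" using mu_pos by (simp add: \<Lambda>_def)
  define F where "F s = exp (- \<Lambda> * s) * energy L s - c * (s + 2 * sqrt s)" for s
  have F: "\<exists>D. (F has_real_derivative D) (at s) \<and> D \<le> 0" if s: "0 < s" "s \<le> t" for s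
  proof -
    from energy_t[OF L s(1) N[OF s]] obtain D where D: "(energy L has_real_derivative D) (at s)"
      "D \<le> \<Lambda> * energy L s + (32 * m * \<mu> + 8 * \<mu> + 8/3 * (2 * A + 1/2)) / L * (1 + 1 / sqrt s) * N"
      unfolding \<Lambda>_def by blast
    have D': "D - \<Lambda> * energy L s \<le> c * (1 + 1 / sqrt s)" using D(2) by (simp add: c_def mult_ac)
    have e: "((\<lambda>s. exp (- \<Lambda> * s)) has_real_derivative - \<Lambda> * exp (- \<Lambda> * s)) (at s)"
      by (auto intro!: derivative_eq_intros)
    have g: "((\<lambda>s. c * (s + 2 * sqrt s)) has_real_derivative c * (1 + 1 / sqrt s)) (at s)"
      using s(1) by (auto intro!: derivative_eq_intros simp: field_simps)
    have "(F has_real_derivative - \<Lambda> * exp (- \<Lambda> * s) * energy L s + D * exp (- \<Lambda> * s) - c * (1 + 1 / sqrt s)) (at s)"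
      unfolding F_def[abs_def] using DERIV_diff[OF DERIV_mult[OF e D(1)] g] .
    moreover have "exp (- \<Lambda> * s) * (D - \<Lambda> * energy L s) \<le> 1 * (c * (1 + 1 / sqrt s))"
    proof -
      have "exp (- \<Lambda> * s) * (D - \<Lambda> * energy L s) \<le> exp (- \<Lambda> * s) * (c * (1 + 1 / sqrt s))"
        by (intro mult_left_mono D') auto
      also have "\<dots> \<le> 1 * (c * (1 + 1 / sqrt s))"
        using l0 s c0 by (intro mult_right_mono mult_nonneg_nonneg) auto
      finally show ?thesis .
    qed
    hence "- \<Lambda> * exp (- \<Lambda> * s) * energy L s + D * exp (- \<Lambda> * s) - c * (1 + 1 / sqrt s) \<le> 0"
      by (simp add: algebra_simps)
    ultimately show ?thesis by blast
  qed
  have "\<forall>\<^sub>F s in at_right 0. s < t" using order_tendstoD(2)[OF tendsto_ident_at t] .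
  hence "\<forall>\<^sub>F s in at_right 0. 0 < s \<and> s < t \<and> (LINT x|lborel. (1 + x\<^sup>2) powr m * (u x s)\<^sup>2) \<le> E0"
    using weighted_initial eventually_at_right_less[of "0::real"] by eventually_elim auto
  then obtain s where s: "0 < s" "s < t" and E: "(LINT x|lborel. (1 + x\<^sup>2) powr m * (u x s)\<^sup>2) \<le> E0"
    using eventually_happens'[of "at_right (0::real)"] by (auto simp: trivial_limit_at_right_real)
  have e1: "energy L s \<le> 3 * E0"
  proof -
    have "energy L s \<le> integral {-L..L} (\<lambda>x. outer x s * (u x s)\<^sup>2)"
      unfolding energy_def
    proof (rule integral_le)
      show "(\<lambda>x. cutoff L 0 x * outer x s * (u x s)\<^sup>2) integrable_on {-L..L}" "(\<lambda>x. outer x s * (u x s)\<^sup>2) integrable_on {-L..L}"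
        using s L by (intro integrable_continuous_real continuous_intros outer_cont; simp)+
      fix x assume x: "x \<in> {-L..L}"
      have y1: "\<bar>x - 0\<bar> \<le> L" using x by (auto simp: abs_le_iff)
      have "cutoff L 0 x * (outer x s * (u x s)\<^sup>2) \<le> 1 * (outer x s * (u x s)\<^sup>2)"
        using cutoff_bounds(2)[OF _ y1] L outer_ge_1[of x s] by (intro mult_right_mono) auto
      thus "cutoff L 0 x * outer x s * (u x s)\<^sup>2 \<le> outer x s * (u x s)\<^sup>2" by (simp add: mult.assoc)
    qed
    also have "\<dots> \<le> (LINT x|lborel. outer x s * (u x s)\<^sup>2)"
      using outer_integrable[OF s(1)] s by (intro hk_integral_le_LINT outer_u_cont outer_u_nonneg)
    also have "\<dots> \<le> 3 * E0" using outer_integrable(2)[OF s(1)] E by simp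
    finally show ?thesis .
  qed
  have E0: "E0 \<ge> 0"
    by (rule order_trans[OF _ E], intro integral_nonneg_AE always_eventually allI) auto
  have "F t \<le> F s"
    using s F by (intro DERIV_nonpos_imp_nonincreasing[of s t F]) auto
  also have "F s \<le> 3 * E0"
  proof -
    have "exp (- \<Lambda> * s) * energy L s \<le> exp (- \<Lambda> * s) * (3 * E0)" using e1 by (intro mult_left_mono) auto
    also have "\<dots> \<le> 1 * (3 * E0)" using l0 s E0 by (intro mult_right_mono) auto
    finally have "exp (- \<Lambda> * s) * energy L s \<le> 3 * E0" by simp
    moreover have "0 \<le> c * (s + 2 * sqrt s)" using c0 s by auto
    ultimately show ?thesis unfolding F_def by linarith
  qed
  finally have "exp (- \<Lambda> * t) * energy L t \<le> 3 * E0 + c * (t + 2 * sqrt t)" by (simp add: F_def)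
  hence "exp (\<Lambda> * t) * (exp (- \<Lambda> * t) * energy L t) \<le> exp (\<Lambda> * t) * (3 * E0 + c * (t + 2 * sqrt t))"
    by (intro mult_left_mono) auto
  hence "energy L t \<le> exp (\<Lambda> * t) * (3 * E0 + c * (t + 2 * sqrt t))"
    by (simp add: mult.assoc[symmetric] exp_add[symmetric])
  thus ?thesis by (simp add: \<Lambda>_def c_def mult_ac)
qed

theorem outer_energy:
  assumes t: "t > 0"
  shows "(LINT x|lborel. outer x t * (u x t)\<^sup>2) \<le> exp (8 * m\<^sup>2 * \<mu> * t) * (3 * E0)"
proof -
  obtain B where B: "\<And>s. 0 < s \<Longrightarrow> s \<le> t \<Longrightarrow> (LINT x|lborel. (1 + x\<^sup>2) powr m * (u x s)\<^sup>2) \<le> B"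
    using weighted_bounded[of t] by blast
  have N: "(LINT x|lborel. outer x s * (u x s)\<^sup>2) \<le> 3 * B" if "0 < s" "s \<le> t" for s
    using outer_integrable(2)[OF that(1)] B[OF that] by linarith
  have eq: "energy (real n + 1) t = (LINT x|lborel. indicator {0-(real n + 1)..0+(real n + 1)} x * cutoff (real n + 1) 0 x * (outer x t * (u x t)\<^sup>2))" for n
    unfolding energy_def using t
    by (subst hk_integral_eq_LINT) (auto intro!: continuous_intros outer_cont simp: mult.assoc)
  have lim: "(\<lambda>n. energy (real n + 1) t) \<longlonglongrightarrow> (LINT x|lborel. outer x t * (u x t)\<^sup>2)"
    unfolding eq by (rule cutoff_LINT_tendsto[OF outer_integrable(1)[OF t]])
  define K where "K = (32 * m * \<mu> + 8 * \<mu> + 8/3 * (2 * A + 1/2)) * (3 * B) * (t + 2 * sqrt t)"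
  have "(\<lambda>n. exp (8 * m\<^sup>2 * \<mu> * t) * (3 * E0 + K / (real n + 1))) \<longlonglongrightarrow> exp (8 * m\<^sup>2 * \<mu> * t) * (3 * E0 + 0)"
    by (intro tendsto_intros real_tendsto_divide_at_top[OF tendsto_const filterlim_real_plus_1])
  from tendsto_le[OF trivial_limit_sequentially this lim] show ?thesis
    using energy_exponential_bound[of "real n + 1" t "3 * B" for n, OF _ t N] by (simp add: K_def)
qed

end

section \<open>From self-similar to physical variables\<close>

lemma integrable_inverse_1_plus_square_UNIV:
  "integrable lborel (\<lambda>x::real. inverse (1 + x\<^sup>2))" "(LINT x|lborel. inverse (1 + x\<^sup>2)) = pi"
  using integrable_inverse_1_plus_square LBINT_inverse_1_plus_square
  by (auto simp: set_integrable_def interval_lebesgue_integral_def set_lebesgue_integral_def einterval_def)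

abbreviation weighted_L2_sq :: "real \<Rightarrow> (real \<Rightarrow> real) \<Rightarrow> real" where
  "weighted_L2_sq m f \<equiv> (LINT x|lborel. (1 + x\<^sup>2) powr m * (f x)\<^sup>2)"

text \<open>
  Pointwise \<open>2 * \<bar>f\<bar> \<le> l * weight * f\<^sup>2 + 1 / (l * weight)\<close>, and the inverse weight is at most
  \<open>inverse (1 + x\<^sup>2)\<close>, whose integral is \<open>pi\<close>. The free parameter \<open>l\<close> turns smallness of the weighted
  norm into smallness of the integral of \<open>\<bar>f\<bar>\<close>.
\<close>

lemma weighted_L2_imp_L1:
  assumes m: "m \<ge> 1" and f: "f \<in> weighted_L2 m"
  shows "integrable lborel f" "l > 0 \<Longrightarrow> (LINT x|lborel. \<bar>f x\<bar>) \<le> (l * weighted_L2_sq m f + pi / l) / 2"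
proof -
  have fi: "integrable lborel (\<lambda>x. (1 + x\<^sup>2) powr m * (f x)\<^sup>2)" and [measurable]: "f \<in> borel_measurable lborel"
    using f by (auto simp: weighted_L2_def)
  have ptw: "\<bar>f x\<bar> \<le> (l * ((1 + x\<^sup>2) powr m * (f x)\<^sup>2) + inverse (1 + x\<^sup>2) / l) / 2" if l: "l > 0" for x l
  proof -
    have p: "1 + x\<^sup>2 \<ge> 1" by simp
    have r: "(1 + x\<^sup>2) \<le> (1 + x\<^sup>2) powr m" using powr_mono[of 1 m "1 + x\<^sup>2"] m p by simp
    have "0 \<le> (l * (1 + x\<^sup>2) * \<bar>f x\<bar> - 1)\<^sup>2" by simp
    hence "2 * (l * (1 + x\<^sup>2)) * \<bar>f x\<bar> \<le> (l * (1 + x\<^sup>2))\<^sup>2 * (f x)\<^sup>2 + 1"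
      by (simp add: power2_eq_square algebra_simps)
    hence "\<bar>f x\<bar> \<le> ((l * (1 + x\<^sup>2))\<^sup>2 * (f x)\<^sup>2 + 1) / (2 * (l * (1 + x\<^sup>2)))"
      using l p by (subst pos_le_divide_eq) (auto simp: mult_ac add_pos_nonneg)
    also have "\<dots> = (l * ((1 + x\<^sup>2) * (f x)\<^sup>2) + inverse (1 + x\<^sup>2) / l) / 2"
    proof -
      define q where "q = 1 + x\<^sup>2"
      have "q > 0" using p unfolding q_def by linarith
      thus ?thesis unfolding q_def[symmetric] using l by (simp add: field_simps power2_eq_square)
    qed
    also have "\<dots> \<le> (l * ((1 + x\<^sup>2) powr m * (f x)\<^sup>2) + inverse (1 + x\<^sup>2) / l) / 2"
      using r l by (intro divide_right_mono add_right_mono mult_left_mono mult_right_mono) auto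
    finally show ?thesis .
  qed
  have gi: "integrable lborel (\<lambda>x. (l * ((1 + x\<^sup>2) powr m * (f x)\<^sup>2) + inverse (1 + x\<^sup>2) / l) / 2)" for l
    using fi integrable_inverse_1_plus_square_UNIV(1)
    by (intro integrable_divide Bochner_Integration.integrable_add integrable_mult_right) auto
  show 1: "integrable lborel f"
    by (rule Bochner_Integration.integrable_bound[OF gi[of 1]]) (use ptw[of 1] in \<open>auto intro: order_trans[OF _ abs_ge_self]\<close>)
  assume l: "l > 0"
  have "(LINT x|lborel. \<bar>f x\<bar>) \<le> (LINT x|lborel. (l * ((1 + x\<^sup>2) powr m * (f x)\<^sup>2) + inverse (1 + x\<^sup>2) / l) / 2)"
    by (intro integral_mono gi ptw l integrable_abs 1)
  also have "\<dots> = (l * weighted_L2_sq m f + pi / l) / 2"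
    using fi integrable_inverse_1_plus_square_UNIV by simp
  finally show "(LINT x|lborel. \<bar>f x\<bar>) \<le> (l * weighted_L2_sq m f + pi / l) / 2" .
qed

lemma weighted_L2_diff:
  assumes "f \<in> weighted_L2 m" "g \<in> weighted_L2 m"
  shows "(\<lambda>x. f x - g x) \<in> weighted_L2 m" "weighted_L2_sq m f \<le> 2 * weighted_L2_sq m (\<lambda>x. f x - g x) + 2 * weighted_L2_sq m g"
proof -
  have fi: "integrable lborel (\<lambda>x. (1 + x\<^sup>2) powr m * (f x)\<^sup>2)" and gi: "integrable lborel (\<lambda>x. (1 + x\<^sup>2) powr m * (g x)\<^sup>2)"
    and [measurable]: "f \<in> borel_measurable lborel" "g \<in> borel_measurable lborel"
    using assms by (auto simp: weighted_L2_def)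
  have sq: "(a + b)\<^sup>2 \<le> 2 * a\<^sup>2 + 2 * b\<^sup>2" for a b :: real
    using zero_le_power2[of "a - b"] by (simp add: power2_eq_square algebra_simps)
  have ptw: "(1 + x\<^sup>2) powr m * (a + b)\<^sup>2 \<le> 2 * ((1 + x\<^sup>2) powr m * a\<^sup>2) + 2 * ((1 + x\<^sup>2) powr m * b\<^sup>2)" for x a b :: real
    using mult_left_mono[OF sq[of a b], of "(1 + x\<^sup>2) powr m"] by (simp add: algebra_simps)
  have di: "integrable lborel (\<lambda>x. (1 + x\<^sup>2) powr m * (f x - g x)\<^sup>2)"
  proof (rule Bochner_Integration.integrable_bound)
    show "integrable lborel (\<lambda>x. 2 * ((1 + x\<^sup>2) powr m * (f x)\<^sup>2) + 2 * ((1 + x\<^sup>2) powr m * (g x)\<^sup>2))"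
      using fi gi by auto
    show "AE x in lborel. norm ((1 + x\<^sup>2) powr m * (f x - g x)\<^sup>2) \<le> norm (2 * ((1 + x\<^sup>2) powr m * (f x)\<^sup>2) + 2 * ((1 + x\<^sup>2) powr m * (g x)\<^sup>2))"
      using ptw[of _ "f _" "- g _"] by (intro always_eventually allI) (auto intro: order_trans[OF _ abs_ge_self])
  qed measurable
  thus "(\<lambda>x. f x - g x) \<in> weighted_L2 m" by (simp add: weighted_L2_def)
  have "weighted_L2_sq m f \<le> (LINT x|lborel. 2 * ((1 + x\<^sup>2) powr m * (f x - g x)\<^sup>2) + 2 * ((1 + x\<^sup>2) powr m * (g x)\<^sup>2))"
  proof (rule integral_mono)
    show "(1 + x\<^sup>2) powr m * (f x)\<^sup>2 \<le> 2 * ((1 + x\<^sup>2) powr m * (f x - g x)\<^sup>2) + 2 * ((1 + x\<^sup>2) powr m * (g x)\<^sup>2)" for x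
      using ptw[of x "f x - g x" "g x"] by simp
  qed (use fi gi di in auto)
  also have "\<dots> = 2 * weighted_L2_sq m (\<lambda>x. f x - g x) + 2 * weighted_L2_sq m g" using gi di by simp
  finally show "weighted_L2_sq m f \<le> 2 * weighted_L2_sq m (\<lambda>x. f x - g x) + 2 * weighted_L2_sq m g" .
qed

lemma primitive_continuous:
  fixes h :: "real \<Rightarrow> real"
  assumes h: "integrable lborel h"
  shows "continuous_on UNIV (\<lambda>y. LINT x:{..y}|lborel. h x)"
proof -
  have "isCont (\<lambda>y. LINT x:{..y}|lborel. h x) y" for y
    unfolding continuous_at_sequentially o_def
  proof (intro allI impI)
    fix X assume X: "X \<longlonglongrightarrow> y"
    show "(\<lambda>n. LINT x:{..X n}|lborel. h x) \<longlonglongrightarrow> (LINT x:{..y}|lborel. h x)"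
      unfolding set_lebesgue_integral_def
    proof (rule integral_dominated_convergence[where w="\<lambda>x. \<bar>h x\<bar>"])
      show "AE x in lborel. (\<lambda>n. indicat_real {..X n} x *\<^sub>R h x) \<longlonglongrightarrow> indicat_real {..y} x *\<^sub>R h x"
      proof (rule eventually_mono[OF AE_lborel_singleton[of y]])
        fix x assume x: "x \<noteq> y"
        have "\<forall>\<^sub>F n in sequentially. indicat_real {..y} x *\<^sub>R h x = indicat_real {..X n} x *\<^sub>R h x"
        proof (cases "x < y")
          case True
          from order_tendstoD(1)[OF X this] show ?thesis by eventually_elim (use True in \<open>auto simp: indicator_def\<close>)
        next
          case False
          hence "y < x" using x by simp
          from order_tendstoD(2)[OF X this] show ?thesis by eventually_elim (use \<open>y < x\<close> in \<open>auto simp: indicator_def\<close>)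
        qed
        thus "(\<lambda>n. indicat_real {..X n} x *\<^sub>R h x) \<longlonglongrightarrow> indicat_real {..y} x *\<^sub>R h x"
          by (rule Lim_transform_eventually[OF tendsto_const])
      qed
    qed (use h in \<open>auto simp: indicator_def\<close>)
  qed
  thus ?thesis by (simp add: continuous_on_eq_continuous_at)
qed

lemma primitive_bound:
  fixes h :: "real \<Rightarrow> real"
  assumes h: "integrable lborel h"
  shows "\<bar>LINT x:{..y}|lborel. h x\<bar> \<le> (LINT x|lborel. \<bar>h x\<bar>)"
  unfolding set_lebesgue_integral_def
proof (rule order_trans[OF integral_abs_bound integral_mono])
  show "integrable lborel (\<lambda>x. \<bar>indicat_real {..y} x *\<^sub>R h x\<bar>)"
    by (intro integrable_abs integrable_mult_indicator h) auto
qed (use h in \<open>auto simp: indicator_def\<close>)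

lemma LINT_rescale:
  fixes F :: "real \<Rightarrow> real"
  assumes "c > 0"
  shows "(LINT x|lborel. F (x / c)) = c * (LINT x|lborel. F x)"
    "integrable lborel F \<Longrightarrow> integrable lborel (\<lambda>x. F (x / c))"
  using lborel_integral_real_affine[of c "\<lambda>x. F (x / c)" 0] assms
    lborel_integrable_real_affine_iff[of "1/c" F 0] by auto

lemma weighted_L2_sq_nonneg: "0 \<le> weighted_L2_sq m f"
  by (intro integral_nonneg_AE always_eventually allI) auto

lemma weighted_L2_sq_eq: "weighted_L2_sq m f = (weighted_L2_norm m f)\<^sup>2"
  using weighted_L2_sq_nonneg[of m f] by (simp add: weighted_L2_norm_def)

text \<open>
  Continuity in time gives a bound near every time, and bisection turns it into a bound on \<open>[0, T]\<close>.
\<close>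

lemma rescaled_solution_locally_bounded:
  assumes sol: "rescaled_Burgers_solution m \<mu> h w" and T: "0 \<le> T"
  shows "\<exists>B. \<forall>\<tau>\<in>{0..T}. weighted_L2_sq m (\<lambda>\<xi>. w \<xi> \<tau>) \<le> B"
proof (rule Bolzano[where P="\<lambda>a b. \<exists>B. \<forall>\<tau>\<in>{a..b}. 0 \<le> \<tau> \<longrightarrow> weighted_L2_sq m (\<lambda>\<xi>. w \<xi> \<tau>) \<le> B", OF T, THEN exE])
  fix a b c assume 1: "\<exists>B. \<forall>\<tau>\<in>{a..b}. 0 \<le> \<tau> \<longrightarrow> weighted_L2_sq m (\<lambda>\<xi>. w \<xi> \<tau>) \<le> B"
    and 2: "\<exists>B. \<forall>\<tau>\<in>{b..c}. 0 \<le> \<tau> \<longrightarrow> weighted_L2_sq m (\<lambda>\<xi>. w \<xi> \<tau>) \<le> B"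
  obtain B1 B2 where B1: "\<forall>\<tau>\<in>{a..b}. 0 \<le> \<tau> \<longrightarrow> weighted_L2_sq m (\<lambda>\<xi>. w \<xi> \<tau>) \<le> B1"
    and B2: "\<forall>\<tau>\<in>{b..c}. 0 \<le> \<tau> \<longrightarrow> weighted_L2_sq m (\<lambda>\<xi>. w \<xi> \<tau>) \<le> B2" using 1 2 by (elim exE)
  have "\<forall>\<tau>\<in>{a..c}. 0 \<le> \<tau> \<longrightarrow> weighted_L2_sq m (\<lambda>\<xi>. w \<xi> \<tau>) \<le> max B1 B2"
  proof (intro ballI impI)
    fix \<tau> assume "\<tau> \<in> {a..c}" "0 \<le> \<tau>"
    thus "weighted_L2_sq m (\<lambda>\<xi>. w \<xi> \<tau>) \<le> max B1 B2"
      using B1 B2 by (cases "\<tau> \<le> b") (auto simp: le_max_iff_disj)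
  qed
  thus "\<exists>B. \<forall>\<tau>\<in>{a..c}. 0 \<le> \<tau> \<longrightarrow> weighted_L2_sq m (\<lambda>\<xi>. w \<xi> \<tau>) \<le> B" by blast
next
  fix x assume x: "0 \<le> x" "x \<le> T"
  have L2: "(\<lambda>\<xi>. w \<xi> \<tau>) \<in> weighted_L2 m" if "\<tau> \<ge> 0" for \<tau>
    using sol that by (simp add: rescaled_Burgers_solution_def)
  have "((\<lambda>s. weighted_L2_norm m (\<lambda>\<xi>. w \<xi> s - w \<xi> x)) \<longlongrightarrow> 0) (at x within {0..})"
    using sol x by (simp add: rescaled_Burgers_solution_def)
  from order_tendstoD(2)[OF this, of 1] obtain d where d: "d > 0"
    "\<And>s. 0 \<le> s \<Longrightarrow> s \<noteq> x \<Longrightarrow> dist s x < d \<Longrightarrow> weighted_L2_norm m (\<lambda>\<xi>. w \<xi> s - w \<xi> x) < 1"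
    by (auto simp: eventually_at)
  have bd: "weighted_L2_sq m (\<lambda>\<xi>. w \<xi> s) \<le> 2 + 2 * weighted_L2_sq m (\<lambda>\<xi>. w \<xi> x)" if s: "0 \<le> s" "dist s x < d" for s
  proof (cases "s = x")
    case True
    thus ?thesis using weighted_L2_sq_nonneg[of m "\<lambda>\<xi>. w \<xi> x"] by simp
  next
    case False
    have "0 \<le> weighted_L2_norm m (\<lambda>\<xi>. w \<xi> s - w \<xi> x)"
      unfolding weighted_L2_norm_def using weighted_L2_sq_nonneg[of m "\<lambda>\<xi>. w \<xi> s - w \<xi> x"] by simp
    hence "weighted_L2_sq m (\<lambda>\<xi>. w \<xi> s - w \<xi> x) \<le> 1"
      unfolding weighted_L2_sq_eq using d(2)[OF s(1) False s(2)] by (simp add: power_le_one)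
    thus ?thesis using weighted_L2_diff(2)[OF L2[OF s(1)] L2[OF x(1)]] by linarith
  qed
  show "\<exists>d>0. \<forall>a b. a \<le> x \<and> x \<le> b \<and> b - a < d \<longrightarrow>
      (\<exists>B. \<forall>\<tau>\<in>{a..b}. 0 \<le> \<tau> \<longrightarrow> weighted_L2_sq m (\<lambda>\<xi>. w \<xi> \<tau>) \<le> B)"
  proof (rule exI[of _ d], rule conjI, rule d(1), rule allI, rule allI, rule impI)
    fix a b assume "a \<le> x \<and> x \<le> b \<and> b - a < d"
    thus "\<exists>B. \<forall>\<tau>\<in>{a..b}. 0 \<le> \<tau> \<longrightarrow> weighted_L2_sq m (\<lambda>\<xi>. w \<xi> \<tau>) \<le> B"
      by (intro exI[of _ "2 + 2 * weighted_L2_sq m (\<lambda>\<xi>. w \<xi> x)"]) (auto intro!: bd simp: dist_real_def)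
  qed
next
  fix B assume "\<forall>\<tau>\<in>{0..T}. 0 \<le> \<tau> \<longrightarrow> weighted_L2_sq m (\<lambda>\<xi>. w \<xi> \<tau>) \<le> B"
  thus ?thesis by auto
qed

text \<open>
  The potential is invariant under the change of variables up to the dilation
  \<open>x \<mapsto> x / sqrt (1 + t)\<close>, so convergence of the integrals of \<open>w\<close> and continuity of the primitive
  of \<open>h\<close> give the initial condition. The constants in \<open>4 + 4 * weighted_L2_sq m h\<close> come from
  the dilation factor and the weighted distance of \<open>w\<close> to \<open>h\<close>, which are below \<open>2\<close> and \<open>1\<close> for small
  times.
\<close>

theorem unscaled_solution:
  assumes m: "m > 3/2" and h: "h \<in> weighted_L2 m" and mu: "\<mu> > 0"
    and sol: "rescaled_Burgers_solution m \<mu> h w"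
  obtains ux uxx where "weighted_burgers \<mu> (\<lambda>x t. w (x / sqrt (1 + t)) (ln (1 + t)) / sqrt (1 + t)) ux uxx
     (\<lambda>y. LINT x:{..y}|lborel. h x) (LINT x|lborel. \<bar>h x\<bar>) m (4 + 4 * weighted_L2_sq m h)"
proof -
  obtain w1 w2 where
      cw0: "continuous_on (UNIV \<times> {0<..}) (\<lambda>z. w (fst z) (snd z))"
    and cw10: "continuous_on (UNIV \<times> {0<..}) (\<lambda>z. w1 (fst z) (snd z))"
    and cw20: "continuous_on (UNIV \<times> {0<..}) (\<lambda>z. w2 (fst z) (snd z))"
    and w_x: "\<And>\<xi> \<tau>. \<tau> > 0 \<Longrightarrow> ((\<lambda>\<eta>. w \<eta> \<tau>) has_real_derivative w1 \<xi> \<tau>) (at \<xi>)"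
    and w1_x: "\<And>\<xi> \<tau>. \<tau> > 0 \<Longrightarrow> ((\<lambda>\<eta>. w1 \<eta> \<tau>) has_real_derivative w2 \<xi> \<tau>) (at \<xi>)"
    and w_t0: "\<And>\<xi> \<tau>. \<tau> > 0 \<Longrightarrow> ((\<lambda>s. w \<xi> s) has_real_derivative
              \<mu> * w2 \<xi> \<tau> + 1/2 * deriv (\<lambda>\<eta>. \<eta> * w \<eta> \<tau>) \<xi> - w \<xi> \<tau> * w1 \<xi> \<tau>) (at \<tau>)"
    using sol unfolding rescaled_Burgers_solution_def case_prod_unfold by blast
  have L2: "(\<lambda>\<xi>. w \<xi> \<tau>) \<in> weighted_L2 m" if "\<tau> \<ge> 0" for \<tau>
    using sol that by (simp add: rescaled_Burgers_solution_def)
  have m1: "m \<ge> 1" using m by simp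
  note cw [continuous_intros] =
    continuous_on_compose2[OF cw0, of _ "\<lambda>z. (f z, g z)" for f g, unfolded fst_conv snd_conv]
    continuous_on_compose2[OF cw10, of _ "\<lambda>z. (f z, g z)" for f g, unfolded fst_conv snd_conv]
    continuous_on_compose2[OF cw20, of _ "\<lambda>z. (f z, g z)" for f g, unfolded fst_conv snd_conv]
  define wt where "wt \<xi> \<tau> = \<mu> * w2 \<xi> \<tau> + 1/2 * (w \<xi> \<tau> + \<xi> * w1 \<xi> \<tau>) - w \<xi> \<tau> * w1 \<xi> \<tau>" for \<xi> \<tau>
  have w_t: "((\<lambda>s. w \<xi> s) has_real_derivative wt \<xi> \<tau>) (at \<tau>)" if "\<tau> > 0" for \<xi> \<tau>
  proof -
    have "((\<lambda>\<eta>. \<eta> * w \<eta> \<tau>) has_real_derivative w \<xi> \<tau> + \<xi> * w1 \<xi> \<tau>) (at \<xi>)"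
      using DERIV_mult[OF DERIV_ident w_x[OF that]] by (simp add: algebra_simps)
    from DERIV_imp_deriv[OF this] show ?thesis using w_t0[OF that, of \<xi>] by (simp add: wt_def)
  qed
  have cwt: "continuous_on (UNIV \<times> {0<..}) (\<lambda>z. wt (fst z) (snd z))"
    unfolding wt_def by (intro continuous_intros cw0 cw10 cw20)
  define u where "u x t = w (x / sqrt (1 + t)) (ln (1 + t)) / sqrt (1 + t)" for x t
  define ux where "ux x t = w1 (x / sqrt (1 + t)) (ln (1 + t)) / (1 + t)" for x t
  define uxx where "uxx x t = w2 (x / sqrt (1 + t)) (ln (1 + t)) / ((1 + t) * sqrt (1 + t))" for x t
  have hi: "integrable lborel h" using weighted_L2_imp_L1(1)[OF m1 h] .
  have lnpos: "ln (1 + t) > 0" if "t > 0" for t :: real using that by simp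
  have int: "integrable lborel (\<lambda>x. u x t)"
      "(LINT x|lborel. \<bar>u x t\<bar>) = (LINT \<xi>|lborel. \<bar>w \<xi> (ln (1 + t))\<bar>)"
      "integrable lborel (\<lambda>x. (1 + x\<^sup>2) powr m * (u x t)\<^sup>2)"
      "weighted_L2_sq m (\<lambda>x. u x t) \<le> (1 + t) powr m * weighted_L2_sq m (\<lambda>\<xi>. w \<xi> (ln (1 + t)))"
      "(LINT y:{..x}|lborel. u y t) = (LINT \<xi>:{..x / sqrt (1 + t)}|lborel. w \<xi> (ln (1 + t)))"
    if t: "t > 0" for t x
  proof -
    define c where "c = sqrt (1 + t)"
    define g where "g \<xi> = w \<xi> (ln (1 + t))" for \<xi>
    have c: "c > 0" "c \<ge> 1" "c\<^sup>2 = 1 + t" using t by (auto simp: c_def)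
    have g: "g \<in> weighted_L2 m" unfolding g_def[abs_def] using L2 lnpos[OF t] by simp
    have gi: "integrable lborel g" using weighted_L2_imp_L1(1)[OF m1 g] .
    have g2: "integrable lborel (\<lambda>x. (1 + x\<^sup>2) powr m * (g x)\<^sup>2)" and [measurable]: "g \<in> borel_measurable lborel"
      using g by (auto simp: weighted_L2_def)
    have u: "u x t = g (x / c) / c" for x by (simp add: u_def g_def c_def)
    show "integrable lborel (\<lambda>x. u x t)" unfolding u
      by (intro integrable_divide LINT_rescale(2)[OF c(1)] gi)
    show "(LINT x|lborel. \<bar>u x t\<bar>) = (LINT \<xi>|lborel. \<bar>w \<xi> (ln (1 + t))\<bar>)"
      unfolding u g_def[symmetric] using LINT_rescale(1)[OF c(1), of "\<lambda>x. \<bar>g x\<bar> / c"] c by (simp add: abs_divide)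
    have "(LINT y:{..x}|lborel. u y t) = (LINT y|lborel. indicator {..x / c} (y / c) * (g (y / c) / c))"
      unfolding set_lebesgue_integral_def u using c
      by (intro Bochner_Integration.integral_cong refl) (auto simp: indicator_def divide_le_cancel)
    also have "\<dots> = c * (LINT y|lborel. indicator {..x / c} y * (g y / c))"
      by (rule LINT_rescale(1)[OF c(1)])
    finally show "(LINT y:{..x}|lborel. u y t) = (LINT \<xi>:{..x / sqrt (1 + t)}|lborel. w \<xi> (ln (1 + t)))"
      using c by (simp add: set_lebesgue_integral_def c_def[symmetric] g_def[symmetric])
    define F where "F \<xi> = (1 + (c * \<xi>)\<^sup>2) powr m * (g \<xi>)\<^sup>2 / c\<^sup>2" for \<xi>
    have F: "(1 + x\<^sup>2) powr m * (u x t)\<^sup>2 = F (x / c)" for x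
      using c by (simp add: F_def u power_divide)
    have F_le: "F \<xi> \<le> (1 + t) powr m / c\<^sup>2 * ((1 + \<xi>\<^sup>2) powr m * (g \<xi>)\<^sup>2)" for \<xi>
    proof -
      have "1 + (c * \<xi>)\<^sup>2 \<le> (1 + t) * (1 + \<xi>\<^sup>2)" using t c by (simp add: power_mult_distrib algebra_simps)
      hence "(1 + (c * \<xi>)\<^sup>2) powr m \<le> ((1 + t) * (1 + \<xi>\<^sup>2)) powr m" using m by (intro powr_mono2) auto
      also have "\<dots> = (1 + t) powr m * (1 + \<xi>\<^sup>2) powr m" by (rule powr_mult)
      finally have "(1 + (c * \<xi>)\<^sup>2) powr m * ((g \<xi>)\<^sup>2 / c\<^sup>2) \<le> ((1 + t) powr m * (1 + \<xi>\<^sup>2) powr m) * ((g \<xi>)\<^sup>2 / c\<^sup>2)"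
        by (intro mult_right_mono) auto
      thus ?thesis by (simp add: F_def mult_ac)
    qed
    have F0: "0 \<le> F \<xi>" for \<xi> by (simp add: F_def)
    have Fi: "integrable lborel F"
    proof (rule Bochner_Integration.integrable_bound)
      show "integrable lborel (\<lambda>\<xi>. (1 + t) powr m / c\<^sup>2 * ((1 + \<xi>\<^sup>2) powr m * (g \<xi>)\<^sup>2))"
        by (intro integrable_mult_right g2)
      show "AE \<xi> in lborel. norm (F \<xi>) \<le> norm ((1 + t) powr m / c\<^sup>2 * ((1 + \<xi>\<^sup>2) powr m * (g \<xi>)\<^sup>2))"
        using F_le F0 by (intro always_eventually allI) (auto intro: order_trans[OF _ abs_ge_self])
      show "F \<in> borel_measurable lborel" unfolding F_def[abs_def] by measurable
    qed
    show "integrable lborel (\<lambda>x. (1 + x\<^sup>2) powr m * (u x t)\<^sup>2)"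
      unfolding F by (rule LINT_rescale(2)[OF c(1) Fi])
    have "weighted_L2_sq m (\<lambda>x. u x t) = c * (LINT \<xi>|lborel. F \<xi>)"
      unfolding F by (rule LINT_rescale(1)[OF c(1)])
    also have "\<dots> \<le> c * (LINT \<xi>|lborel. (1 + t) powr m / c\<^sup>2 * ((1 + \<xi>\<^sup>2) powr m * (g \<xi>)\<^sup>2))"
      using c by (intro mult_left_mono integral_mono Fi integrable_mult_right g2 F_le) auto
    also have "\<dots> = (1 + t) powr m * weighted_L2_sq m g / c"
    proof -
      have "c * (k / c\<^sup>2 * i) = k * i / c" for k i using c(1) by (simp add: power2_eq_square)
      thus ?thesis by (simp only: integral_mult_right_zero)
    qed
    also have "\<dots> \<le> (1 + t) powr m * weighted_L2_sq m g"
      using divide_left_mono[of 1 c "(1 + t) powr m * weighted_L2_sq m g"] c weighted_L2_sq_nonneg[of m g] by simp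
    finally show "weighted_L2_sq m (\<lambda>x. u x t) \<le> (1 + t) powr m * weighted_L2_sq m (\<lambda>\<xi>. w \<xi> (ln (1 + t)))"
      by (simp add: g_def[abs_def])
  qed
  have bounded: "\<exists>B. \<forall>t. 0 < t \<and> t \<le> T \<longrightarrow> weighted_L2_sq m (\<lambda>x. u x t) \<le> B
      \<and> (LINT x|lborel. \<bar>u x t\<bar>) \<le> B" for T
  proof (cases "T > 0")
    case True
    have "0 \<le> ln (1 + T)" using True by simp
    from rescaled_solution_locally_bounded[OF sol this]
    obtain B where "\<forall>\<tau>\<in>{0..ln (1 + T)}. weighted_L2_sq m (\<lambda>\<xi>. w \<xi> \<tau>) \<le> B" by (elim exE)
    note B = this[THEN bspec]
    let ?B = "max ((1 + T) powr m * B) ((B + pi) / 2)"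
    show ?thesis
    proof (intro exI[of _ "?B"] allI impI)
      fix t assume t: "0 < t \<and> t \<le> T"
      have b: "weighted_L2_sq m (\<lambda>\<xi>. w \<xi> (ln (1 + t))) \<le> B" using t by (intro B) auto
      have "weighted_L2_sq m (\<lambda>x. u x t) \<le> (1 + T) powr m * B"
        using t m b weighted_L2_sq_nonneg[of m "\<lambda>\<xi>. w \<xi> (ln (1 + t))"]
        by (intro order_trans[OF int(4)] mult_mono powr_mono2) auto
      moreover have "(LINT x|lborel. \<bar>u x t\<bar>) \<le> (B + pi) / 2"
        using weighted_L2_imp_L1(2)[OF m1 L2[of "ln (1 + t)"], of 1] b t int(2)[of t] by simp
      ultimately show "weighted_L2_sq m (\<lambda>x. u x t) \<le> ?B
         \<and> (LINT x|lborel. \<bar>u x t\<bar>) \<le> ?B"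
        by (meson max.coboundedI1 max.coboundedI2)
    qed
  qed auto
  have u2_le: "(u x t)\<^sup>2 \<le> (1 + x\<^sup>2) powr m * (u x t)\<^sup>2" for x t
    using mult_right_mono[OF ge_one_powr_ge_zero[of "1 + x\<^sup>2" m], of "(u x t)\<^sup>2"] m by simp
  have ucont: "continuous_on UNIV (\<lambda>x. u x t)" if "t > 0" for t
    unfolding u_def using that by (intro continuous_intros) auto
  have u2: "integrable lborel (\<lambda>x. (u x t)\<^sup>2)" if t: "t > 0" for t
  proof (rule Bochner_Integration.integrable_bound[OF int(3)[OF t]])
    have [measurable]: "(\<lambda>x. u x t) \<in> borel_measurable borel" by (intro borel_measurable_continuous_onI ucont t)
    show "(\<lambda>x. (u x t)\<^sup>2) \<in> borel_measurable lborel" by measurable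
  qed (use u2_le in auto)
  have u2_int: "(LINT x|lborel. (u x t)\<^sup>2) \<le> weighted_L2_sq m (\<lambda>x. u x t)" if t: "t > 0" for t
    by (intro integral_mono u2 int(3) t u2_le)
  have to0: "filterlim (\<lambda>t. ln (1 + t)) (at 0 within {0..}) (at_right (0::real))"
    unfolding filterlim_at
  proof (intro conjI)
    show "\<forall>\<^sub>F t in at_right 0. ln (1 + t) \<in> {0..} \<and> ln (1 + t) \<noteq> (0::real)"
      using eventually_at_right_less[of "0::real"] by eventually_elim auto
    have "((\<lambda>t. ln (1 + t)) \<longlongrightarrow> ln (1 + 0)) (at_right (0::real))" by (intro tendsto_intros) auto
    thus "((\<lambda>t. ln (1 + t)) \<longlongrightarrow> (0::real)) (at_right 0)" by simp
  qed
  have norm0: "((\<lambda>\<tau>. weighted_L2_sq m (\<lambda>\<xi>. w \<xi> \<tau> - w \<xi> 0)) \<longlongrightarrow> 0) (at 0 within {0..})"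
  proof -
    have "((\<lambda>s. weighted_L2_norm m (\<lambda>\<xi>. w \<xi> s - w \<xi> 0)) \<longlongrightarrow> 0) (at 0 within {0..})"
      using sol by (simp add: rescaled_Burgers_solution_def)
    from tendsto_power[OF this, of 2] show ?thesis by (simp add: weighted_L2_sq_eq)
  qed
  have ae: "AE \<xi> in lborel. w \<xi> 0 = h \<xi>" using sol by (simp add: rescaled_Burgers_solution_def)
  have [measurable]: "(\<lambda>\<xi>. w \<xi> 0) \<in> borel_measurable lborel" "h \<in> borel_measurable lborel"
    using h L2[of 0] by (auto simp: weighted_L2_def)
  have w0: "weighted_L2_sq m (\<lambda>\<xi>. w \<xi> 0) = weighted_L2_sq m h"
    by (rule integral_cong_AE) (use ae in auto)
  have w0': "(LINT \<xi>:{..a}|lborel. w \<xi> 0) = (LINT \<xi>:{..a}|lborel. h \<xi>)" for a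
    unfolding set_lebesgue_integral_def by (rule integral_cong_AE) (use ae in auto)
  have winit: "\<forall>\<^sub>F t in at_right 0. weighted_L2_sq m (\<lambda>x. u x t) \<le> 4 + 4 * weighted_L2_sq m h"
  proof -
    have "\<forall>\<^sub>F t in at_right 0. weighted_L2_sq m (\<lambda>\<xi>. w \<xi> (ln (1 + t)) - w \<xi> 0) < 1"
      using order_tendstoD(2)[OF filterlim_compose[OF norm0 to0], of 1] by simp
    moreover have "((\<lambda>t. (1 + t) powr m) \<longlongrightarrow> (1 + 0) powr m) (at_right (0::real))" by (intro tendsto_intros) auto
    hence "\<forall>\<^sub>F t in at_right (0::real). (1 + t) powr m < 2" by (rule order_tendstoD(2)) simp
    ultimately show ?thesis using eventually_at_right_less[of "0::real"]
    proof eventually_elim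
      case (elim t)
      have "weighted_L2_sq m (\<lambda>\<xi>. w \<xi> (ln (1 + t))) \<le> 2 * weighted_L2_sq m (\<lambda>\<xi>. w \<xi> (ln (1 + t)) - w \<xi> 0) + 2 * weighted_L2_sq m h"
        using weighted_L2_diff(2)[OF L2[of "ln (1 + t)"] L2[of 0]] elim w0 by simp
      hence "weighted_L2_sq m (\<lambda>\<xi>. w \<xi> (ln (1 + t))) \<le> 2 + 2 * weighted_L2_sq m h" using elim by simp
      hence "(1 + t) powr m * weighted_L2_sq m (\<lambda>\<xi>. w \<xi> (ln (1 + t))) \<le> 2 * (2 + 2 * weighted_L2_sq m h)"
        using elim weighted_L2_sq_nonneg[of m "\<lambda>\<xi>. w \<xi> (ln (1 + t))"] by (intro mult_mono) auto
      from order_trans[OF int(4)[OF elim(3)] this] show ?case by simp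
    qed
  qed
  have Hc: "continuous_on UNIV (\<lambda>y. LINT x:{..y}|lborel. h x)" by (rule primitive_continuous[OF hi])
  have init: "((\<lambda>t. LINT y:{..x}|lborel. u y t) \<longlongrightarrow> (LINT y:{..x}|lborel. h y)) (at_right 0)" for x
  proof -
    have L1lim: "((\<lambda>\<tau>. LINT \<xi>|lborel. \<bar>w \<xi> \<tau> - w \<xi> 0\<bar>) \<longlongrightarrow> 0) (at 0 within {0..})"
    proof (rule tendstoI)
      fix e :: real assume e: "e > 0"
      define l where "l = 2 * pi / e"
      have l: "l > 0" "pi / l = e / 2" using e by (auto simp: l_def)
      have "((\<lambda>\<tau>. l * weighted_L2_sq m (\<lambda>\<xi>. w \<xi> \<tau> - w \<xi> 0)) \<longlongrightarrow> l * 0) (at 0 within {0..})"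
        by (intro tendsto_intros norm0)
      hence "\<forall>\<^sub>F \<tau> in at 0 within {0..}. l * weighted_L2_sq m (\<lambda>\<xi>. w \<xi> \<tau> - w \<xi> 0) < e"
        by (rule order_tendstoD(2)) (use e in simp)
      moreover have "\<forall>\<^sub>F \<tau> in at 0 within {0..}. \<tau> \<ge> (0::real)" by (auto simp: eventually_at_filter)
      ultimately show "\<forall>\<^sub>F \<tau> in at 0 within {0..}. dist (LINT \<xi>|lborel. \<bar>w \<xi> \<tau> - w \<xi> 0\<bar>) 0 < e"
      proof eventually_elim
        case (elim \<tau>)
        have "(LINT \<xi>|lborel. \<bar>w \<xi> \<tau> - w \<xi> 0\<bar>) \<le> (l * weighted_L2_sq m (\<lambda>\<xi>. w \<xi> \<tau> - w \<xi> 0) + pi / l) / 2"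
          by (rule weighted_L2_imp_L1(2)[OF m1 weighted_L2_diff(1)[OF L2 L2] l(1)]) (use elim in auto)
        also have "\<dots> < e"
        proof -
          have "(a + b) / 2 < e" if "a < e" "b = e / 2" for a b :: real using that e by (simp add: field_simps)
          thus ?thesis using elim(1) l(2) .
        qed
        finally show ?case by (simp add: dist_real_def integral_nonneg_AE)
      qed
    qed
    have 1: "((\<lambda>t. LINT \<xi>|lborel. \<bar>w \<xi> (ln (1 + t)) - w \<xi> 0\<bar>) \<longlongrightarrow> 0) (at_right 0)"
      using filterlim_compose[OF L1lim to0] .
    have "isCont (\<lambda>y. LINT x:{..y}|lborel. h x) (x / sqrt (1 + 0))"
      using Hc by (auto simp: continuous_on_eq_continuous_at)
    moreover have "((\<lambda>t. x / sqrt (1 + t)) \<longlongrightarrow> x / sqrt (1 + 0)) (at_right 0)"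
      by (intro tendsto_intros) auto
    ultimately have 2: "((\<lambda>t. LINT y:{..x / sqrt (1 + t)}|lborel. h y) \<longlongrightarrow> (LINT y:{..x}|lborel. h y)) (at_right 0)"
      using isCont_tendsto_compose by fastforce
    have 3: "((\<lambda>t. (LINT y:{..x}|lborel. u y t) - (LINT y:{..x / sqrt (1 + t)}|lborel. h y)) \<longlongrightarrow> 0) (at_right 0)"
    proof (rule Lim_null_comparison[OF _ 1])
      show "\<forall>\<^sub>F t in at_right 0. norm ((LINT y:{..x}|lborel. u y t) - (LINT y:{..x / sqrt (1 + t)}|lborel. h y))
         \<le> (LINT \<xi>|lborel. \<bar>w \<xi> (ln (1 + t)) - w \<xi> 0\<bar>)"
        using eventually_at_right_less[of "0::real"]
      proof eventually_elim
        case (elim t)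
        let ?a = "x / sqrt (1 + t)"
        have i: "integrable lborel (\<lambda>\<xi>. w \<xi> \<tau>)" if "\<tau> \<ge> 0" for \<tau> using weighted_L2_imp_L1(1)[OF m1 L2[OF that]] .
        have t0: "ln (1 + t) \<ge> 0" using elim by simp
        have si: "set_integrable lborel {..?a} (\<lambda>\<xi>. w \<xi> \<tau>)" if "\<tau> \<ge> 0" for \<tau>
          unfolding set_integrable_def by (intro integrable_mult_indicator i that) auto
        have "(LINT y:{..x}|lborel. u y t) - (LINT y:{..?a}|lborel. h y) = (LINT \<xi>:{..?a}|lborel. w \<xi> (ln (1 + t)) - w \<xi> 0)"
          unfolding int(5)[OF elim] w0'[symmetric] using si[OF t0] si[of 0] by (simp add: set_integral_diff)
        thus ?case using primitive_bound[OF Bochner_Integration.integrable_diff[OF i[OF t0] i[of 0]], of ?a] by simp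
      qed
    qed
    from tendsto_add[OF 3 2] show ?thesis by simp
  qed
  have "weighted_burgers \<mu> u ux uxx (\<lambda>y. LINT x:{..y}|lborel. h x) (LINT x|lborel. \<bar>h x\<bar>) m (4 + 4 * weighted_L2_sq m h)"
  proof unfold_locales
    show "continuous_on (UNIV \<times> {0<..}) (\<lambda>z. u (fst z) (snd z))"
      "continuous_on (UNIV \<times> {0<..}) (\<lambda>z. ux (fst z) (snd z))"
      "continuous_on (UNIV \<times> {0<..}) (\<lambda>z. uxx (fst z) (snd z))"
      unfolding u_def ux_def uxx_def by (intro continuous_intros; auto)+
    fix x t :: real assume t: "t > 0"
    define c where "c = sqrt (1 + t)"
    define g where "g \<xi> = w \<xi> (ln (1 + t))" for \<xi>
    have c: "c > 0" "c\<^sup>2 = 1 + t" using t by (auto simp: c_def)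
    have lin: "((\<lambda>y. y / c) has_real_derivative 1 / c) (at x)" using c by (auto intro!: derivative_eq_intros)
    show "((\<lambda>y. u y t) has_real_derivative ux x t) (at x)"
      using DERIV_cdivide[OF DERIV_chain2[OF w_x[OF lnpos[OF t]] lin], of c] c
      by (simp add: u_def ux_def c_def[symmetric] power2_eq_square)
    show "((\<lambda>y. ux y t) has_real_derivative uxx x t) (at x)"
      using DERIV_cdivide[OF DERIV_chain2[OF w1_x[OF lnpos[OF t]] lin], of "1 + t"] c
      by (simp add: ux_def uxx_def c_def[symmetric] mult.commute)
    show "((\<lambda>s. u x s) has_real_derivative \<mu> * uxx x t - u x t * ux x t) (at t)"
    proof -
      have dc: "((\<lambda>t. sqrt (1 + t)) has_real_derivative 1 / (2 * c)) (at t)"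
        using t by (auto intro!: derivative_eq_intros simp: c_def inverse_eq_divide)
      have da: "((\<lambda>t. x / sqrt (1 + t)) has_real_derivative - (x / (2 * c^3))) (at t)"
        by (rule DERIV_cong[OF DERIV_divide[OF DERIV_const dc]])
          (use c in \<open>auto simp: c_def[symmetric] field_simps power3_eq_cube power2_eq_square\<close>)
      have db: "((\<lambda>t. ln (1 + t)) has_real_derivative 1 / c\<^sup>2) (at t)"
        unfolding c(2) using t by (auto intro!: derivative_eq_intros)
      have dw: "((\<lambda>t. w (x / sqrt (1 + t)) (ln (1 + t))) has_real_derivative
          w1 (x / c) (ln (1 + t)) * - (x / (2 * c^3)) + wt (x / c) (ln (1 + t)) * (1 / c\<^sup>2)) (at t)"
        using chain_rule_from_partials[of w w1 wt, OF w_x w_t cwt da db lnpos[OF t]] by (simp add: c_def)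
      show ?thesis
        unfolding u_def
        by (rule DERIV_cong[OF DERIV_divide[OF dw dc]])
          (use c in \<open>simp_all add: c_def[symmetric] wt_def ux_def uxx_def c(2)[symmetric] field_simps power3_eq_cube power2_eq_square\<close>)
    qed
    show "integrable lborel (\<lambda>x. u x t)" "integrable lborel (\<lambda>x. (u x t)\<^sup>2)"
      "integrable lborel (\<lambda>x. (1 + x\<^sup>2) powr m * (u x t)\<^sup>2)"
      using int(1,3)[OF t] u2[OF t] by auto
  next
    fix T
    show "\<exists>B. \<forall>t. 0 < t \<and> t \<le> T \<longrightarrow> (LINT x|lborel. \<bar>u x t\<bar>) \<le> B \<and> (LINT x|lborel. (u x t)\<^sup>2) \<le> B"
      using bounded[of T] u2_int by (meson order_trans)
    show "\<exists>B. \<forall>t. 0 < t \<and> t \<le> T \<longrightarrow> weighted_L2_sq m (\<lambda>x. u x t) \<le> B"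
      using bounded[of T] by blast
  qed (use mu m init Hc primitive_bound[OF hi] winit in auto)
  thus thesis unfolding u_def[abs_def] by (rule that)
qed

section \<open>The N-wave as limit of the Hopf-Lax formula\<close>

text \<open>
  The primitive of \<^term>\<open>N_wave p q\<close> that vanishes at \<open>-\<infinity>\<close>.
\<close>

definition wave_primitive :: "real \<Rightarrow> real \<Rightarrow> real \<Rightarrow> real" where
  "wave_primitive p q \<xi> = (if \<xi> \<le> - sqrt p then 0 else if \<xi> < sqrt q then (\<xi>\<^sup>2 - p) / 2 else (q - p) / 2)"

text \<open>
  Outside \<open>[- sqrt p, sqrt q]\<close> the parabola exceeds the constant branches, inside it lies below them.
\<close>

lemma wave_primitive_bounds:
  assumes p: "0 \<le> p" and q: "0 \<le> q"
  shows "wave_primitive p q \<xi> \<le> (\<xi>\<^sup>2 - p) / 2"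
    and "\<xi> \<le> 0 \<Longrightarrow> wave_primitive p q \<xi> \<le> 0"
    and "0 \<le> \<xi> \<Longrightarrow> wave_primitive p q \<xi> \<le> (q - p) / 2"
proof -
  have sp: "(sqrt p)\<^sup>2 = p" "(sqrt q)\<^sup>2 = q" "0 \<le> sqrt p" "0 \<le> sqrt q" using p q by auto
  have 1: "p \<le> \<xi>\<^sup>2" if "\<xi> \<le> - sqrt p"
    using power_mono[of "sqrt p" "- \<xi>" 2] that sp by simp
  have 2: "q \<le> \<xi>\<^sup>2" if "sqrt q \<le> \<xi>"
    using power_mono[of "sqrt q" "\<xi>" 2] that sp by simp
  have 3: "\<xi>\<^sup>2 \<le> p" if "- sqrt p < \<xi>" "\<xi> \<le> 0"
    using power_mono[of "- \<xi>" "sqrt p" 2] that sp by simp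
  have 4: "\<xi>\<^sup>2 \<le> q" if "\<xi> < sqrt q" "0 \<le> \<xi>"
    using power_mono[of "\<xi>" "sqrt q" 2] that sp by simp
  have 5: "q = 0" if "sqrt q \<le> \<xi>" "\<xi> \<le> 0"
    using that sp by (metis order_antisym order_trans real_sqrt_eq_0_iff)
  have 6: "p = 0" if "\<xi> \<le> - sqrt p" "0 \<le> \<xi>"
  proof -
    have "sqrt p = 0" using that sp by linarith
    thus ?thesis by simp
  qed
  show "wave_primitive p q \<xi> \<le> (\<xi>\<^sup>2 - p) / 2"
    using 1 2 by (auto simp: wave_primitive_def)
  show "wave_primitive p q \<xi> \<le> 0" if "\<xi> \<le> 0"
    using 3 5 that p by (auto simp: wave_primitive_def)
  show "wave_primitive p q \<xi> \<le> (q - p) / 2" if "0 \<le> \<xi>"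
    using 4 6 that p q by (auto simp: wave_primitive_def)
qed

lemma wave_primitive_increment:
  assumes "0 \<le> p" "0 \<le> q" and d: "0 < d"
    and away: "\<bar>\<xi> + sqrt p\<bar> > d" "\<bar>\<xi> - sqrt q\<bar> > d"
    and e: "\<bar>e\<bar> \<le> d"
  shows "e * N_wave p q \<xi> \<le> wave_primitive p q (\<xi> + e) - wave_primitive p q \<xi>"
proof -
  have s: "0 \<le> sqrt p" "0 \<le> sqrt q" using assms by auto
  consider "\<xi> + d < - sqrt p" | "- sqrt p < \<xi> - d" "\<xi> + d < sqrt q" | "sqrt q < \<xi> - d"
    using away s by (auto simp: abs_if split: if_splits)
  thus ?thesis
  proof cases
    case 1
    thus ?thesis using e s d by (auto simp: N_wave_def wave_primitive_def abs_le_iff)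
  next
    case 2
    hence "\<not> \<xi> \<le> - sqrt p" "\<xi> < sqrt q" "\<not> \<xi> + e \<le> - sqrt p" "\<xi> + e < sqrt q" using e d by auto
    thus ?thesis by (simp add: N_wave_def wave_primitive_def power2_eq_square algebra_simps add_divide_distrib diff_divide_distrib)
  next
    case 3
    hence "\<not> \<xi> \<le> - sqrt p" "\<not> \<xi> < sqrt q" "\<not> \<xi> + e \<le> - sqrt p" "\<not> \<xi> + e < sqrt q"
      using e d s by linarith+
    thus ?thesis by (simp add: N_wave_def wave_primitive_def)
  qed
qed

context viscous_burgers begin

text \<open>
  The fraction \<open>\<theta> = 1 / \<sigma>\<close> in \<open>W_lower\<close> is chosen because the remaining quadratic term is then exactly
  \<open>(\<xi> - z)\<^sup>2 / 2\<close> with \<open>z = y / sqrt \<sigma>\<close>. Points \<open>y\<close> far out on the side of \<open>\<xi>\<close> see the limit of \<open>H\<close>,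
  points on the other side are at distance at least \<open>\<bar>\<xi>\<bar>\<close>, and for bounded \<open>y\<close> the number \<open>z\<close> is small.
\<close>

lemma W_above_wave:
  assumes \<sigma>: "\<sigma> > 1" and pq: "0 \<le> p" "0 \<le> q" and Y: "0 \<le> Y"
    and Hp: "\<And>y. - p / 2 \<le> H y"
    and Hl: "\<And>y. y \<le> - Y \<Longrightarrow> - \<epsilon> \<le> H y"
    and Hr: "\<And>y. Y \<le> y \<Longrightarrow> (q - p) / 2 - \<epsilon> \<le> H y"
    and \<xi>: "\<bar>\<xi>\<bar> \<le> R" and small: "Y * R \<le> \<epsilon> * sqrt \<sigma>" "\<mu> * ln \<sigma> \<le> \<epsilon>" and e0: "0 \<le> \<epsilon>"
  shows "wave_primitive p q \<xi> - 2 * \<epsilon> \<le> W (sqrt \<sigma> * \<xi>) (\<sigma> - 1)"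
proof -
  define s where "s = sqrt \<sigma>"
  have s: "s > 0" "s\<^sup>2 = \<sigma>" using \<sigma> by (auto simp: s_def)
  note wp = wave_primitive_bounds[OF pq, of \<xi>]
  have "(wave_primitive p q \<xi> - \<epsilon>) + \<mu> * ln (1 / \<sigma>) \<le> W (s * \<xi>) (\<sigma> - 1)"
  proof (rule W_lower)
    fix y
    define z where "z = y / s"
    have "(1 - 1 / \<sigma>) * (s * \<xi> - y)\<^sup>2 / (2 * (\<sigma> - 1)) = (s * \<xi> - y)\<^sup>2 / (2 * \<sigma>)"
      using \<sigma> by (simp add: divide_simps)
    also have "\<dots> = (s * (\<xi> - z))\<^sup>2 / (2 * \<sigma>)" using s by (simp add: z_def algebra_simps)
    also have "\<dots> = (\<xi> - z)\<^sup>2 / 2"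
      using s \<sigma> by (simp add: power_mult_distrib)
    finally have eq: "(1 - 1 / \<sigma>) * (s * \<xi> - y)\<^sup>2 / (2 * (\<sigma> - 1)) = (\<xi> - z)\<^sup>2 / 2" .
    have sq: "\<xi>\<^sup>2 \<le> (\<xi> - z)\<^sup>2" if "\<xi> * z \<le> 0"
    proof -
      have "(\<xi> - z)\<^sup>2 = \<xi>\<^sup>2 - 2 * (\<xi> * z) + z\<^sup>2" by (simp add: power2_eq_square algebra_simps)
      thus ?thesis using that zero_le_power2[of z] by linarith
    qed
    have nn: "0 \<le> (\<xi> - z)\<^sup>2 / 2" by simp
    have "wave_primitive p q \<xi> - \<epsilon> \<le> (\<xi> - z)\<^sup>2 / 2 + H y"
    proof -
      consider "y \<le> - Y" "\<xi> \<le> 0" | "Y \<le> y" "0 \<le> \<xi>" | "\<xi> * z \<le> 0" | "\<bar>y\<bar> \<le> Y"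
      proof -
        have "\<xi> * z \<le> 0" if "y \<le> 0 \<and> 0 \<le> \<xi> \<or> 0 \<le> y \<and> \<xi> \<le> 0"
          using that s by (auto simp: z_def mult_nonneg_nonpos mult_nonpos_nonneg divide_nonpos_pos)
        thus ?thesis using that Y by (cases "y \<le> - Y"; cases "Y \<le> y"; cases "\<xi> \<le> 0") (auto simp: abs_if)
      qed
      thus ?thesis
      proof cases
        case 1
        thus ?thesis using wp(2) Hl[of y] nn by linarith
      next
        case 2
        thus ?thesis using wp(3) Hr[of y] nn by linarith
      next
        case 3
        have "wave_primitive p q \<xi> \<le> \<xi>\<^sup>2 / 2 - p / 2" using wp(1) by (simp add: diff_divide_distrib)
        thus ?thesis using sq[OF 3] Hp[of y] e0 by simp
      next
        case 4
        have "\<bar>\<xi> * z\<bar> \<le> \<epsilon>"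
        proof -
          have "\<bar>\<xi> * z\<bar> \<le> R * (Y / s)"
            unfolding abs_mult using \<xi> 4 s Y by (intro mult_mono) (auto simp: z_def divide_right_mono)
          also have "\<dots> \<le> \<epsilon>" using small(1) s by (simp add: s_def[symmetric] field_simps)
          finally show ?thesis .
        qed
        hence xz: "\<xi> * z \<le> \<epsilon>" by (simp add: abs_le_iff)
        have "(\<xi> - z)\<^sup>2 = \<xi>\<^sup>2 - 2 * (\<xi> * z) + z\<^sup>2" by (simp add: power2_eq_square algebra_simps)
        hence "\<xi>\<^sup>2 - 2 * \<epsilon> \<le> (\<xi> - z)\<^sup>2" using xz zero_le_power2[of z] by linarith
        moreover have "wave_primitive p q \<xi> \<le> \<xi>\<^sup>2 / 2 - p / 2" using wp(1) by (simp add: diff_divide_distrib)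
        ultimately show ?thesis using Hp[of y] by simp
      qed
    qed
    thus "wave_primitive p q \<xi> - \<epsilon> \<le> (1 - 1 / \<sigma>) * (s * \<xi> - y)\<^sup>2 / (2 * (\<sigma> - 1)) + H y"
      unfolding eq .
  qed (use \<sigma> in auto)
  moreover have "ln (1 / \<sigma>) = - ln \<sigma>" using \<sigma> by (simp add: ln_div)
  ultimately show ?thesis using small(2) by (simp add: s_def)
qed

text \<open>
  One competitor for each branch: a point beyond \<open>- Y\<close> or \<open>Y\<close> at bounded distance from \<open>x\<close> for the
  constant branches, and a near-minimiser \<open>y1\<close> of \<open>H\<close> for the parabola.
\<close>

lemma W_below_wave:
  assumes \<sigma>: "\<sigma> > 1" and pq: "0 \<le> p" "0 \<le> q" and Y: "0 \<le> Y" and r: "r > 0"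
    and Hm: "\<And>y. \<bar>y - y1\<bar> \<le> r \<Longrightarrow> H y \<le> - p / 2 + \<epsilon>"
    and Hl: "\<And>y. y \<le> - Y \<Longrightarrow> H y \<le> \<epsilon>"
    and Hr: "\<And>y. Y \<le> y \<Longrightarrow> H y \<le> (q - p) / 2 + \<epsilon>"
    and \<xi>: "\<bar>\<xi>\<bar> \<le> R"
    and small: "(Y + 2 * r)\<^sup>2 / (2 * (\<sigma> - 1)) \<le> \<epsilon>"
      "(R\<^sup>2 + 2 * sqrt \<sigma> * R * (\<bar>y1\<bar> + r) + (\<bar>y1\<bar> + r)\<^sup>2) / (2 * (\<sigma> - 1)) \<le> \<epsilon>"
      "\<mu>\<^sup>2 * pi * (\<sigma> - 1) / r\<^sup>2 \<le> \<epsilon>"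
  shows "W (sqrt \<sigma> * \<xi>) (\<sigma> - 1) \<le> wave_primitive p q \<xi> + 3 * \<epsilon>"
proof -
  define s where "s = sqrt \<sigma>"
  have s: "s > 0" "s\<^sup>2 = \<sigma>" using \<sigma> by (auto simp: s_def)
  have t: "\<sigma> - 1 > 0" using \<sigma> by simp
  have sp: "0 \<le> sqrt p" "0 \<le> sqrt q" using pq by auto
  have far: "(\<bar>s * \<xi> - y0\<bar> + r)\<^sup>2 / (2 * (\<sigma> - 1)) \<le> \<epsilon>" if "\<bar>s * \<xi> - y0\<bar> \<le> Y + r" for y0
  proof -
    have "(\<bar>s * \<xi> - y0\<bar> + r)\<^sup>2 \<le> (Y + 2 * r)\<^sup>2" using that r by (intro power_mono) auto
    hence "(\<bar>s * \<xi> - y0\<bar> + r)\<^sup>2 / (2 * (\<sigma> - 1)) \<le> (Y + 2 * r)\<^sup>2 / (2 * (\<sigma> - 1))"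
      using t by (intro divide_right_mono) auto
    thus ?thesis using small(1) by simp
  qed
  consider "\<xi> \<le> - sqrt p" | "- sqrt p < \<xi>" "\<xi> < sqrt q" | "sqrt q \<le> \<xi>" "- sqrt p < \<xi>" by linarith
  thus ?thesis
  proof cases
    case 1
    define y0 where "y0 = min (s * \<xi>) (- Y) - r"
    have "\<xi> \<le> 0" using 1 sp by linarith
    hence sx: "s * \<xi> \<le> 0" using s by (intro mult_nonneg_nonpos) auto
    have "\<bar>s * \<xi> - y0\<bar> \<le> Y + r" using sx Y r by (auto simp: y0_def min_def abs_if)
    moreover have "H y \<le> \<epsilon>" if "\<bar>y - y0\<bar> \<le> r" for y
      using that by (intro Hl) (auto simp: y0_def abs_le_iff)
    ultimately have "W (s * \<xi>) (\<sigma> - 1) \<le> \<epsilon> + \<epsilon> + \<epsilon>"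
      using W_upper[OF t r, of y0 \<epsilon> "s * \<xi>"] far[of y0] small(3) by fastforce
    thus ?thesis using 1 by (simp add: wave_primitive_def s_def)
  next
    case 3
    define y0 where "y0 = max (s * \<xi>) Y + r"
    have "0 \<le> \<xi>" using 3 sp by linarith
    hence sx: "0 \<le> s * \<xi>" using s by (intro mult_nonneg_nonneg) auto
    have "\<bar>s * \<xi> - y0\<bar> \<le> Y + r" using sx Y r by (auto simp: y0_def max_def abs_if)
    moreover have "H y \<le> (q - p) / 2 + \<epsilon>" if "\<bar>y - y0\<bar> \<le> r" for y
      using that by (intro Hr) (auto simp: y0_def abs_le_iff)
    ultimately have "W (s * \<xi>) (\<sigma> - 1) \<le> \<epsilon> + ((q - p) / 2 + \<epsilon>) + \<epsilon>"
      using W_upper[OF t r, of y0 "(q - p) / 2 + \<epsilon>" "s * \<xi>"] far[of y0] small(3) by fastforce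
    thus ?thesis using 3 by (simp add: wave_primitive_def s_def)
  next
    case 2
    define K where "K = \<bar>y1\<bar> + r"
    have K: "K \<ge> 0" using r by (simp add: K_def)
    have R: "0 \<le> R" using \<xi> by linarith
    have "(\<bar>s * \<xi> - y1\<bar> + r)\<^sup>2 \<le> (s * \<bar>\<xi>\<bar> + K)\<^sup>2"
    proof (rule power_mono)
      have "\<bar>s * \<xi> - y1\<bar> \<le> s * \<bar>\<xi>\<bar> + \<bar>y1\<bar>" using abs_triangle_ineq4[of "s * \<xi>" y1] s by (simp add: abs_mult)
      thus "\<bar>s * \<xi> - y1\<bar> + r \<le> s * \<bar>\<xi>\<bar> + K" by (simp add: K_def)
    qed (use r in auto)
    also have "\<dots> = (\<sigma> - 1) * \<xi>\<^sup>2 + (\<xi>\<^sup>2 + 2 * s * \<bar>\<xi>\<bar> * K + K\<^sup>2)"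
      using s by (simp add: power2_sum power_mult_distrib algebra_simps)
    also have "\<dots> \<le> (\<sigma> - 1) * \<xi>\<^sup>2 + (R\<^sup>2 + 2 * s * R * K + K\<^sup>2)"
      using \<xi> s K R by (intro add_left_mono add_right_mono add_mono mult_right_mono mult_left_mono)
        (auto simp: abs_le_square_iff[symmetric])
    finally have "(\<bar>s * \<xi> - y1\<bar> + r)\<^sup>2 / (2 * (\<sigma> - 1)) \<le> ((\<sigma> - 1) * \<xi>\<^sup>2 + (R\<^sup>2 + 2 * s * R * K + K\<^sup>2)) / (2 * (\<sigma> - 1))"
      using t by (intro divide_right_mono) auto
    also have "\<dots> = \<xi>\<^sup>2 / 2 + (R\<^sup>2 + 2 * s * R * K + K\<^sup>2) / (2 * (\<sigma> - 1))"
    proof -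
      have "(k * a + b) / (2 * k) = a / 2 + b / (2 * k)" if "k > 0" for k a b :: real
        using that by (simp add: add_divide_distrib)
      thus ?thesis using t .
    qed
    also have "\<dots> \<le> \<xi>\<^sup>2 / 2 + \<epsilon>" using small(2) by (simp add: K_def s_def)
    finally have "W (s * \<xi>) (\<sigma> - 1) \<le> (\<xi>\<^sup>2 / 2 + \<epsilon>) + (- p / 2 + \<epsilon>) + \<epsilon>"
      using W_upper[OF t r, of y1 "- p / 2 + \<epsilon>" "s * \<xi>", OF Hm] small(3) by linarith
    thus ?thesis using 2 by (simp add: wave_primitive_def s_def diff_divide_distrib)
  qed
qed

end

section \<open>Distance to the N-wave in the weighted norm\<close>

context weighted_burgers begin

text \<open>
  For \<open>\<bar>\<xi>\<bar> > R\<close> the front lies below \<open>\<bar>x\<bar> / 2\<close> with \<open>x = sqrt \<sigma> * \<xi>\<close>, so the outer weight is at least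
  \<open>(\<bar>x\<bar> / 2) powr (2 * m)\<close>, which exceeds the weight in \<open>\<xi>\<close> by a multiple of \<open>\<sigma> powr m\<close>.
\<close>

lemma tail_pointwise:
  assumes \<sigma>: "\<sigma> > 1" and R: "2 * (1 + 4/3 * (2 * A + 1/2)) \<le> R" and \<xi>: "R < \<bar>\<xi>\<bar>"
  shows "(1 + \<xi>\<^sup>2) powr m \<le> 8 powr m * \<sigma> powr (- m) * outer (sqrt \<sigma> * \<xi>) (\<sigma> - 1)"
proof -
  define x where "x = sqrt \<sigma> * \<xi>"
  have s: "sqrt \<sigma> \<ge> 1" "(sqrt \<sigma>)\<^sup>2 = \<sigma>" using \<sigma> by auto
  have R1: "R \<ge> 1" using R A_nonneg by (simp add: field_simps)
  have x2: "x\<^sup>2 = \<sigma> * \<xi>\<^sup>2" using s by (simp add: x_def power_mult_distrib)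
  have ax: "\<bar>x\<bar> = sqrt \<sigma> * \<bar>\<xi>\<bar>" using s by (simp add: x_def abs_mult)
  have "front (\<sigma> - 1) \<le> sqrt \<sigma> * (1 + 4/3 * (2 * A + 1/2))"
  proof -
    have "4/3 * (2 * A + 1/2) * sqrt (\<sigma> - 1) \<le> 4/3 * (2 * A + 1/2) * sqrt \<sigma>"
      using A_nonneg by (intro mult_left_mono) auto
    from add_mono[OF s(1) this] show ?thesis unfolding front_def by (simp add: algebra_simps)
  qed
  also have "\<dots> \<le> sqrt \<sigma> * (\<bar>\<xi>\<bar> / 2)" using R \<xi> s(1) by (intro mult_left_mono) auto
  finally have f: "front (\<sigma> - 1) \<le> \<bar>x\<bar> / 2" by (simp add: ax)
  have "(x\<^sup>2 / 4) powr m = pospow (2 * m) (\<bar>x\<bar> / 2)"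
  proof -
    have "(\<bar>x\<bar> / 2) powr 2 = x\<^sup>2 / 4" by (simp add: powr_numeral power_divide)
    hence "(x\<^sup>2 / 4) powr m = ((\<bar>x\<bar> / 2) powr 2) powr m" by (simp only:)
    also have "\<dots> = (\<bar>x\<bar> / 2) powr (2 * m)" by (rule powr_powr)
    finally show ?thesis by (simp add: pospow_def)
  qed
  also have "\<dots> \<le> pospow (2 * m) (\<bar>x\<bar> - front (\<sigma> - 1))"
    unfolding pospow_def using f m by (intro powr_mono2) auto
  also have "\<dots> \<le> outer x (\<sigma> - 1)"
    unfolding outer_def by (cases "x \<ge> 0") (auto simp: add_increasing add_increasing2)
  finally have o: "(x\<^sup>2 / 4) powr m \<le> outer x (\<sigma> - 1)" .
  have "1 \<le> \<bar>\<xi>\<bar>" using R1 \<xi> by linarith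
  hence "1 \<le> \<xi>\<^sup>2" using power_mono[of 1 "\<bar>\<xi>\<bar>" 2] by simp
  moreover have "8 * inverse \<sigma> * (x\<^sup>2 / 4) = 2 * \<xi>\<^sup>2" unfolding x2 using \<sigma> by simp
  ultimately have "1 + \<xi>\<^sup>2 \<le> 8 * inverse \<sigma> * (x\<^sup>2 / 4)" by linarith
  hence "(1 + \<xi>\<^sup>2) powr m \<le> (8 * inverse \<sigma> * (x\<^sup>2 / 4)) powr m"
    using m by (intro powr_mono2) auto
  also have "\<dots> = 8 powr m * \<sigma> powr (- m) * (x\<^sup>2 / 4) powr m"
  proof -
    have "inverse \<sigma> powr m = \<sigma> powr (- m)" using \<sigma> by (simp add: powr_minus inverse_powr)
    thus ?thesis by (simp only: powr_mult)
  qed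
  also have "\<dots> \<le> 8 powr m * \<sigma> powr (- m) * outer x (\<sigma> - 1)"
    using o by (intro mult_left_mono) auto
  finally show ?thesis by (simp add: x_def)
qed

text \<open>
  Three contributions. For \<open>\<bar>\<xi>\<bar> \<le> R\<close> and at distance more than \<open>d\<close> from the shocks, tangents of
  length \<open>d\<close> show that the slopes of \<open>W\<close> and of the wave differ by at most \<open>3 * d\<close>. The
  \<open>d\<close>-neighbourhoods of the shocks have total length \<open>4 * d\<close>, and there both functions are bounded. For
  \<open>\<bar>\<xi>\<bar> > R\<close> the wave vanishes and \<open>outer_energy\<close> applies.
\<close>

theorem distance_to_wave:
  assumes \<sigma>: "\<sigma> \<ge> 2" "\<mu> * \<sigma> \<le> 1" and pq: "0 \<le> p" "0 \<le> q" and d: "0 < d" "d \<le> 1"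
    and R: "2 * (1 + 4/3 * (2 * A + 1/2)) \<le> R" "sqrt p < R" "sqrt q < R"
    and close: "\<And>\<xi>. \<bar>\<xi>\<bar> \<le> R + 1 \<Longrightarrow> \<bar>W (sqrt \<sigma> * \<xi>) (\<sigma> - 1) - wave_primitive p q \<xi>\<bar> \<le> d\<^sup>2"
  shows "weighted_L2_sq m (\<lambda>\<xi>. sqrt \<sigma> * u (sqrt \<sigma> * \<xi>) (\<sigma> - 1) - N_wave p q \<xi>)
    \<le> (1 + R\<^sup>2) powr m * (18 * R * d\<^sup>2 + 4 * d * (2 * (2 * A + 1/2) + sqrt p + sqrt q)\<^sup>2)
       + 8 powr m * (exp (8 * m\<^sup>2) * (3 * E0)) * \<sigma> powr (1/2 - m)"
proof -
  define s where "s = sqrt \<sigma>"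
  define t where "t = \<sigma> - 1"
  define K where "K = 2 * (2 * A + 1/2) + sqrt p + sqrt q"
  define v where "v \<xi> = s * u (s * \<xi>) t" for \<xi>
  have s: "s > 0" "s\<^sup>2 = \<sigma>" using \<sigma> by (auto simp: s_def)
  have t: "t > 0" "\<sigma> \<le> 2 * t" using \<sigma> by (auto simp: t_def)
  have R0: "R > 0" using R(1) A_nonneg by (simp add: field_simps)
  have sp: "0 \<le> sqrt p" "0 \<le> sqrt q" using pq by auto
  have close': "\<bar>W (s * \<xi>) t - wave_primitive p q \<xi>\<bar> \<le> d\<^sup>2" if "\<bar>\<xi>\<bar> \<le> R + 1" for \<xi>
    using close[OF that] by (simp add: s_def t_def)
  have tangent: "W (s * (\<xi> + e)) t \<le> W (s * \<xi>) t + e * v \<xi> + e\<^sup>2" for \<xi> e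
  proof -
    have "(s * e)\<^sup>2 / (2 * t) = e\<^sup>2 * (\<sigma> / (2 * t))" by (simp add: power_mult_distrib s(2))
    also have "\<dots> \<le> e\<^sup>2 * 1" using t by (intro mult_left_mono) auto
    finally have "(s * e)\<^sup>2 / (2 * t) \<le> e\<^sup>2" by simp
    thus ?thesis using W_tangent[OF t(1), of "s * \<xi>" "s * e"] by (simp add: v_def algebra_simps)
  qed
  have near: "\<bar>v \<xi> - N_wave p q \<xi>\<bar> \<le> 3 * d"
    if \<xi>: "\<bar>\<xi>\<bar> \<le> R" and away: "\<bar>\<xi> + sqrt p\<bar> > d" "\<bar>\<xi> - sqrt q\<bar> > d" for \<xi>
  proof -
    have step: "e * N_wave p q \<xi> \<le> e * v \<xi> + 3 * d\<^sup>2" if e: "\<bar>e\<bar> \<le> d" "e\<^sup>2 = d\<^sup>2" for e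
    proof -
      have "\<bar>\<xi> + e\<bar> \<le> R + 1" "\<bar>\<xi>\<bar> \<le> R + 1" using \<xi> e(1) d by linarith+
      thus ?thesis
        using wave_primitive_increment[OF pq d(1) away e(1)] tangent[of \<xi> e] close'[of \<xi>] close'[of "\<xi> + e"] e(2)
        by (simp add: abs_le_iff)
    qed
    have "d * N_wave p q \<xi> \<le> d * (v \<xi> + 3 * d)" "d * (v \<xi> - 3 * d) \<le> d * N_wave p q \<xi>"
      using step[of d] step[of "- d"] d by (simp_all add: power2_eq_square algebra_simps)
    hence "N_wave p q \<xi> \<le> v \<xi> + 3 * d" "v \<xi> - 3 * d \<le> N_wave p q \<xi>" using d(1) by simp_all
    thus ?thesis by linarith
  qed
  have crude: "\<bar>v \<xi> - N_wave p q \<xi>\<bar> \<le> K" for \<xi>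
  proof -
    have B0: "2 * A + 1/2 \<ge> 0" using A_nonneg by simp
    have st: "s \<le> 2 * sqrt t"
    proof -
      have "\<sigma> \<le> 2\<^sup>2 * t" using t by simp
      hence "sqrt \<sigma> \<le> sqrt (2\<^sup>2 * t)" by (rule real_sqrt_le_mono)
      thus ?thesis by (simp add: s_def real_sqrt_mult)
    qed
    have "\<bar>v \<xi>\<bar> = s * \<bar>u (s * \<xi>) t\<bar>" using s by (simp add: v_def abs_mult)
    also have "\<dots> \<le> 2 * sqrt t * ((2 * A + 1/2) / sqrt t)"
      using st s u_bound[OF t(1)] t by (intro mult_mono) auto
    also have "\<dots> = 2 * (2 * A + 1/2)" using t by simp
    finally have "\<bar>v \<xi>\<bar> \<le> 2 * (2 * A + 1/2)" .
    moreover have "N_wave p q \<xi> = 0 \<or> - sqrt p < N_wave p q \<xi> \<and> N_wave p q \<xi> < sqrt q"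
      by (auto simp: N_wave_def)
    hence "\<bar>N_wave p q \<xi>\<bar> \<le> sqrt p + sqrt q" using sp by linarith
    ultimately show ?thesis unfolding K_def by linarith
  qed
  define F where "F \<xi> = outer (s * \<xi>) t * (u (s * \<xi>) t)\<^sup>2" for \<xi>
  have F0: "0 \<le> F \<xi>" for \<xi> by (simp add: F_def outer_u_nonneg)
  have Fi: "integrable lborel F" and FI: "(LINT \<xi>|lborel. F \<xi>) \<le> exp (8 * m\<^sup>2) * (3 * E0) / s"
  proof -
    have s1: "1 / s > 0" using s by simp
    show "integrable lborel F"
      using LINT_rescale(2)[OF s1 outer_integrable(1)[OF t(1)]] by (simp add: F_def[abs_def] mult.commute)
    have "(LINT \<xi>|lborel. F \<xi>) = (LINT x|lborel. outer x t * (u x t)\<^sup>2) / s"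
      using LINT_rescale(1)[OF s1, of "\<lambda>x. outer x t * (u x t)\<^sup>2"] by (simp add: F_def[abs_def] mult.commute)
    also have "\<dots> \<le> exp (8 * m\<^sup>2 * \<mu> * t) * (3 * E0) / s"
      using outer_energy[OF t(1)] s by (intro divide_right_mono) auto
    also have "\<dots> \<le> exp (8 * m\<^sup>2) * (3 * E0) / s"
    proof (intro divide_right_mono mult_right_mono)
      have "\<mu> * t \<le> 1" using mu_pos \<sigma>(2) by (simp add: t_def right_diff_distrib)
      hence "8 * m\<^sup>2 * (\<mu> * t) \<le> 8 * m\<^sup>2 * 1" by (intro mult_left_mono) auto
      thus "exp (8 * m\<^sup>2 * \<mu> * t) \<le> exp (8 * m\<^sup>2)" by (simp add: mult.assoc)
      have "0 \<le> (LINT x|lborel. outer x t * (u x t)\<^sup>2)"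
        by (intro integral_nonneg_AE always_eventually allI outer_u_nonneg)
      hence "0 \<le> exp (8 * m\<^sup>2 * \<mu> * t) * (3 * E0)"
        using outer_energy[OF t(1)] by (rule order_trans)
      thus "0 \<le> 3 * E0" by (simp add: zero_le_mult_iff)
    qed (use s in auto)
    finally show "(LINT \<xi>|lborel. F \<xi>) \<le> exp (8 * m\<^sup>2) * (3 * E0) / s" .
  qed
  define C where "C = (1 + R\<^sup>2) powr m"
  have C0: "C \<ge> 0" by (simp add: C_def)
  define G where "G \<xi> = C * (9 * d\<^sup>2) * indicator {-R..R} \<xi> + C * K\<^sup>2 * indicator {- sqrt p - d..- sqrt p + d} \<xi>
     + C * K\<^sup>2 * indicator {sqrt q - d..sqrt q + d} \<xi> + 8 powr m * \<sigma> powr (1 - m) * F \<xi>" for \<xi>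
  have ind: "integrable lborel (indicat_real {a..b})" for a b :: real
    by (intro integrable_real_indicator) (auto simp: emeasure_lborel_Icc_eq)
  have Gi: "integrable lborel G"
    unfolding G_def[abs_def] by (intro Bochner_Integration.integrable_add integrable_mult_right ind Fi)
  have ptw: "(1 + \<xi>\<^sup>2) powr m * (v \<xi> - N_wave p q \<xi>)\<^sup>2 \<le> G \<xi>" for \<xi>
  proof (cases "\<bar>\<xi>\<bar> \<le> R")
    case True
    have "\<xi>\<^sup>2 \<le> R\<^sup>2" using True by (simp add: abs_le_square_iff[symmetric])
    hence "(1 + \<xi>\<^sup>2) powr m \<le> C" unfolding C_def using m by (intro powr_mono2) auto
    hence 1: "(1 + \<xi>\<^sup>2) powr m * (v \<xi> - N_wave p q \<xi>)\<^sup>2 \<le> C * (v \<xi> - N_wave p q \<xi>)\<^sup>2" by (intro mult_right_mono) auto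
    have F1: "0 \<le> 8 powr m * \<sigma> powr (1 - m) * F \<xi>" using F0 by simp
    have nn: "0 \<le> C * (9 * d\<^sup>2)" "0 \<le> C * K\<^sup>2" using C0 by auto
    show ?thesis
    proof (cases "\<bar>\<xi> + sqrt p\<bar> > d \<and> \<bar>\<xi> - sqrt q\<bar> > d")
      case far: True
      have "\<bar>v \<xi> - N_wave p q \<xi>\<bar>\<^sup>2 \<le> (3 * d)\<^sup>2" using near[OF True] far by (intro power_mono) auto
      hence "C * (v \<xi> - N_wave p q \<xi>)\<^sup>2 \<le> C * (9 * d\<^sup>2)" using C0 by (intro mult_left_mono) (auto simp: power_mult_distrib)
      also have "\<dots> \<le> G \<xi>" unfolding G_def using F1 nn True by (auto simp: indicator_def abs_le_iff)
      finally show ?thesis using 1 by simp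
    next
      case False
      have "\<bar>v \<xi> - N_wave p q \<xi>\<bar>\<^sup>2 \<le> K\<^sup>2" using crude by (intro power_mono) auto
      hence "C * (v \<xi> - N_wave p q \<xi>)\<^sup>2 \<le> C * K\<^sup>2" using C0 by (intro mult_left_mono) auto
      also have "\<dots> \<le> G \<xi>" unfolding G_def using F1 nn False by (auto simp: indicator_def abs_if split: if_splits)
      finally show ?thesis using 1 by simp
    qed
  next
    case False
    have N0: "N_wave p q \<xi> = 0" using False R sp by (auto simp: N_wave_def abs_if split: if_splits)
    have "(1 + \<xi>\<^sup>2) powr m * (v \<xi>)\<^sup>2 \<le> 8 powr m * \<sigma> powr (- m) * outer (s * \<xi>) t * (v \<xi>)\<^sup>2"
      using tail_pointwise[of \<sigma> R \<xi>] \<sigma> R False by (intro mult_right_mono) (auto simp: s_def t_def)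
    also have "\<dots> = 8 powr m * (\<sigma> powr (- m) * \<sigma>) * F \<xi>"
      by (simp add: v_def F_def power_mult_distrib s(2) mult_ac)
    also have "\<sigma> powr (- m) * \<sigma> = \<sigma> powr (1 - m)"
      using powr_add[of \<sigma> "- m" 1] \<sigma> by simp
    also have "8 powr m * \<sigma> powr (1 - m) * F \<xi> \<le> G \<xi>" unfolding G_def using C0 by (simp add: add_increasing)
    finally show ?thesis by (simp add: N0)
  qed
  have "weighted_L2_sq m (\<lambda>\<xi>. v \<xi> - N_wave p q \<xi>) \<le> (LINT \<xi>|lborel. G \<xi>)"
  proof (rule integral_mono'[OF Gi ptw])
    show "0 \<le> G \<xi>" for \<xi>
      by (rule order_trans[OF _ ptw]) auto
  qed
  also have "\<dots> = C * (9 * d\<^sup>2) * (2 * R) + C * K\<^sup>2 * (2 * d) + C * K\<^sup>2 * (2 * d) + 8 powr m * \<sigma> powr (1 - m) * (LINT \<xi>|lborel. F \<xi>)"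
    unfolding G_def using ind Fi R0 d by (simp add: Bochner_Integration.integral_add)
  also have "\<dots> \<le> C * (9 * d\<^sup>2) * (2 * R) + C * K\<^sup>2 * (2 * d) + C * K\<^sup>2 * (2 * d) + 8 powr m * \<sigma> powr (1 - m) * (exp (8 * m\<^sup>2) * (3 * E0) / s)"
    by (intro add_left_mono mult_left_mono FI) auto
  also have "\<dots> = C * (18 * R * d\<^sup>2 + 4 * d * K\<^sup>2) + 8 powr m * (exp (8 * m\<^sup>2) * (3 * E0)) * (\<sigma> powr (1 - m) / s)"
    by (simp add: algebra_simps)
  also have "\<sigma> powr (1 - m) / s = \<sigma> powr (1/2 - m)"
  proof -
    have "s = \<sigma> powr (1/2)" using \<sigma> by (simp add: s_def powr_half_sqrt)
    thus ?thesis using powr_diff[of \<sigma> "1 - m" "1/2"] by (simp add: algebra_simps)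
  qed
  finally show ?thesis by (simp add: v_def s_def t_def C_def K_def)
qed

end

section \<open>Convergence to the N-wave\<close>

lemma LINT_upper_half:
  fixes h :: "real \<Rightarrow> real"
  assumes h: "integrable lborel h"
  shows "(LINT x:{y..}|lborel. h x) = (LINT x|lborel. h x) - (LINT x:{..y}|lborel. h x)"
proof -
  have i: "integrable lborel (\<lambda>x. indicat_real S x * h x)" if "S \<in> sets borel" for S
    using integrable_mult_indicator[OF _ h, of S] that by simp
  have "(LINT x|lborel. h x) = (LINT x|lborel. indicator {y..} x * h x + indicator {..y} x * h x)"
    by (intro integral_cong_AE)
      (use AE_lborel_singleton[of y] borel_measurable_integrable[OF h] in \<open>auto elim!: eventually_mono simp: indicator_def\<close>)
  also have "\<dots> = (LINT x|lborel. indicator {y..} x * h x) + (LINT x|lborel. indicator {..y} x * h x)"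
    by (intro Bochner_Integration.integral_add i) auto
  finally show ?thesis by (simp add: set_lebesgue_integral_def)
qed

lemma primitive_at_top:
  fixes h :: "real \<Rightarrow> real"
  assumes h: "integrable lborel h"
  shows "((\<lambda>y. LINT x:{..y}|lborel. h x) \<longlongrightarrow> (LINT x|lborel. h x)) at_top"
  unfolding set_lebesgue_integral_def
proof (rule integral_dominated_convergence_at_top[where w="\<lambda>x. \<bar>h x\<bar>"])
  show "AE x in lborel. ((\<lambda>y. indicat_real {..y} x *\<^sub>R h x) \<longlongrightarrow> h x) at_top"
  proof (intro always_eventually allI)
    fix x
    have "\<forall>\<^sub>F y in at_top. h x = indicat_real {..y} x *\<^sub>R h x"
      using eventually_ge_at_top[of x] by eventually_elim auto
    thus "((\<lambda>y. indicat_real {..y} x *\<^sub>R h x) \<longlongrightarrow> h x) at_top"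
      by (rule Lim_transform_eventually[OF tendsto_const])
  qed
qed (use h in \<open>auto simp: indicator_def intro!: always_eventually\<close>)

lemma primitive_at_bot:
  fixes h :: "real \<Rightarrow> real"
  assumes h: "integrable lborel h"
  shows "((\<lambda>y. LINT x:{..y}|lborel. h x) \<longlongrightarrow> 0) at_bot"
  unfolding filterlim_at_bot_mirror set_lebesgue_integral_def
proof -
  have "((\<lambda>y. LINT x|lborel. indicat_real {..- y} x *\<^sub>R h x) \<longlongrightarrow> (LINT x|(lborel :: real measure). (0::real))) at_top"
  proof (rule integral_dominated_convergence_at_top[where w="\<lambda>x. \<bar>h x\<bar>"])
    show "AE x in lborel. ((\<lambda>y. indicat_real {..- y} x *\<^sub>R h x) \<longlongrightarrow> 0) at_top"
    proof (intro always_eventually allI)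
      fix x
      have "\<forall>\<^sub>F y in at_top. 0 = indicat_real {..- y} x *\<^sub>R h x"
        using eventually_gt_at_top[of "- x"] by eventually_elim auto
      thus "((\<lambda>y. indicat_real {..- y} x *\<^sub>R h x) \<longlongrightarrow> 0) at_top"
        by (rule Lim_transform_eventually[OF tendsto_const])
    qed
  qed (use h in \<open>auto simp: indicator_def intro!: always_eventually\<close>)
  thus "((\<lambda>y. LINT x|lborel. indicat_real {..- y} x *\<^sub>R h x) \<longlongrightarrow> 0) at_top" by simp
qed

text \<open>
  The integrals over \<open>{y..}\<close> are the mass minus the primitive, so their supremum is the mass minus the
  infimum of the primitive. Both parameters are nonnegative because the infimum is at most the limits
  \<open>0\<close> and \<open>M\<close> of the primitive.
\<close>

lemma wave_parameters:
  fixes h :: "real \<Rightarrow> real"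
  assumes h: "integrable lborel h"
    and p: "p = - 2 * (INF y. LINT x:{..y}|lborel. h x)"
    and q: "q = 2 * (SUP y. LINT x:{y..}|lborel. h x)"
  shows "0 \<le> p" "0 \<le> q" "(LINT x|lborel. h x) = (q - p) / 2"
    "- p / 2 \<le> (LINT x:{..y}|lborel. h x)"
    "\<epsilon> > 0 \<Longrightarrow> \<exists>y. (LINT x:{..y}|lborel. h x) < - p / 2 + \<epsilon>"
proof -
  define H where "H y = (LINT x:{..y}|lborel. h x)" for y
  define M where "M = (LINT x|lborel. h x)"
  define I where "I = (INF y. H y)"
  have bnd: "\<bar>H y\<bar> \<le> (LINT x|lborel. \<bar>h x\<bar>)" for y unfolding H_def by (rule primitive_bound[OF h])
  have bb: "bdd_below (range H)"
    by (rule bdd_belowI2[of _ "- (LINT x|lborel. \<bar>h x\<bar>)"]) (use bnd in \<open>simp add: abs_le_iff minus_le_iff\<close>)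
  have I: "I \<le> H y" for y unfolding I_def by (rule cINF_lower[OF bb]) simp
  have pI: "p = - 2 * I" using p by (simp add: I_def H_def)
  have I0: "I \<le> 0" using primitive_at_bot[OF h]
    by (rule tendsto_lowerbound) (use I in \<open>auto simp: H_def trivial_limit_at_bot_linorder\<close>)
  have IM: "I \<le> M" using primitive_at_top[OF h, folded M_def]
    by (rule tendsto_lowerbound) (use I in \<open>auto simp: H_def\<close>)
  have SU: "(SUP y. LINT x:{y..}|lborel. h x) = M - I"
  proof -
    have eq: "(LINT x:{y..}|lborel. h x) = M - H y" for y
      unfolding H_def M_def by (rule LINT_upper_half[OF h])
    have ba: "bdd_above (range (\<lambda>y. M - H y))"
      by (rule bdd_aboveI2[of _ _ "M - I"]) (use I in simp)
    have "(SUP y. M - H y) \<le> M - I" by (rule cSUP_least) (use I in auto)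
    moreover have "M - (SUP y. M - H y) \<le> I"
      unfolding I_def
    proof (rule cINF_greatest)
      show "M - (SUP y. M - H y) \<le> H y" for y using cSUP_upper[OF _ ba, of y] by simp
    qed simp
    ultimately show ?thesis unfolding eq by simp
  qed
  have qI: "q = 2 * (M - I)" unfolding q SU ..
  show "0 \<le> p" "0 \<le> q" "(LINT x|lborel. h x) = (q - p) / 2" "- p / 2 \<le> (LINT x:{..y}|lborel. h x)"
    using I0 IM I[of y] pI qI by (auto simp: M_def[symmetric] H_def[symmetric])
  show "\<exists>y. (LINT x:{..y}|lborel. h x) < - p / 2 + \<epsilon>" if "\<epsilon> > 0"
  proof (rule ccontr)
    assume "\<not> ?thesis"
    hence "I + \<epsilon> \<le> H y" for y unfolding H_def pI by (simp add: not_less)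
    hence "I + \<epsilon> \<le> I" unfolding I_def by (intro cINF_greatest) auto
    thus False using that by simp
  qed
qed

theorem theorem1:
  fixes m M p q :: real
    and h :: "real \<Rightarrow> real"
    and w :: "real \<Rightarrow> real \<Rightarrow> real \<Rightarrow> real"
  assumes "m > 3/2"
    and "h \<in> weighted_L2 m"
    and "M = (LINT \<xi>|lborel. h \<xi>)"
    and "p = - 2 * (INF y. LINT x:{..y}|lborel. h x)"
    and "q = 2 * (SUP y. LINT x:{y..}|lborel. h x)"
    and "\<And>\<mu>. \<mu> > 0 \<Longrightarrow> rescaled_Burgers_solution m \<mu> h (w \<mu>)"
  shows "\<forall>\<delta>>0. \<exists>\<mu>0 C. 0 < \<mu>0 \<and> \<mu>0 < 1 \<and> C > 0 \<and>
           (\<forall>\<mu>. 0 < \<mu> \<and> \<mu> < \<mu>0 \<longrightarrow>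
              (\<exists>T. 0 < T \<and> T \<le> C * \<bar>ln \<mu>\<bar> \<and>
                 weighted_L2_norm m (\<lambda>\<xi>. w \<mu> \<xi> T - N_wave p q \<xi>) \<le> \<delta>))"
proof (intro allI impI)
  fix \<delta> :: real assume \<delta>: "\<delta> > 0"
  define H where "H y = (LINT x:{..y}|lborel. h x)" for y
  define A where "A = (LINT x|lborel. \<bar>h x\<bar>)"
  define E0 where "E0 = 4 + 4 * weighted_L2_sq m h"
  have hi: "integrable lborel h" using weighted_L2_imp_L1(1)[of m h] assms(1,2) by simp
  note par = wave_parameters[OF hi assms(4,5)]
  have pq: "0 \<le> p" "0 \<le> q" using par by auto
  have sp: "0 \<le> sqrt p" "0 \<le> sqrt q" using pq by auto
  have A0: "A \<ge> 0" unfolding A_def by (intro integral_nonneg_AE) auto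
  define R where "R = 2 * (1 + 4/3 * (2 * A + 1/2)) + sqrt p + sqrt q"
  have R: "2 * (1 + 4/3 * (2 * A + 1/2)) \<le> R" "sqrt p < R" "sqrt q < R" "0 < R"
  proof -
    define b where "b = 4/3 * (2 * A + 1/2)"
    have b: "0 \<le> b" using A0 by (simp add: b_def)
    have Rb: "R = 2 + 2 * b + sqrt p + sqrt q" "2 * (1 + 4/3 * (2 * A + 1/2)) = 2 + 2 * b"
      unfolding R_def b_def[symmetric] by simp_all
    show "2 * (1 + 4/3 * (2 * A + 1/2)) \<le> R" "sqrt p < R" "sqrt q < R" "0 < R"
      unfolding Rb by (use sp b in linarith)+
  qed
  let ?K = "2 * (2 * A + 1/2) + sqrt p + sqrt q"
  define c where "c = (1 + R\<^sup>2) powr m * (18 * R + 4 * ?K\<^sup>2)"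
  have c0: "c \<ge> 0" unfolding c_def using R by (intro mult_nonneg_nonneg add_nonneg_nonneg) auto
  \<comment> \<open>the order of choices: \<open>R\<close>, then the tangent length \<open>d\<close>, then the accuracy \<open>\<epsilon>\<close> of \<open>W\<close>, then the
    time \<open>ln \<sigma>\<close>, and the viscosity last\<close>
  define d where "d = min 1 (\<delta>\<^sup>2 / 2 / (c + 1))"
  have d: "0 < d" "d \<le> 1" using \<delta> c0 by (auto simp: d_def)
  have cd: "(1 + R\<^sup>2) powr m * (18 * R * d\<^sup>2 + 4 * d * ?K\<^sup>2) \<le> \<delta>\<^sup>2 / 2"
  proof -
    have "d\<^sup>2 \<le> d" using d by (simp add: power2_eq_square mult_left_le)
    hence "18 * R * d\<^sup>2 \<le> 18 * R * d" using R by (intro mult_left_mono) auto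
    hence "(1 + R\<^sup>2) powr m * (18 * R * d\<^sup>2 + 4 * d * ?K\<^sup>2)
      \<le> (1 + R\<^sup>2) powr m * (18 * R * d + 4 * d * ?K\<^sup>2)"
      by (rule mult_left_mono[OF add_right_mono]) simp
    also have "\<dots> = d * c" by (simp add: c_def algebra_simps)
    also have "\<dots> \<le> d * (c + 1)" using d by simp
    also have "\<dots> \<le> \<delta>\<^sup>2 / 2 / (c + 1) * (c + 1)" using c0 by (intro mult_right_mono) (auto simp: d_def)
    also have "\<dots> = \<delta>\<^sup>2 / 2"
    proof -
      have "a / k * k = a" if "k > 0" for a k :: real using that by simp
      thus ?thesis using c0 by (simp only: add_nonneg_pos zero_less_one)
    qed
    finally show ?thesis .
  qed
  define \<epsilon> where "\<epsilon> = d\<^sup>2 / 3"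
  have \<epsilon>: "\<epsilon> > 0" using d by (simp add: \<epsilon>_def)
  have Hp: "- p / 2 \<le> H y" for y unfolding H_def by (rule par(4))
  obtain y1 where y1: "H y1 < - p / 2 + \<epsilon>" using par(5)[OF \<epsilon>] by (auto simp: H_def)
  have "isCont H y1"
    using primitive_continuous[OF hi] by (simp add: H_def[abs_def] continuous_on_eq_continuous_at)
  hence "\<forall>\<^sub>F y in nhds y1. H y < - p / 2 + \<epsilon>"
    using y1 by (intro order_tendstoD(2)) (auto simp: isCont_def tendsto_at_iff_tendsto_nhds)
  then obtain r0 where r0: "r0 > 0" "\<And>y. dist y y1 < r0 \<Longrightarrow> H y < - p / 2 + \<epsilon>"
    by (auto simp: eventually_nhds_metric)
  define r where "r = r0 / 2"
  have r: "r > 0" and Hm: "\<And>y. \<bar>y - y1\<bar> \<le> r \<Longrightarrow> H y \<le> - p / 2 + \<epsilon>"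
    using r0 by (auto simp: r_def dist_real_def intro!: less_imp_le)
  have "(H \<longlongrightarrow> 0) at_bot" "(H \<longlongrightarrow> (q - p) / 2) at_top"
    using primitive_at_bot[OF hi] primitive_at_top[OF hi] par(3) by (simp_all add: H_def[abs_def])
  hence "\<forall>\<^sub>F y in at_bot. dist (H y) 0 < \<epsilon>" "\<forall>\<^sub>F y in at_top. dist (H y) ((q - p) / 2) < \<epsilon>"
    using tendstoD[OF _ \<epsilon>] by blast+
  then obtain Y1 Y2 where Y1: "\<And>y. y \<le> Y1 \<Longrightarrow> dist (H y) 0 < \<epsilon>" and Y2: "\<And>y. Y2 \<le> y \<Longrightarrow> dist (H y) ((q - p) / 2) < \<epsilon>"
    by (auto simp: eventually_at_bot_linorder eventually_at_top_linorder)
  define Y where "Y = max 0 (max (- Y1) Y2)"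
  have Y: "0 \<le> Y" by (simp add: Y_def)
  have Hl: "- \<epsilon> \<le> H y" "H y \<le> \<epsilon>" if "y \<le> - Y" for y
  proof -
    have "y \<le> Y1" using that unfolding Y_def by linarith
    hence "\<bar>H y\<bar> < \<epsilon>" using Y1[of y] by (simp add: dist_real_def)
    thus "- \<epsilon> \<le> H y" "H y \<le> \<epsilon>" by linarith+
  qed
  have Hr: "(q - p) / 2 - \<epsilon> \<le> H y" "H y \<le> (q - p) / 2 + \<epsilon>" if "Y \<le> y" for y
  proof -
    have "dist (H y) ((q - p) / 2) < \<epsilon>" using that by (intro Y2) (auto simp: Y_def)
    thus "(q - p) / 2 - \<epsilon> \<le> H y" "H y \<le> (q - p) / 2 + \<epsilon>" unfolding dist_real_def by linarith+
  qed
  define k where "k = \<bar>y1\<bar> + r"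
  have k: "k \<ge> 0" using r by (simp add: k_def)
  define C1 where "C1 = 8 powr m * (exp (8 * m\<^sup>2) * (3 * E0))"
  \<comment> \<open>as \<open>(a + b * sqrt \<sigma>) / (2 * (\<sigma> - 1))\<close> is at most \<open>(a + b) / sqrt \<sigma>\<close> for \<open>\<sigma> \<ge> 2\<close>, each smallness
    condition on \<open>\<sigma>\<close> is a lower bound for \<open>sqrt \<sigma>\<close>\<close>
  define N where "N = max (Y * (R + 1) / \<epsilon>) (max ((Y + 2 * r)\<^sup>2 / \<epsilon>) (((R + 1)\<^sup>2 + 2 * (R + 1) * k + k\<^sup>2) / \<epsilon>))"
  have "((\<lambda>\<sigma>. C1 * \<sigma> powr (1/2 - m)) \<longlongrightarrow> C1 * 0) at_top"
    using assms(1) by (intro tendsto_mult_left tendsto_neg_powr filterlim_ident) auto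
  hence "\<forall>\<^sub>F \<sigma> in at_top. C1 * \<sigma> powr (1/2 - m) < \<delta>\<^sup>2 / 2"
    by (rule order_tendstoD(2)) (use \<delta> in simp)
  moreover have "\<forall>\<^sub>F \<sigma>::real in at_top. N \<le> sqrt \<sigma>"
    using sqrt_at_top by (auto simp: filterlim_at_top)
  ultimately have "\<forall>\<^sub>F \<sigma> in at_top. C1 * \<sigma> powr (1/2 - m) < \<delta>\<^sup>2 / 2 \<and> N \<le> sqrt \<sigma> \<and> 2 \<le> \<sigma>"
    using eventually_ge_at_top[of "2::real"] by eventually_elim auto
  then obtain \<sigma> where tail: "C1 * \<sigma> powr (1/2 - m) < \<delta>\<^sup>2 / 2" and N\<sigma>: "N \<le> sqrt \<sigma>" and \<sigma>: "2 \<le> \<sigma>"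
    using eventually_happens'[of "at_top :: real filter"] by auto
  have s: "1 \<le> sqrt \<sigma>" "(sqrt \<sigma>)\<^sup>2 = \<sigma>" using \<sigma> by auto
  have over: "(a + b * sqrt \<sigma>) / (2 * (\<sigma> - 1)) \<le> \<epsilon>" if ab: "0 \<le> a" "0 \<le> b" "(a + b) / \<epsilon> \<le> sqrt \<sigma>" for a b
  proof -
    have "a + b * sqrt \<sigma> \<le> (a + b) * sqrt \<sigma>"
      using ab s mult_left_mono[of 1 "sqrt \<sigma>" a] by (simp add: algebra_simps)
    also have "\<dots> \<le> (\<epsilon> * sqrt \<sigma>) * sqrt \<sigma>"
      using ab \<epsilon> s by (intro mult_right_mono) (auto simp: divide_le_eq mult.commute)
    also have "\<dots> = \<epsilon> * \<sigma>" using s(2) by (simp add: power2_eq_square)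
    also have "\<dots> \<le> \<epsilon> * (2 * (\<sigma> - 1))" using \<epsilon> \<sigma> by (intro mult_left_mono) auto
    finally show ?thesis using \<sigma> by (simp add: divide_le_eq)
  qed
  have small1: "Y * (R + 1) \<le> \<epsilon> * sqrt \<sigma>"
    using N\<sigma> \<epsilon> by (simp add: N_def divide_le_eq mult.commute)
  have small2: "(Y + 2 * r)\<^sup>2 / (2 * (\<sigma> - 1)) \<le> \<epsilon>"
    using over[of "(Y + 2 * r)\<^sup>2" 0] N\<sigma> by (simp add: N_def)
  have small3: "((R + 1)\<^sup>2 + 2 * sqrt \<sigma> * (R + 1) * (\<bar>y1\<bar> + r) + (\<bar>y1\<bar> + r)\<^sup>2) / (2 * (\<sigma> - 1)) \<le> \<epsilon>"
    unfolding k_def[symmetric] using over[of "(R + 1)\<^sup>2 + k\<^sup>2" "2 * (R + 1) * k"] N\<sigma> R(4) k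
    by (simp add: N_def algebra_simps)
  have ln: "ln \<sigma> > 0" using \<sigma> by simp
  define \<mu>0 where "\<mu>0 = min (1/2) (min (1 / \<sigma>) (min (\<epsilon> / ln \<sigma>) (\<epsilon> * r\<^sup>2 / (pi * (\<sigma> - 1)))))"
  have \<mu>0: "0 < \<mu>0" "\<mu>0 < 1" using \<sigma> \<epsilon> r ln by (auto simp: \<mu>0_def)
  have ln0: "ln \<mu>0 < 0" using \<mu>0 by simp
  have main: "weighted_L2_norm m (\<lambda>\<xi>. w \<mu> \<xi> (ln \<sigma>) - N_wave p q \<xi>) \<le> \<delta>"
    if \<mu>: "0 < \<mu>" "\<mu> < \<mu>0" for \<mu>
  proof -
    from unscaled_solution[OF assms(1,2) \<mu>(1) assms(6)[OF \<mu>(1)]] obtain ux uxx where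
      "weighted_burgers \<mu> (\<lambda>x t. w \<mu> (x / sqrt (1 + t)) (ln (1 + t)) / sqrt (1 + t)) ux uxx
        (\<lambda>y. LINT x:{..y}|lborel. h x) (LINT x|lborel. \<bar>h x\<bar>) m (4 + 4 * weighted_L2_sq m h)" .
    hence "weighted_burgers \<mu> (\<lambda>x t. w \<mu> (x / sqrt (1 + t)) (ln (1 + t)) / sqrt (1 + t)) ux uxx H A m E0"
      by (simp add: H_def[abs_def] A_def E0_def)
    then interpret B: weighted_burgers \<mu> "\<lambda>x t. w \<mu> (x / sqrt (1 + t)) (ln (1 + t)) / sqrt (1 + t)" ux uxx H A m E0 .
    have "\<mu> \<le> 1 / \<sigma>" "\<mu> \<le> \<epsilon> / ln \<sigma>" "\<mu> \<le> \<epsilon> * r\<^sup>2 / (pi * (\<sigma> - 1))" using \<mu> by (auto simp: \<mu>0_def)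
    hence small: "\<mu> * \<sigma> \<le> 1" "\<mu> * ln \<sigma> \<le> \<epsilon>" "\<mu> * (pi * (\<sigma> - 1)) \<le> \<epsilon> * r\<^sup>2"
      using \<sigma> ln by (auto simp: le_divide_eq)
    have small4: "\<mu>\<^sup>2 * pi * (\<sigma> - 1) / r\<^sup>2 \<le> \<epsilon>"
    proof -
      have "\<mu>\<^sup>2 * (pi * (\<sigma> - 1)) \<le> \<mu> * (pi * (\<sigma> - 1))"
        using \<mu> \<mu>0 \<sigma> by (intro mult_right_mono) (auto simp: power2_eq_square mult_left_le)
      also note small(3)
      finally show ?thesis using r by (simp add: divide_le_eq mult.assoc)
    qed
    have "weighted_L2_sq m (\<lambda>\<xi>. sqrt \<sigma> * (w \<mu> (sqrt \<sigma> * \<xi> / sqrt (1 + (\<sigma> - 1))) (ln (1 + (\<sigma> - 1))) / sqrt (1 + (\<sigma> - 1))) - N_wave p q \<xi>)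
      \<le> (1 + R\<^sup>2) powr m * (18 * R * d\<^sup>2 + 4 * d * ?K\<^sup>2)
         + 8 powr m * (exp (8 * m\<^sup>2) * (3 * E0)) * \<sigma> powr (1/2 - m)"
    proof (rule B.distance_to_wave[OF \<sigma> small(1) pq d R(1,2,3)])
      fix \<xi> assume \<xi>: "\<bar>\<xi>\<bar> \<le> R + 1"
      have "wave_primitive p q \<xi> - 2 * \<epsilon> \<le> B.W (sqrt \<sigma> * \<xi>) (\<sigma> - 1)"
        by (rule B.W_above_wave[OF _ pq Y Hp Hl(1) Hr(1) \<xi> small1 small(2)]) (use \<sigma> \<epsilon> in auto)
      moreover have "B.W (sqrt \<sigma> * \<xi>) (\<sigma> - 1) \<le> wave_primitive p q \<xi> + 3 * \<epsilon>"
        by (rule B.W_below_wave[OF _ pq Y r Hm Hl(2) Hr(2) \<xi> small2 small3 small4]) (use \<sigma> in auto)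
      ultimately have "\<bar>B.W (sqrt \<sigma> * \<xi>) (\<sigma> - 1) - wave_primitive p q \<xi>\<bar> \<le> 3 * \<epsilon>" using \<epsilon> by linarith
      thus "\<bar>B.W (sqrt \<sigma> * \<xi>) (\<sigma> - 1) - wave_primitive p q \<xi>\<bar> \<le> d\<^sup>2" by (simp add: \<epsilon>_def)
    qed
    also have "\<dots> \<le> \<delta>\<^sup>2 / 2 + \<delta>\<^sup>2 / 2" using cd tail unfolding C1_def by (intro add_mono) auto
    finally have "weighted_L2_sq m (\<lambda>\<xi>. w \<mu> \<xi> (ln \<sigma>) - N_wave p q \<xi>) \<le> \<delta>\<^sup>2"
      using \<sigma> by simp
    thus ?thesis unfolding weighted_L2_norm_def using \<delta> by (intro real_le_lsqrt) auto
  qed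
  show "\<exists>\<mu>0 C. 0 < \<mu>0 \<and> \<mu>0 < 1 \<and> C > 0 \<and>
           (\<forall>\<mu>. 0 < \<mu> \<and> \<mu> < \<mu>0 \<longrightarrow>
              (\<exists>T. 0 < T \<and> T \<le> C * \<bar>ln \<mu>\<bar> \<and>
                 weighted_L2_norm m (\<lambda>\<xi>. w \<mu> \<xi> T - N_wave p q \<xi>) \<le> \<delta>))"
  proof (rule exI[of _ \<mu>0], rule exI[of _ "ln \<sigma> / \<bar>ln \<mu>0\<bar>"], intro conjI allI impI)
    show "0 < ln \<sigma> / \<bar>ln \<mu>0\<bar>" using ln ln0 by (intro divide_pos_pos) auto
    fix \<mu> assume \<mu>: "0 < \<mu> \<and> \<mu> < \<mu>0"
    have "\<bar>ln \<mu>0\<bar> \<le> \<bar>ln \<mu>\<bar>" using \<mu> \<mu>0 ln0 by (simp add: abs_if)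
    hence "ln \<sigma> / \<bar>ln \<mu>0\<bar> * \<bar>ln \<mu>0\<bar> \<le> ln \<sigma> / \<bar>ln \<mu>0\<bar> * \<bar>ln \<mu>\<bar>" using ln by (intro mult_left_mono) auto
    hence "ln \<sigma> \<le> ln \<sigma> / \<bar>ln \<mu>0\<bar> * \<bar>ln \<mu>\<bar>" using ln0 by simp
    thus "\<exists>T. 0 < T \<and> T \<le> ln \<sigma> / \<bar>ln \<mu>0\<bar> * \<bar>ln \<mu>\<bar> \<and>
       weighted_L2_norm m (\<lambda>\<xi>. w \<mu> \<xi> T - N_wave p q \<xi>) \<le> \<delta>"
      using main[of \<mu>] \<mu> ln by blast
  qed (use \<mu>0 in auto)
qed

end
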